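(* Let $a,b>0$, $p\in\mathbb{R}$, $p\neq 0$, and let $q_1\in L^2(-a,0)$, $q_2\in L^2(0,b)$ be real-valued. Let $k,\rho,r,\delta_1,\delta_2$ and the characteristic functions $\Delta(0,\lambda)$ (of the unperturbed operator $L_0$) and $\Delta(q,\lambda)$ (of the perturbed operator $L_q$) be as defined in the context. Suppose that $$2\delta_1+\frac{4\delta_2(a+b)}{\pi-2r}<(1+p^2)\,\frac{\rho^2r^2}{1+|k|}.$$ Then for each zero $\lambda_s(0)$ of $\Delta(0,\lambda)$, the neighborhood $$|\lambda-\lambda_s(0)|<\frac{2\delta_1+\frac{4\delta_2(a+b)}{\pi-2r}}{(1+p^2)(a+b)|\rho|\,r}$$ contains exactly one zero $\lambda_s(q)$ of $\Delta(q,\lambda)$.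
   Context: Operator: in $H=L^2(-a,0)\oplus L^2(0,b)$ let $L_q y=(-y_1''+q_1y_1,\,-y_2''+q_2y_2)$ for $y=(y_1,y_2)$, on the domain of $y$ with $y_1\in W^2_2(-a,0)$, $y_2\in W_2^2(0,b)$, $y_1'(-a)=0$, $y_2'(b)=0$, $y_2(0)+p\,y_1(0)=0$, $y_1'(0)+p\,y_2'(0)=0$. $L_0$ is the case $q_1=q_2=0$. The spectral parameter is $\lambda^2$. Constants: $k=\frac{1-p^2}{1+p^2}$, $\rho=\frac{b-a}{b+a}$, $r=(1-|\rho|)(1-|k|)$. With $\sigma_1=\int_{-a}^0|q_1(t)|\,dt$, $\sigma_2=\int_0^b|q_2(t)|\,dt$, $$\delta_1=\sigma_1ae^{\sigma_1a}+\sigma_2be^{\sigma_2b},\qquad \delta_2=\sigma_1e^{\sigma_1a}+\sigma_2e^{\sigma_2b}+\sigma_1\sigma_2(a+b)e^{\sigma_1a+\sigma_2b}.$$ Unperturbed characteristic function: $\Delta(0,\lambda)=\lambda p^2\cos\lambda a\,\sin\lambda b+\lambda\cos\lambda b\,\sin\lambda a$. Perturbed characteristic function: for $\lambda\in\mathbb{C}$ put $K_{1,1}(x,t)=\frac{\sin\lambda(x-t)}{\lambda}$ for $-a\le t\le x\le 0$ and $K_{1,n+1}(x,t)=\int_t^x\frac{\sin\lambda(x-s)}{\lambda}K_{1,n}(s,t)q_1(s)\,ds$; $K_{2,1}(x,t)=\frac{\sin\lambda(x-t)}{\lambda}$ for $0\le x\le t\le b$ and $K_{2,n+1}(x,t)=\int_x^t\frac{\sin\lambda(x-s)}{\lambda}K_{2,n}(s,t)q_2(s)\,ds$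 ($n\ge1$; for $\lambda=0$ read $\frac{\sin\lambda u}{\lambda}$ as $u$). Put $N_1(x,t,\lambda)=\sum_{n\ge1}K_{1,n}(x,t)$, $N_2(x,t,\lambda)=\sum_{n\ge1}(-1)^{n-1}K_{2,n}(x,t)$, and let $N_k'=\partial N_k/\partial x$. Then $$\Delta(q,\lambda)=\begin{vmatrix} p\left(\cos\lambda a+\int_{-a}^0N_1(0,t,\lambda)q_1(t)\cos\lambda(t+a)\,dt\right) & \cos\lambda b-\int_0^bN_2(0,t,\lambda)q_2(t)\cos\lambda(b-t)\,dt\\ -\lambda\sin\lambda a+\int_{-a}^0N_1'(0,t,\lambda)q_1(t)\cos\lambda(t+a)\,dt & p\left(\lambda\sin\lambda b-\int_0^bN_2'(0,t,\lambda)q_2(t)\cos\lambda(b-t)\,dt\right)\end{vmatrix}.$$ Here $q$ in $\Delta(q,\lambda)$ stands for the pair $(q_1,q_2)$.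
   Formalization: The formal theorem concerns only nonzero zeros λ_s(0) of Δ(0,λ) and assumes q_1, q_2 are not both zero almost everywhere: at λ_s(0)=0 the claim can fail (a=1, b=3, p=1, q_1=q_2=0.0001), and for q=0 the neighborhood is empty. *)

theory Defs
  imports "HOL-Analysis.Analysis"
begin

definition square_integrable_on :: "(real \<Rightarrow> real) \<Rightarrow> real set \<Rightarrow> bool" where
  "square_integrable_on f S \<longleftrightarrow>
     set_borel_measurable lebesgue S f \<and> set_integrable lebesgue S (\<lambda>t. (f t)\<^sup>2)"

definition k_par :: "real \<Rightarrow> real" where
  "k_par p = (1 - p\<^sup>2) / (1 + p\<^sup>2)"

definition rho_par :: "real \<Rightarrow> real \<Rightarrow> real" where
  "rho_par a b = (b - a) / (b + a)"

definition r_par :: "real \<Rightarrow> real \<Rightarrow> real \<Rightarrow> real" where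
  "r_par a b p = (1 - \<bar>rho_par a b\<bar>) * (1 - \<bar>k_par p\<bar>)"

definition sigma1 :: "real \<Rightarrow> (real \<Rightarrow> real) \<Rightarrow> real" where
  "sigma1 a q1 = (LINT t:{-a..0}|lebesgue. \<bar>q1 t\<bar>)"

definition sigma2 :: "real \<Rightarrow> (real \<Rightarrow> real) \<Rightarrow> real" where
  "sigma2 b q2 = (LINT t:{0..b}|lebesgue. \<bar>q2 t\<bar>)"

definition delta1 :: "real \<Rightarrow> real \<Rightarrow> (real \<Rightarrow> real) \<Rightarrow> (real \<Rightarrow> real) \<Rightarrow> real" where
  "delta1 a b q1 q2 =
     sigma1 a q1 * a * exp (sigma1 a q1 * a) + sigma2 b q2 * b * exp (sigma2 b q2 * b)"

definition delta2 :: "real \<Rightarrow> real \<Rightarrow> (real \<Rightarrow> real) \<Rightarrow> (real \<Rightarrow> real) \<Rightarrow> real" where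
  "delta2 a b q1 q2 =
     sigma1 a q1 * exp (sigma1 a q1 * a) + sigma2 b q2 * exp (sigma2 b q2 * b)
     + sigma1 a q1 * sigma2 b q2 * (a + b) * exp (sigma1 a q1 * a + sigma2 b q2 * b)"

definition char_unperturbed :: "real \<Rightarrow> real \<Rightarrow> real \<Rightarrow> complex \<Rightarrow> complex" where
  "char_unperturbed a b p z =
     z * (of_real p)\<^sup>2 * cos (z * of_real a) * sin (z * of_real b)
     + z * cos (z * of_real b) * sin (z * of_real a)"

definition sin_quot :: "complex \<Rightarrow> real \<Rightarrow> complex" where
  "sin_quot z u = (if z = 0 then of_real u else sin (z * of_real u) / z)"

(* The iterates are numbered from 0: K1 q z n is K_{1,n+1}, and likewise for K2.
   K1 is meant for t \<le> x, K2 for x \<le> t. *)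

primrec K1 :: "(real \<Rightarrow> real) \<Rightarrow> complex \<Rightarrow> nat \<Rightarrow> real \<Rightarrow> real \<Rightarrow> complex" where
  "K1 q z 0 x t = sin_quot z (x - t)"
| "K1 q z (Suc n) x t =
     (LINT s:{t..x}|lebesgue. sin_quot z (x - s) * K1 q z n s t * of_real (q s))"

primrec K2 :: "(real \<Rightarrow> real) \<Rightarrow> complex \<Rightarrow> nat \<Rightarrow> real \<Rightarrow> real \<Rightarrow> complex" where
  "K2 q z 0 x t = sin_quot z (x - t)"
| "K2 q z (Suc n) x t =
     (LINT s:{x..t}|lebesgue. sin_quot z (x - s) * K2 q z n s t * of_real (q s))"

definition N1 :: "(real \<Rightarrow> real) \<Rightarrow> real \<Rightarrow> real \<Rightarrow> complex \<Rightarrow> complex" where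
  "N1 q x t z = (\<Sum>n. K1 q z n x t)"

definition N2 :: "(real \<Rightarrow> real) \<Rightarrow> real \<Rightarrow> real \<Rightarrow> complex \<Rightarrow> complex" where
  "N2 q x t z = (\<Sum>n. (-1) ^ n * K2 q z n x t)"

(* Derivatives in x, taken within the interval on which the kernel is defined for
   the given t; at x = 0 they are one-sided. For t = 0 that interval is a single
   point and the value is unspecified, which concerns only a null set of t. *)

definition N1' :: "(real \<Rightarrow> real) \<Rightarrow> real \<Rightarrow> real \<Rightarrow> complex \<Rightarrow> complex" where
  "N1' q x t z = vector_derivative (\<lambda>y. N1 q y t z) (at x within {t..0})"

definition N2' :: "(real \<Rightarrow> real) \<Rightarrow> real \<Rightarrow> real \<Rightarrow> complex \<Rightarrow> complex" where
  "N2' q x t z = vector_derivative (\<lambda>y. N2 q y t z) (at x within {0..t})"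

definition char_perturbed ::
  "real \<Rightarrow> real \<Rightarrow> real \<Rightarrow> (real \<Rightarrow> real) \<Rightarrow> (real \<Rightarrow> real) \<Rightarrow> complex \<Rightarrow> complex" where
  "char_perturbed a b p q1 q2 z = det (vector
     [vector
        [of_real p * (cos (z * of_real a)
           + (LINT t:{-a..0}|lebesgue. N1 q1 0 t z * of_real (q1 t) * cos (z * of_real (t + a)))),
         cos (z * of_real b)
           - (LINT t:{0..b}|lebesgue. N2 q2 0 t z * of_real (q2 t) * cos (z * of_real (b - t)))],
      vector
        [- z * sin (z * of_real a)
           + (LINT t:{-a..0}|lebesgue. N1' q1 0 t z * of_real (q1 t) * cos (z * of_real (t + a))),
         of_real p * (z * sin (z * of_real b)
           - (LINT t:{0..b}|lebesgue. N2' q2 0 t z * of_real (q2 t) * cos (z * of_real (b - t))))]]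
     :: complex^2^2)"

end

theory Submission
  imports Defs "HOL-Complex_Analysis.Complex_Analysis"
begin

text \<open>
  Reflecting the second interval turns the determinant into
  \<open>- p\<^sup>2 U\<^sub>1 V\<^sub>2 - U\<^sub>2 V\<^sub>1\<close>, where \<open>U\<close> and \<open>V\<close> are the value and the slope at \<open>0\<close> of the
  solution with Neumann data at the outer endpoint. The hypothesis forces the potentials to be so
  small that the Neumann series of the kernels is dominated by a geometric series, which gives
  holomorphy of \<open>U\<close>, \<open>V\<close> and bounds for \<open>U - cos\<close> and \<open>V + z sin\<close>.

  Bounding \<open>\<Delta>(q) - \<Delta>(0)\<close> term by term loses a factor \<open>max 1 p\<^sup>2\<close>, which the hypothesis does not
  pay for. The loss is avoided by using the equation satisfied by the unperturbed zero: it
  expresses \<open>cos az\<^sub>0\<close>, \<open>sin az\<^sub>0\<close> through \<open>cos bz\<^sub>0\<close>, \<open>sin bz\<^sub>0\<close> and shows that the large coefficients of the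
  error are matched by the derivative of \<open>\<Delta>(0)/z\<close> at \<open>z\<^sub>0\<close>. Exchanging the two intervals replaces
  \<open>p\<close> by \<open>1/p\<close>, so one may assume \<open>p\<^sup>2 \<ge> 1\<close>. On the bounding circle \<open>\<Delta>(q)/z\<close> then differs from its
  linearisation \<open>k (z - z\<^sub>0)\<close> by less than \<open>|k|\<close> times the radius, and the claim follows from Rouche's
  theorem.
\<close>

subsection \<open>Complex analysis\<close>

text \<open>Let M be the numerator of the radius and g = |rho| (1 - |rho|). For p^2 >= 1, after
  scaling lengths by a + b, the radius is M / (2 g) and the hypothesis says that p^2 times this
  radius is below g. Since delta1 >= sigma1 a + sigma2 b, delta2 >= sigma1 + sigma2 and pi - 2 r <=
  pi, M dominates a linear form in sigma1 and sigma2. The error in the characteristic function,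
  divided by the spectral parameter, is also linear in these weights up to one mixed product. Hence
  the estimate splits into two inequalities, one for the coefficient of each weight, which have to
  hold uniformly in the lengths, in p and in the unperturbed zero. They hold with little to spare,
  which explains the explicit rational constants. Two facts keep the constants small: nonzero
  unperturbed zeros are real and of modulus at least pi / (2 (a + b)), so that the reciprocal of the
  spectral parameter stays bounded on the circle; and g <= 1/4 bounds the scaled radius and with it
  all exponential factors.\<close>

lemma ex1_zero_near_linear:
  fixes F :: "complex \<Rightarrow> complex"
  assumes hol: "F holomorphic_on ball z0 R'" and R: "0 < R" "R < R'"
    and less: "\<And>z. cmod (z - z0) = R \<Longrightarrow> cmod (F z - (z - z0)) < R"
  shows "\<exists>!z. cmod (z - z0) < R \<and> F z = 0"
proof -
  let ?\<gamma> = "circlepath z0 R"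
  \<comment> \<open>An intermediate radius: the closure is compact in the domain of
    \<open>F\<close>, so \<open>F\<close> has finitely many zeros in \<open>?s\<close>. Zeros
    outside the circle have winding number 0 and drop out of the count.\<close>
  let ?s = "ball z0 ((R + R') / 2)"
  have sub: "?s \<subseteq> ball z0 R'" using R by (intro subset_ball) simp
  have nz: "F z \<noteq> 0" if "cmod (z - z0) = R" for z
    using less[OF that] that by (auto simp: norm_minus_commute)
  have ex0: "\<exists>w\<in>ball z0 r. F w \<noteq> 0" if "R < r" for r
    using that R by (intro bexI[of _ "z0 + of_real R"] nz) (auto simp: dist_norm)
  have fin: "finite {p \<in> ?s. F p = 0}"
  proof (cases "F constant_on ball z0 R'")
    case True
    then have "F p \<noteq> 0" if "p \<in> ball z0 R'" for p
      using ex0[OF R(2)] that unfolding constant_on_def by metis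
    then have "{p \<in> ?s. F p = 0} = {}" using sub by blast
    then show ?thesis by (metis finite.emptyI)
  next
    case False
    have "finite {p \<in> cball z0 ((R + R') / 2). F p = 0}"
      by (rule holomorphic_compact_finite_zeros[OF hol]) (use False R in auto)
    then show ?thesis by (rule rev_finite_subset) auto
  qed
  have img: "path_image ?\<gamma> = sphere z0 R" using R by simp
  have out: "winding_number ?\<gamma> w = 0" if "cmod (w - z0) > R" for w
    by (rule winding_number_zero_outside[where s = "cball z0 R"])
       (use that R in \<open>auto simp: dist_norm norm_minus_commute\<close>)
  define Z where "Z = {p \<in> ball z0 R. F p = 0}"
  have Zs: "Z \<subseteq> {p \<in> ?s. F p = 0}" using R by (auto simp: Z_def)
  have "(\<Sum>p | p \<in> ?s \<and> (p - z0) + (F p - (p - z0)) = 0.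
          winding_number ?\<gamma> p * complex_of_int (zorder (\<lambda>p. (p - z0) + (F p - (p - z0))) p))
      = (\<Sum>p | p \<in> ?s \<and> p - z0 = 0. winding_number ?\<gamma> p * complex_of_int (zorder (\<lambda>p. p - z0) p))"
  proof (rule Rouche_theorem)
    show "finite {p \<in> ?s. p - z0 = 0}" by (rule finite_subset[of _ "{z0}"]) auto
    show "(\<lambda>p. F p - (p - z0)) holomorphic_on ?s"
      by (intro holomorphic_intros holomorphic_on_subset[OF hol] sub)
    show "\<forall>z\<in>path_image ?\<gamma>. cmod (F z - (z - z0)) < cmod (z - z0)"
      using less R by (auto simp: img dist_norm norm_minus_commute)
    show "\<forall>z. z \<notin> ?s \<longrightarrow> winding_number ?\<gamma> z = 0"
      using R by (auto intro!: out simp: dist_norm norm_minus_commute)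
    show "path_image ?\<gamma> \<subseteq> ?s" using R by (auto simp: img)
  qed (use fin in \<open>auto intro!: holomorphic_intros\<close>)
  moreover have "{p \<in> ?s. p - z0 = 0} = {z0}" using R by auto
  moreover have "winding_number ?\<gamma> z0 = 1" using R by (simp add: winding_number_circlepath_centre)
  moreover have "zorder (\<lambda>p. p - z0) z0 = 1"
    by (rule zorder_eqI[where S = UNIV and g = "\<lambda>_. 1"]) auto
  ultimately have "(\<Sum>p\<in>{p \<in> ?s. F p = 0}. winding_number ?\<gamma> p * complex_of_int (zorder F p)) = 1"
    by simp
  also have "(\<Sum>p\<in>{p \<in> ?s. F p = 0}. winding_number ?\<gamma> p * complex_of_int (zorder F p))
      = (\<Sum>p\<in>Z. winding_number ?\<gamma> p * complex_of_int (zorder F p))"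
  proof (rule sum.mono_neutral_right[OF fin Zs])
    show "\<forall>i\<in>{p \<in> ?s. F p = 0} - Z. winding_number ?\<gamma> i * complex_of_int (zorder F i) = 0"
    proof
      fix i assume i: "i \<in> {p \<in> ?s. F p = 0} - Z"
      then have "cmod (i - z0) \<noteq> R" "\<not> cmod (i - z0) < R"
        using nz by (auto simp: Z_def dist_norm norm_minus_commute)
      then show "winding_number ?\<gamma> i * complex_of_int (zorder F i) = 0" using out[of i] by simp
    qed
  qed
  also have "\<dots> = (\<Sum>p\<in>Z. complex_of_int (zorder F p))"
    by (rule sum.cong) (auto simp: Z_def dist_norm norm_minus_commute winding_number_circlepath)
  finally have sum1: "(\<Sum>p\<in>Z. zorder F p) = 1"
    by (metis of_int_sum of_int_eq_1_iff)
  have pos: "zorder F p \<ge> 1" if "p \<in> Z" for p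
  proof -
    have "p \<in> ball z0 R'" "F p = 0" using that R by (auto simp: Z_def)
    then show ?thesis using zorder_exist_zero[OF hol _ _ _ ex0[OF R(2)], of p] by auto
  qed
  have "finite Z" using fin Zs finite_subset by blast
  \<comment> \<open>The orders add up to 1 and each is at least 1, so there is only one
    zero.\<close>
  then have "int (card Z) \<le> 1" using sum_bounded_below[of Z 1 "zorder F"] pos sum1 by simp
  moreover have "Z \<noteq> {}" using sum1 by auto
  ultimately have "card Z = 1" using \<open>finite Z\<close> by (simp add: Suc_leI card_gt_0_iff le_antisym)
  then obtain w where "Z = {w}" using card_1_singletonE by blast
  then have "w \<in> Z" "\<And>z. z \<in> Z \<Longrightarrow> z = w" by auto
  moreover have "z \<in> Z \<longleftrightarrow> cmod (z - z0) < R \<and> F z = 0" for z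
    by (simp add: Z_def dist_norm norm_minus_commute)
  ultimately show ?thesis by blast
qed

lemma norm_cos_le_exp_Im: "cmod (cos z) \<le> exp \<bar>Im z\<bar>"
  using cmod_cos_le_exp[of 1 z] by simp

text \<open>Mean value estimate along the segment from 0 to \<open>z\<close>, where the derivative
  \<open>cos\<close> is bounded by the exponential.\<close>

lemma norm_sin_le_exp_Im: "cmod (sin z) \<le> cmod z * exp \<bar>Im z\<bar>"
proof -
  have "norm (sin z - sin 0) \<le> exp \<bar>Im z\<bar> * norm (z - 0)"
  proof (rule field_differentiable_bound[where f' = cos and S = "closed_segment 0 z"])
    fix u assume "u \<in> closed_segment 0 z"
    then obtain t where t: "0 \<le> t" "t \<le> 1" "u = t *\<^sub>R z" by (auto simp: closed_segment_def)
    show "norm (cos u) \<le> exp \<bar>Im z\<bar>"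
      unfolding t(3) by (rule cmod_cos_le_exp) (use t in auto)
    show "(sin has_field_derivative cos u) (at u within closed_segment 0 z)"
      by (rule has_field_derivative_at_within) (rule DERIV_sin)
  qed auto
  then show ?thesis by (simp add: mult.commute)
qed

section \<open>Dominated integrals depending holomorphically on a parameter\<close>

lemma integrable_norm_bound:
  fixes f :: "'a \<Rightarrow> 'b :: {banach, second_countable_topology}"
  assumes "integrable M w" "f \<in> borel_measurable M" "\<And>x. norm (f x) \<le> w x"
  shows "integrable M f"
  by (rule Bochner_Integration.integrable_bound[OF assms(1,2)])
     (use assms(3) in \<open>auto intro!: AE_I2 order_trans[OF _ abs_ge_self]\<close>)

lemma norm_integral_le:
  fixes f :: "'a \<Rightarrow> 'b :: {banach, second_countable_topology}"
  assumes "integrable M w" "f \<in> borel_measurable M" "\<And>x. norm (f x) \<le> w x"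
  shows "norm (\<integral>x. f x \<partial>M) \<le> (\<integral>x. w x \<partial>M)"
  using assms integrable_norm_bound[OF assms]
  by (intro order_trans[OF integral_norm_bound] integral_mono integrable_norm) auto

text \<open>Only \<open>f\<close> is dominated, not its derivative: Cauchy's inequality on discs of
  fixed radius \<open>d\<close> turns the bound \<open>w\<close> into \<open>w / d\<close> for the
  derivative, hence for the difference quotients, and dominated convergence applies. The measure is
  arbitrary, so series are covered through counting measure.\<close>

lemma holomorphic_on_integral:
  fixes f :: "complex \<Rightarrow> 'a \<Rightarrow> complex"
  assumes A: "open A"
    and hol: "\<And>s. (\<lambda>z. f z s) holomorphic_on A"
    and meas: "\<And>z. z \<in> A \<Longrightarrow> f z \<in> borel_measurable M"
    and w: "integrable M w" and bound: "\<And>z s. z \<in> A \<Longrightarrow> cmod (f z s) \<le> w s"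
  shows "(\<lambda>z. \<integral>s. f z s \<partial>M) holomorphic_on A"
proof -
  have "(\<lambda>z. \<integral>s. f z s \<partial>M) field_differentiable (at z)" if z: "z \<in> A" for z
  proof -
    \<comment> \<open>With \<open>2 * d\<close> available, the disc of radius \<open>d\<close> about
      every point of \<open>ball z d\<close> stays inside \<open>A\<close>.\<close>
    obtain d where d: "d > 0" "cball z (2 * d) \<subseteq> A"
    proof -
      obtain d' where "d' > 0" "cball z d' \<subseteq> A" using A z open_contains_cball by blast
      then show ?thesis using that[of "d' / 2"] by auto
    qed
    let ?D = "\<lambda>s. deriv (\<lambda>z. f z s) z"
    have dq: "((\<lambda>u. (f u s - f z s) / (u - z)) \<longlongrightarrow> ?D s) (at z)" for s
      using holomorphic_derivI[OF hol A z] by (simp add: has_field_derivative_iff)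
    have lip: "cmod ((f u s - f z s) / (u - z)) \<le> w s / d" if u: "u \<in> ball z d" "u \<noteq> z" for u s
    proof -
      have "norm (f u s - f z s) \<le> w s / d * norm (u - z)"
      proof (rule field_differentiable_bound[where f = "\<lambda>z. f z s" and f' = "\<lambda>v. deriv (\<lambda>z. f z s) v" and S = "ball z d"])
        fix v assume v: "v \<in> ball z d"
        have sub: "cball v d \<subseteq> A"
        proof
          fix y assume "y \<in> cball v d"
          then have "dist z y \<le> 2 * d" using v dist_triangle[of z y v] by (auto simp: mem_ball)
          then show "y \<in> A" using d(2) by auto
        qed
        have vA: "v \<in> A" using sub d(1) by auto
        show "((\<lambda>z. f z s) has_field_derivative deriv (\<lambda>z. f z s) v) (at v within ball z d)"
          by (rule has_field_derivative_at_within) (rule holomorphic_derivI[OF hol A vA])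
        have "norm ((deriv ^^ 1) (\<lambda>z. f z s) v) \<le> fact 1 * w s / d ^ 1"
        proof (rule Cauchy_inequality)
          show "(\<lambda>z. f z s) holomorphic_on ball v d"
            by (rule holomorphic_on_subset[OF hol]) (use sub ball_subset_cball in blast)
          show "continuous_on (cball v d) (\<lambda>z. f z s)"
            by (rule holomorphic_on_imp_continuous_on, rule holomorphic_on_subset[OF hol]) (use sub in blast)
          show "\<And>x. cmod (v - x) = d \<Longrightarrow> cmod (f x s) \<le> w s"
            by (rule bound, rule subsetD[OF sub]) (auto simp: dist_norm)
        qed (use d in auto)
        then show "norm (deriv (\<lambda>z. f z s) v) \<le> w s / d" by simp
      qed (use u d in auto)
      then show ?thesis using u by (simp add: norm_divide divide_le_eq)
    qed
    have intg: "integrable M (f u)" if "u \<in> A" for u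
      by (rule integrable_norm_bound[OF w meas[OF that] bound[OF that]])
    have "((\<lambda>u. ((\<integral>s. f u s \<partial>M) - (\<integral>s. f z s \<partial>M)) / (u - z)) \<longlongrightarrow> (\<integral>s. ?D s \<partial>M)) (at z)"
      unfolding tendsto_at_iff_sequentially
    proof (intro allI impI)
      fix X :: "nat \<Rightarrow> complex" assume X: "\<forall>i. X i \<in> UNIV - {z}" "X \<longlonglongrightarrow> z"
      from X(2) d(1) have ev: "\<forall>\<^sub>F n in sequentially. X n \<in> ball z d"
        using tendstoD[OF X(2) d(1)] by (auto simp: dist_commute)
      \<comment> \<open>Dropping the first \<open>N\<close> terms makes the Lipschitz bound
        \<open>lip\<close> valid for all remaining ones.\<close>
      then obtain N where N: "\<And>n. n \<ge> N \<Longrightarrow> X n \<in> ball z d"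
        by (auto simp: eventually_sequentially)
      let ?Y = "\<lambda>n. X (n + N)"
      have Y: "?Y n \<in> ball z d" "?Y n \<noteq> z" "?Y n \<in> A" for n
      proof -
        show *: "?Y n \<in> ball z d" using N by simp
        show "?Y n \<noteq> z" using X(1) by auto
        show "?Y n \<in> A" using * d by (auto simp: mem_ball)
      qed
      have Ylim: "?Y \<longlonglongrightarrow> z" by (rule LIMSEQ_ignore_initial_segment[OF X(2)])
      have conv: "(\<lambda>n. (f (?Y n) s - f z s) / (?Y n - z)) \<longlonglongrightarrow> ?D s" for s
        using dq[of s, unfolded tendsto_at_iff_sequentially comp_def, rule_format, of ?Y] Y Ylim by blast
      have mD: "?D \<in> borel_measurable M"
        by (rule borel_measurable_LIMSEQ_metric[OF _ conv])
           (use meas[OF Y(3)] meas[OF z] in measurable)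
      have "(\<lambda>n. \<integral>s. (f (?Y n) s - f z s) / (?Y n - z) \<partial>M) \<longlonglongrightarrow> (\<integral>s. ?D s \<partial>M)"
      proof (rule integral_dominated_convergence[where w = "\<lambda>s. w s / d"])
        show "?D \<in> borel_measurable M" by (rule mD)
        show "(\<lambda>s. (f (?Y n) s - f z s) / (?Y n - z)) \<in> borel_measurable M" for n
          using meas[OF Y(3)] meas[OF z] by measurable
        show "integrable M (\<lambda>s. w s / d)" using w by simp
        show "AE s in M. (\<lambda>n. (f (?Y n) s - f z s) / (?Y n - z)) \<longlonglongrightarrow> ?D s"
          using conv by simp
        show "AE s in M. norm ((f (?Y n) s - f z s) / (?Y n - z)) \<le> w s / d" for n
          using lip[OF Y(1,2)] by simp
      qed
      moreover have "(\<integral>s. (f (?Y n) s - f z s) / (?Y n - z) \<partial>M)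
          = ((\<integral>s. f (?Y n) s \<partial>M) - (\<integral>s. f z s \<partial>M)) / (?Y n - z)" for n
        using intg[OF Y(3)] intg[OF z] by simp
      ultimately have "(\<lambda>n. ((\<integral>s. f (?Y n) s \<partial>M) - (\<integral>s. f z s \<partial>M)) / (?Y n - z)) \<longlonglongrightarrow> (\<integral>s. ?D s \<partial>M)"
        by (simp only:)
      then show "((\<lambda>u. ((\<integral>s. f u s \<partial>M) - (\<integral>s. f z s \<partial>M)) / (u - z)) \<circ> X) \<longlonglongrightarrow> (\<integral>s. ?D s \<partial>M)"
        unfolding comp_def by (rule LIMSEQ_offset)
    qed
    then show ?thesis unfolding field_differentiable_def has_field_derivative_iff by blast
  qed
  then show ?thesis
    by (simp add: holomorphic_on_def field_differentiable_at_within)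
qed

subsection \<open>The unperturbed characteristic function\<close>

text \<open>Since (n + 2)! >= 2 n!, the tail from the quadratic term on is dominated termwise by a
  multiple of the exponential series.\<close>

lemma norm_exp_remainder_le:
  fixes v :: complex
  shows "cmod (exp v - 1 - v) \<le> (cmod v)\<^sup>2 / 2 * exp (cmod v)"
proof -
  let ?f = "\<lambda>n. v ^ (n + 2) /\<^sub>R fact (n + 2)"
  let ?h = "\<lambda>n. (cmod v)\<^sup>2 / 2 * (cmod v ^ n /\<^sub>R fact n)"
  have "(\<lambda>n. v ^ n /\<^sub>R fact n) sums exp v" by (rule exp_converges)
  then have "?f sums (exp v - (\<Sum>i<2. v ^ i /\<^sub>R fact i))" by (rule sums_split_initial_segment)
  then have f: "?f sums (exp v - 1 - v)" by (simp add: eval_nat_numeral algebra_simps)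
  have h: "?h sums ((cmod v)\<^sup>2 / 2 * exp (cmod v))" by (intro sums_mult exp_converges)
  have "norm (?f n) \<le> ?h n" for n
  proof -
    have "2 * fact n \<le> (fact (n + 2) :: real)"
      by (simp add: eval_nat_numeral fact_Suc algebra_simps)
    then have "inverse (fact (n + 2)) \<le> inverse (2 * fact n :: real)"
      by (intro le_imp_inverse_le) auto
    then have "cmod v ^ (n + 2) * inverse (fact (n + 2)) \<le> cmod v ^ (n + 2) * inverse (2 * fact n)"
      by (intro mult_left_mono) auto
    moreover have "norm (v ^ m /\<^sub>R fact m) = cmod v ^ m * inverse (fact m)" for m
      by (simp add: norm_power field_simps)
    moreover have "?h n = cmod v ^ (n + 2) * inverse (2 * fact n)"
      by (simp add: power_add power2_eq_square field_simps)
    ultimately show ?thesis by (simp only:)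
  qed
  then show ?thesis
    using suminf_le[of "\<lambda>n. norm (?f n)" ?h] summable_norm_comparison_test[of ?f ?h]
      summable_comparison_test'[of ?h 0 "\<lambda>n. norm (?f n)"] f h summable_norm[of ?f]
    by (force simp: sums_iff)
qed

text \<open>Because the base point is real, the exponentials at \<open>x\<close> have modulus 1, and
  the remainder is no larger than the exponential one at 0.\<close>

lemma norm_sin_remainder_le:
  fixes x :: real and d :: complex
  shows "cmod (sin (of_real x + d) - sin (of_real x) - d * cos (of_real x)) \<le> (cmod d)\<^sup>2 / 2 * exp (cmod d)"
proof -
  let ?e = "exp (\<i> * of_real x)" and ?e' = "exp (- (\<i> * of_real x))"
  let ?R = "\<lambda>v. exp v - 1 - v"
  have "sin (of_real x + d) - sin (of_real x) - d * cos (of_real x)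
     = (?e * ?R (\<i> * d) - ?e' * ?R (- (\<i> * d))) / (2 * \<i>)"
    by (simp add: sin_exp_eq cos_exp_eq exp_add[symmetric] algebra_simps exp_minus field_simps)
  then have "cmod (sin (of_real x + d) - sin (of_real x) - d * cos (of_real x))
     = cmod (?e * ?R (\<i> * d) - ?e' * ?R (- (\<i> * d))) / 2"
    by (simp add: norm_divide norm_mult)
  also have "\<dots> \<le> (cmod (?R (\<i> * d)) + cmod (?R (- (\<i> * d)))) / 2"
    by (intro divide_right_mono order_trans[OF norm_triangle_ineq4]) (simp_all add: norm_mult norm_exp_eq_Re)
  also have "\<dots> \<le> (cmod d)\<^sup>2 / 2 * exp (cmod d)"
    using norm_exp_remainder_le[of "\<i> * d"] norm_exp_remainder_le[of "- (\<i> * d)"]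
    by (simp add: norm_mult)
  finally show ?thesis .
qed

text \<open>
  In units where the total length is \<open>1\<close>, with \<open>A\<close>, \<open>B\<close> the relative lengths of the two intervals,
  \<open>secular A B (p\<^sup>2)\<close> is the unperturbed characteristic function divided by the spectral parameter.
\<close>

definition secular :: "real \<Rightarrow> real \<Rightarrow> real \<Rightarrow> complex \<Rightarrow> complex" where
  "secular A B c w = of_real c * cos (of_real A * w) * sin (of_real B * w) + cos (of_real B * w) * sin (of_real A * w)"

text \<open>The derivative of \<open>secular A B c\<close>, taken at real arguments because the
  zeros of \<open>secular\<close> are real.\<close>

definition secular_slope :: "real \<Rightarrow> real \<Rightarrow> real \<Rightarrow> real \<Rightarrow> real" where
  "secular_slope A B c x = cos (A * x) * cos (B * x) * (c * B + A) - sin (A * x) * sin (B * x) * (c * A + B)"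

text \<open>Product-to-sum formulas. For c = p^2 and B - A = rho the ratio of the second coefficient
  to the first is -k. This form suits the Taylor remainder and the reality of the zeros; the product
  form suits the perturbation.\<close>

lemma secular_eq:
  assumes "A + B = 1"
  shows "secular A B c w = of_real ((c + 1) / 2) * sin w + of_real ((c - 1) / 2) * sin (of_real (B - A) * w)"
proof -
  have w: "w = of_real A * w + of_real B * w"
    using assms by (simp add: distrib_right[symmetric] of_real_add[symmetric] del: of_real_add)
  have "sin w = sin (of_real A * w) * cos (of_real B * w) + cos (of_real A * w) * sin (of_real B * w)"
    by (subst w) (rule sin_add)
  moreover have "sin (of_real (B - A) * w) = sin (of_real B * w) * cos (of_real A * w) - cos (of_real B * w) * sin (of_real A * w)"
    by (simp add: sin_diff left_diff_distrib)
  moreover have "of_real ((c + 1) / 2) * (SA * CB + CA * SB) + of_real ((c - 1) / 2) * (SB * CA - CB * SA)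
      = of_real c * CA * SB + CB * SA" for SA SB CA CB :: complex
    by (simp add: field_simps)
  ultimately show ?thesis by (simp only: secular_def)
qed

lemma secular_slope_eq:
  assumes "A + B = 1"
  shows "secular_slope A B c x = (c + 1) / 2 * cos x + (c - 1) / 2 * (B - A) * cos ((B - A) * x)"
proof -
  have x: "x = A * x + B * x" using assms by (simp add: distrib_right[symmetric])
  have A: "A = 1 - B" using assms by simp
  have "cos x = cos (A * x) * cos (B * x) - sin (A * x) * sin (B * x)"
    by (subst x) (rule cos_add)
  moreover have "cos ((B - A) * x) = cos (A * x) * cos (B * x) + sin (A * x) * sin (B * x)"
    by (simp only: cos_diff left_diff_distrib) (simp add: mult.commute)
  moreover have "(c + 1) / 2 * (CC - SS) + (c - 1) / 2 * (B - A) * (CC + SS)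
      = CC * (c * B + A) - SS * (c * A + B)" for CC SS :: real
    unfolding A by (simp add: field_simps)
  ultimately show ?thesis by (simp add: secular_slope_def)
qed

text \<open>Both frequencies, 1 and B - A, are at most 1 in modulus, and for c >= 1 the two
  coefficients are nonnegative with sum \<open>c\<close>.\<close>

lemma secular_remainder_le:
  assumes AB: "A + B = 1" "0 \<le> A" "0 \<le> B" and c: "c \<ge> 1"
    and zero: "secular A B c (of_real x) = 0" and R: "cmod (w - of_real x) = R"
  shows "cmod (secular A B c w - of_real (secular_slope A B c x) * (w - of_real x)) \<le> c * R\<^sup>2 / 2 * exp R"
proof -
  define d where "d = w - of_real x"
  have w: "w = of_real x + d" by (simp add: d_def)
  have d: "cmod d = R" using R by (simp add: d_def)
  define \<rho> where "\<rho> = B - A"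
  have \<rho>: "\<bar>\<rho>\<bar> \<le> 1" using AB by (auto simp: \<rho>_def)
  let ?T = "\<lambda>x d. sin (of_real x + d) - sin (of_real x) - d * cos (of_real x :: complex)"
  have trig: "cos (of_real \<rho> * of_real x) = complex_of_real (cos (\<rho> * x))"
    by (metis cos_of_real of_real_mult)
  have "secular A B c w - of_real (secular_slope A B c x) * (w - of_real x)
     = secular A B c w - secular A B c (of_real x) - of_real (secular_slope A B c x) * d"
    using zero by (simp add: d_def)
  also have "\<dots> = of_real ((c + 1) / 2) * ?T x d + of_real ((c - 1) / 2) * ?T (\<rho> * x) (of_real \<rho> * d)"
    unfolding secular_eq[OF AB(1)] secular_slope_eq[OF AB(1)] w \<rho>_def[symmetric]
    by (simp add: trig cos_of_real field_simps)
  finally have "cmod (secular A B c w - of_real (secular_slope A B c x) * (w - of_real x))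
     \<le> cmod (of_real ((c + 1) / 2) * ?T x d) + cmod (of_real ((c - 1) / 2) * ?T (\<rho> * x) (of_real \<rho> * d))"
    using norm_triangle_ineq by metis
  also have "\<dots> = (c + 1) / 2 * cmod (?T x d) + (c - 1) / 2 * cmod (?T (\<rho> * x) (of_real \<rho> * d))"
    unfolding norm_mult norm_of_real using c by simp
  also have "\<dots> \<le> (c + 1) / 2 * (R\<^sup>2 / 2 * exp R) + (c - 1) / 2 * (R\<^sup>2 / 2 * exp R)"
  proof (intro add_mono mult_left_mono)
    show "cmod (?T x d) \<le> R\<^sup>2 / 2 * exp R" using norm_sin_remainder_le[of x d] d by simp
    have "R \<ge> 0" using d by auto
    then have "\<bar>\<rho>\<bar> * R \<le> R" using \<rho> by (simp add: mult_left_le_one_le)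
    have "cmod (?T (\<rho> * x) (of_real \<rho> * d)) \<le> (cmod (of_real \<rho> * d))\<^sup>2 / 2 * exp (cmod (of_real \<rho> * d))"
      by (rule norm_sin_remainder_le)
    also have "\<dots> \<le> R\<^sup>2 / 2 * exp R"
      using \<open>\<bar>\<rho>\<bar> * R \<le> R\<close> \<open>R \<ge> 0\<close> d
      by (intro mult_mono divide_right_mono power_mono) (auto simp: norm_mult)
    finally show "cmod (?T (\<rho> * x) (of_real \<rho> * d)) \<le> R\<^sup>2 / 2 * exp R" .
  qed (use c in auto)
  also have "\<dots> = c * R\<^sup>2 / 2 * exp R" by (simp add: field_simps)
  finally show ?thesis .
qed

text \<open>
  At a zero, \<open>(c1, s1)\<close> is parallel to \<open>(c2, - c s2)\<close>, and \<open>\<eta>\<close> is the ratio of their lengths.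
  Then \<open>c B / \<eta> + A \<eta>\<close> is the absolute value of the derivative of the secular function.
\<close>

lemma secular_zero_structure:
  fixes c1 s1 c2 s2 A B c :: real
  assumes one: "c1\<^sup>2 + s1\<^sup>2 = 1" "c2\<^sup>2 + s2\<^sup>2 = 1" and zero: "c * c1 * s2 + c2 * s1 = 0"
    and c: "c \<ge> 1" and AB: "A \<ge> 0" "B \<ge> 0"
  obtains \<eta> where "1 \<le> \<eta>" "\<eta> \<le> c" "\<eta>\<^sup>2 = c2\<^sup>2 + c\<^sup>2 * s2\<^sup>2" "\<bar>c1\<bar> * \<eta> = \<bar>c2\<bar>" "\<bar>s1\<bar> * \<eta> = c * \<bar>s2\<bar>"
    "\<bar>c1 * c2 * (c * B + A) - s1 * s2 * (c * A + B)\<bar> = c * B / \<eta> + A * \<eta>"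
proof -
  define n where "n = c2\<^sup>2 + c\<^sup>2 * s2\<^sup>2"
  have c2: "c\<^sup>2 \<ge> 1" using c by simp
  have n1: "n \<ge> 1"
  proof -
    have "s2\<^sup>2 \<le> c\<^sup>2 * s2\<^sup>2" using mult_right_mono[OF c2, of "s2\<^sup>2"] by simp
    then show ?thesis using one(2) by (simp add: n_def)
  qed
  have nc: "n \<le> c\<^sup>2"
  proof -
    have "c2\<^sup>2 \<le> c\<^sup>2 * c2\<^sup>2" using mult_right_mono[OF c2, of "c2\<^sup>2"] by simp
    then have "n \<le> c\<^sup>2 * (c2\<^sup>2 + s2\<^sup>2)" by (simp add: n_def algebra_simps)
    then show ?thesis using one(2) by simp
  qed
  \<comment> \<open>The coefficient of the orthogonal projection of (c1, s1) onto (c2, - c s2). By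
    the zero condition the two vectors are parallel, so the projection is (c1, s1) itself; as that
    is a unit vector, |\<open>\<kappa>\<close>| is the reciprocal of the square root of
    \<open>n\<close>.\<close>
  define \<kappa> where "\<kappa> = (c1 * c2 - c * s1 * s2) / n"
  have z2: "c2 * s1 = - c * c1 * s2" using zero by simp
  have c1: "c1 = \<kappa> * c2"
  proof -
    have "(c1 * c2 - c * s1 * s2) * c2 = c1 * c2\<^sup>2 - c * s2 * (c2 * s1)" by (simp add: algebra_simps power2_eq_square)
    also have "\<dots> = c1 * n" unfolding z2 by (simp add: n_def algebra_simps power2_eq_square)
    finally show ?thesis using n1 by (simp add: \<kappa>_def field_simps)
  qed
  have s1: "s1 = - \<kappa> * c * s2"
  proof -
    have "(c1 * c2 - c * s1 * s2) * c * s2 = c2 * (c * c1 * s2) - s1 * (c\<^sup>2 * s2\<^sup>2)" by (simp add: algebra_simps power2_eq_square)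
    also have "c * c1 * s2 = - c2 * s1" using z2 by simp
    also have "c2 * (- c2 * s1) - s1 * (c\<^sup>2 * s2\<^sup>2) = - s1 * n" by (simp add: n_def algebra_simps power2_eq_square)
    finally show ?thesis using n1 by (simp add: \<kappa>_def field_simps)
  qed
  have "1 = \<kappa>\<^sup>2 * n" using one(1) by (subst (asm) c1, subst (asm) s1) (simp add: n_def algebra_simps power_mult_distrib)
  then have "1 = sqrt (\<kappa>\<^sup>2 * n)" by simp
  then have k: "\<bar>\<kappa>\<bar> * sqrt n = 1" by (simp add: real_sqrt_mult)
  have sl: "c1 * c2 * (c * B + A) - s1 * s2 * (c * A + B) = \<kappa> * (c * B + A * n)"
  proof -
    have "c1 * c2 * (c * B + A) - s1 * s2 * (c * A + B) = \<kappa> * (c2\<^sup>2 * (c * B + A) + c * s2\<^sup>2 * (c * A + B))"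
      unfolding c1 s1 by (simp add: algebra_simps power2_eq_square)
    also have "c2\<^sup>2 * (c * B + A) + c * s2\<^sup>2 * (c * A + B) = c * B * (c2\<^sup>2 + s2\<^sup>2) + A * n"
      by (simp add: algebra_simps power2_eq_square n_def)
    finally show ?thesis using one(2) by simp
  qed
  have pos: "c * B + A * n \<ge> 0" using AB c n1 by (intro add_nonneg_nonneg mult_nonneg_nonneg) auto
  have sn: "sqrt n > 0" "sqrt n * sqrt n = n" using n1 by auto
  have ak: "\<bar>\<kappa>\<bar> = 1 / sqrt n" using k sn by (simp add: field_simps)
  show thesis
  proof
    show "1 \<le> sqrt n" using n1 by simp
    show "sqrt n \<le> c" using nc c by (intro real_le_lsqrt) auto
    show "(sqrt n)\<^sup>2 = c2\<^sup>2 + c\<^sup>2 * s2\<^sup>2" using n1 by (simp add: n_def)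
    have "\<bar>c1\<bar> = \<bar>\<kappa>\<bar> * \<bar>c2\<bar>" by (subst c1) (rule abs_mult)
    then show "\<bar>c1\<bar> * sqrt n = \<bar>c2\<bar>" using sn by (simp add: ak)
    have "\<bar>s1\<bar> = \<bar>\<kappa>\<bar> * (c * \<bar>s2\<bar>)" by (subst s1) (use c in \<open>simp add: abs_mult\<close>)
    then show "\<bar>s1\<bar> * sqrt n = c * \<bar>s2\<bar>" using sn by (simp add: ak)
    show "\<bar>c1 * c2 * (c * B + A) - s1 * s2 * (c * A + B)\<bar> = c * B / sqrt n + A * sqrt n"
      unfolding sl abs_mult ak using pos sn by (simp add: field_simps)
  qed
qed

subsection \<open>Numerical margins\<close>

text \<open>From sin t >= t - t^3 / 6, where pi^2 B / 6 <= 1. The angle \<open>pi * B\<close> is the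
  least value of 2 B |x| at a nonzero zero x, since |x| >= pi / 2 there.\<close>

lemma sin_pi_mult_ge:
  assumes "0 \<le> B" "B \<le> 1 / 2"
  shows "pi * B * (1 - B) \<le> sin (pi * B)"
proof -
  let ?t = "pi * B"
  have t: "0 \<le> ?t" using assms by simp
  have "{..<3::nat} = {0, 1, 2}" by auto
  then have "\<bar>sin ?t - ?t\<bar> \<le> ?t ^ 3 / 6"
    using Maclaurin_sin_bound[of ?t 3] t by (simp add: sin_coeff_def eval_nat_numeral field_simps)
  then have "?t - ?t ^ 3 / 6 \<le> sin ?t" by linarith
  moreover have "?t ^ 3 / 6 \<le> ?t * B"
  proof -
    have "pi * pi \<le> (63 / 20) * (63 / 20)" using pi_approx by (intro mult_mono) auto
    moreover have "pi * pi * B \<le> pi * pi * (1 / 2)" using assms by (intro mult_left_mono) auto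
    ultimately have "pi * pi * B / 6 \<le> 1" by linarith
    then have "(pi * pi * B / 6) * (?t * B) \<le> 1 * (?t * B)"
      using assms by (intro mult_right_mono) auto
    then show ?thesis by (simp add: power3_eq_cube algebra_simps)
  qed
  ultimately show ?thesis by (simp add: algebra_simps)
qed

text \<open>The fourth power of 2569/2000 lies just above 68/25, which exceeds e.\<close>

lemma exp_quarter_le: "exp (1 / 4 :: real) \<le> 2569 / 2000"
proof (rule ccontr)
  assume "\<not> exp (1 / 4 :: real) \<le> 2569 / 2000"
  then have "(2569 / 2000 :: real) ^ 4 \<le> exp (1 / 4) ^ 4" by (intro power_mono) auto
  also have "exp (1 / 4 :: real) ^ 4 = exp 1" by (simp add: exp_of_nat_mult[symmetric])
  also have "\<dots> < 68 / 25" using e_less_272 by simp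
  finally show False by (simp add: eval_nat_numeral)
qed

text \<open>For B - A = rho this is |rho| (1 - |rho|), so |rho| r equals \<open>gap\<close> times 1
  - |k|. It is the scale against which both the radius and the hypothesis are measured.\<close>

definition gap :: "real \<Rightarrow> real \<Rightarrow> real" where
  "gap A B = \<bar>B - A\<bar> * (1 - \<bar>B - A\<bar>)"

text \<open>Here 1 - |B - A| is twice the minimum of \<open>A\<close> and \<open>B\<close>, and t (1
  - t) <= 1/4.\<close>

lemma gap_bounds:
  assumes "A + B = 1" "0 < A" "0 < B" "A \<noteq> B"
  shows "0 < gap A B" "gap A B \<le> 1 / 4" "gap A B \<le> 2 * A" "gap A B \<le> 2 * B"
proof -
  let ?r = "\<bar>B - A\<bar>"
  have r: "0 < ?r" "?r < 1" using assms by auto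
  then show "0 < gap A B" by (simp add: gap_def)
  have "0 \<le> (?r - 1 / 2)\<^sup>2" by simp
  then show "gap A B \<le> 1 / 4" unfolding gap_def by (simp add: power2_eq_square algebra_simps)
  have "gap A B \<le> 1 - ?r" using r by (simp add: gap_def mult_left_le_one_le)
  then show "gap A B \<le> 2 * A" "gap A B \<le> 2 * B" using assms by auto
qed

lemma gap_commute: "gap A B = gap B A"
  by (simp add: gap_def abs_minus_commute)

text \<open>
  With \<open>E\<close> a bound for the exponential factors on the circle, a potential of weight \<open>S\<close> on the
  interval of length \<open>B\<close> contributes \<open>S W (margin g E B)\<close> to the lower bound for the linear term
  after the quadratic Taylor remainder has been subtracted, where \<open>W\<close> is the derivative. The
  constants below are \<open>2569/2000 \<ge> exp (1/4)\<close>, \<open>167/125\<close> for \<open>E\<close> times the geometric factor \<open>26/25\<close>,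
  and \<open>379/500\<close> for the reciprocal of the modulus of the spectral parameter.
\<close>

definition margin :: "real \<Rightarrow> real \<Rightarrow> real \<Rightarrow> real" where
  "margin g E B = (1 - g * E / 2) * (2 * B + 4 / pi) / (2 * g)"

lemma four_over_pi: "1273 / 1000 \<le> 4 / pi"
  using pi_approx by (simp add: field_simps)

text \<open>\<open>margin\<close> decreases in \<open>g\<close> and \<open>E\<close> and increases
  in \<open>B\<close>, so end values with rational constants suffice; 1273/1000 replaces
  4/pi.\<close>

lemma margin_ge:
  assumes "0 < g" "g \<le> G" "G \<le> 1" "0 \<le> b" "b \<le> B" "0 \<le> E" "E \<le> 2569 / 2000"
  shows "(1 - 2569 / 4000 * G) * (2 * b + 1273 / 1000) / (2 * G) \<le> margin g E B"
  unfolding margin_def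
proof (rule frac_le)
  have "g * E \<le> G * (2569 / 2000)" using assms by (intro mult_mono) auto
  then have *: "1 - 2569 / 4000 * G \<le> 1 - g * E / 2" by linarith
  then have "0 \<le> 1 - g * E / 2" using assms by linarith
  then show "(1 - 2569 / 4000 * G) * (2 * b + 1273 / 1000) \<le> (1 - g * E / 2) * (2 * B + 4 / pi)"
    using four_over_pi assms(4,5) * \<open>0 \<le> 1 - g * E / 2\<close> by (intro mult_mono) linarith+
  show "0 \<le> (1 - g * E / 2) * (2 * B + 4 / pi)"
    using \<open>0 \<le> 1 - g * E / 2\<close> assms by (intro mult_nonneg_nonneg) auto
qed (use assms in auto)

text \<open>Replacing \<open>B\<close> by its lower bound g / 2 leaves a decreasing function of
  \<open>g\<close>, about 2.56 at g = 1/4. The value 49/20 is the common target of the other margin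
  estimates.\<close>

lemma margin_ge_const:
  assumes "0 < g" "g \<le> 1 / 4" "g \<le> 2 * B" "0 \<le> E" "E \<le> 2569 / 2000"
  shows "49 / 20 \<le> margin g E B"
proof -
  have "g * g \<le> g * (1 / 4)" using assms by (intro mult_left_mono) auto
  then have "49 / 20 * (2 * g) \<le> (1 - 2569 / 4000 * g) * (2 * (g / 2) + 1273 / 1000)"
  proof -
    have "(1 - 2569 / 4000 * g) * (2 * (g / 2) + 1273 / 1000)
        = 1273 / 1000 + 729663 / 4000000 * g - 2569 / 4000 * (g * g)"
      by (simp add: field_simps)
    moreover have "g * g \<le> g / 4" using \<open>g * g \<le> g * (1 / 4)\<close> by simp
    ultimately show ?thesis using assms(1,2) by linarith
  qed
  then have "49 / 20 \<le> (1 - 2569 / 4000 * g) * (2 * (g / 2) + 1273 / 1000) / (2 * g)"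
    using assms(1) by (subst pos_le_divide_eq) auto
  also have "\<dots> \<le> margin g E B" using assms by (intro margin_ge) auto
  finally show ?thesis .
qed

lemma near_margin_poly:
  fixes B :: real
  assumes "0 \<le> B" "B \<le> 1 / 2"
  defines "A \<equiv> 1 - B" and "g \<equiv> 2 * B * (1 - 2 * B)"
  shows "167 / 125 * (379 / 500 * (1 + g * A + 41 / 25 * g\<^sup>2) + 442 / 625 * B + g * A * B) * (4 * (1 - 2 * B))
       < (1 - 2569 / 4000 * g) * (1 + 157 / 50 * A\<^sup>2) * (2 * B + 1273 / 1000)"
proof -
  define P where "P = (1 - 2569 / 4000 * g) * (1 + 157 / 50 * A\<^sup>2) * (2 * B + 1273 / 1000)
      - 167 / 125 * (379 / 500 * (1 + g * A + 41 / 25 * g\<^sup>2) + 442 / 625 * B + g * A * B) * (4 * (1 - 2 * B))"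
  consider "B \<le> 3 / 10" | "3 / 10 < B" by linarith
  then have "P > 0"
  proof cases
    case 1
    have "P = 304867 / 250000 - 1026331439 / 100000000 * B + 192684423 / 12500000 * B\<^sup>2
        + B ^ 3 * (16607806127 / 100000000 - 20101881163 / 50000000 * B + 848339953 / 3125000 * B\<^sup>2)"
      unfolding P_def A_def g_def by (simp add: field_simps eval_nat_numeral)
    \<comment> \<open>The bracket is at least 45 for B <= 3/10, already without its quadratic term.
      Replacing B^3 and B^2 by their tangents at 4/25 and 11/50 below leaves a linear
      inequality.\<close>
    moreover have "B ^ 3 * 45 \<le> B ^ 3 * (16607806127 / 100000000 - 20101881163 / 50000000 * B + 848339953 / 3125000 * B\<^sup>2)"
    proof (intro mult_left_mono)
      show "0 \<le> B ^ 3" using assms(1) by simp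
      have "0 \<le> B\<^sup>2" by simp
      then show "45 \<le> 16607806127 / 100000000 - 20101881163 / 50000000 * B + 848339953 / 3125000 * B\<^sup>2"
        using 1 assms(1) by linarith
    qed
    moreover have "48 / 625 * B - 128 / 15625 \<le> B ^ 3"
    proof -
      have "0 \<le> (B - 4 / 25)\<^sup>2 * (B + 8 / 25)" using assms(1) by simp
      then show ?thesis by (simp add: field_simps eval_nat_numeral)
    qed
    moreover have "0 \<le> (B - 11 / 50)\<^sup>2" by simp
    then have "11 / 25 * B - 121 / 2500 \<le> B\<^sup>2" by (simp add: power2_eq_square field_simps)
    ultimately show ?thesis using assms(1) 1 by simp
  next
    case 2
    define t where "t = B - 3 / 10"
    have t: "0 \<le> t" "t \<le> 1 / 5" "B = t + 3 / 10" using 2 assms(2) by (auto simp: t_def)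
    \<comment> \<open>Expanded about 3/10, only the cubic coefficient is negative, and for t <= 1/5
      the quadratic term absorbs it.\<close>
    have "P = 1768841977421 / 1250000000000 + 114010369357 / 10000000000 * t + t\<^sup>2 * (105406321809 / 5000000000 - 36022590089 / 500000000 * t)
        + 258277709 / 50000000 * t ^ 4 + 848339953 / 3125000 * t ^ 5"
      unfolding P_def A_def g_def t(3) by (simp add: field_simps eval_nat_numeral)
    moreover have "0 \<le> t\<^sup>2 * (105406321809 / 5000000000 - 36022590089 / 500000000 * t)"
      using t by (intro mult_nonneg_nonneg) auto
    moreover have "0 \<le> t ^ 4" "0 \<le> t ^ 5" using t by auto
    ultimately show ?thesis using t(1) by linarith
  qed
  then show ?thesis by (simp add: P_def)
qed

text \<open>With \<open>A * \<eta>\<close> and 1 both at most \<open>W\<close>, the left side is at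
  most 167/125 (1 + 1/16 + 379/500) W, about 2.432 W, just below 49/20 W.\<close>

lemma first_margin:
  assumes g: "0 < g" "g \<le> 1 / 4" "g \<le> 2 * A" and E: "0 \<le> E" "E \<le> 2569 / 2000"
    and AB: "0 \<le> A" "A * B \<le> 1 / 4" and K: "0 \<le> K" "K \<le> 167 / 125"
    and i: "0 \<le> i" "i \<le> 379 / 500" and W: "1 \<le> W" "A * \<eta> \<le> W" and "0 \<le> \<eta>" "0 \<le> B"
  shows "K * (A * (\<eta> + B * g) + i) < W * margin g E A"
proof -
  have "A * B * g \<le> 1 / 4 * (1 / 4)" using AB g \<open>0 \<le> B\<close> by (intro mult_mono) auto
  then have "A * (\<eta> + B * g) + i \<le> W * (1 + 1 / 16 + 379 / 500)"
    using W i by (simp add: algebra_simps)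
  then have "K * (A * (\<eta> + B * g) + i) \<le> 167 / 125 * (W * (1 + 1 / 16 + 379 / 500))"
    using K AB i g \<open>0 \<le> \<eta>\<close> \<open>0 \<le> B\<close> by (intro mult_mono add_nonneg_nonneg mult_nonneg_nonneg) auto
  also have "\<dots> < W * (49 / 20)" using W by simp
  also have "\<dots> \<le> W * margin g E A"
    using W g E by (intro mult_left_mono margin_ge_const) auto
  finally show ?thesis .
qed

text \<open>
  The perturbation on the interval without the factor \<open>c\<close> is the delicate one. It is harmless when
  that interval is the longer one; otherwise the term \<open>A Q\<close> of the derivative is needed, except when
  \<open>B |x|\<close> is so large that the reciprocal \<open>i\<close> of the spectral parameter is of the order of \<open>B\<close>.
\<close>

lemma far_weight_margin:
  assumes AB: "A + B = 1" "0 < A" "A < B" and g: "g = gap A B" and E: "0 \<le> E" "E \<le> 2569 / 2000"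
    and K: "0 \<le> K" "K \<le> 167 / 125" and i: "0 \<le> i" "i \<le> 379 / 500" and c2: "0 \<le> c2" "c2 \<le> 1"
    and s2: "0 \<le> s2" "s2 \<le> 1" and Q: "0 \<le> Q"
  shows "K * (i * (c2 + g * A + 41 / 25 * g\<^sup>2) + B * s2 + g * A * B) < (B + A * Q) * margin g E B"
proof -
  have gb: "0 < g" "g \<le> 1 / 4" using gap_bounds[of A B] AB g by auto
  have g2: "g \<le> 2 * B - 1"
  proof -
    have "\<bar>B - A\<bar> = 2 * B - 1" using AB by linarith
    then have "g = (2 * B - 1) * (1 - (2 * B - 1))" unfolding g gap_def by simp
    also have "\<dots> \<le> (2 * B - 1) * 1" using AB by (intro mult_left_mono) auto
    finally show ?thesis by simp
  qed
  have "g * A \<le> 1 / 4 * (1 / 2)" using gb AB by (intro mult_mono) auto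
  moreover have "g\<^sup>2 \<le> 1 / 4 * (1 / 4)" unfolding power2_eq_square using gb by (intro mult_mono) auto
  ultimately have "c2 + g * A + 41 / 25 * g\<^sup>2 \<le> 1 + 1 / 8 + 41 / 400" using c2 by simp
  then have "i * (c2 + g * A + 41 / 25 * g\<^sup>2) \<le> 379 / 500 * (1 + 1 / 8 + 41 / 400)"
    using i c2 gb AB by (intro mult_mono add_nonneg_nonneg mult_nonneg_nonneg) auto
  moreover have "B * s2 \<le> B * 1" using s2 AB by (intro mult_left_mono) auto
  moreover have "g * A * B \<le> 1 / 8 * 1" using \<open>g * A \<le> 1 / 4 * (1 / 2)\<close> AB gb by (intro mult_mono) auto
  ultimately have "i * (c2 + g * A + 41 / 25 * g\<^sup>2) + B * s2 + g * A * B \<le> 11 / 10 + B" by simp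
  then have "K * (i * (c2 + g * A + 41 / 25 * g\<^sup>2) + B * s2 + g * A * B) \<le> 167 / 125 * (11 / 10 + B)"
    using K i c2 gb s2 AB by (intro mult_mono add_nonneg_nonneg mult_nonneg_nonneg) auto
  also have "\<dots> < B * margin g E B"
  \<comment> \<open>For longer \<open>B\<close> the bound g <= 1/4 is enough; for \<open>B\<close>
    near 1/2 the smaller bound g <= 2 B - 1 makes up for the loss of length.\<close>
  proof (cases "B \<ge> 3 / 5")
    case True
    have "(1 - 2569 / 4000 * (1 / 4)) * (2 * (3 / 5) + 1273 / 1000) / (2 * (1 / 4)) \<le> margin g E B"
      using gb E True by (intro margin_ge) auto
    then have "83 / 20 \<le> margin g E B" by simp
    then have "83 / 20 * B \<le> margin g E B * B" using AB by (intro mult_right_mono) auto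
    then have "83 / 20 * B \<le> B * margin g E B" by (simp only: mult.commute)
    moreover have "167 / 125 * (11 / 10 + B) < 83 / 20 * B" using True by simp
    ultimately show ?thesis by (rule less_le_trans[rotated])
  next
    case False
    then have "g \<le> 1 / 5" using g2 by simp
    then have "(1 - 2569 / 4000 * (1 / 5)) * (2 * (1 / 2) + 1273 / 1000) / (2 * (1 / 5)) \<le> margin g E B"
      using gb E AB by (intro margin_ge) auto
    then have "99 / 20 \<le> margin g E B" by simp
    then have "99 / 20 * B \<le> margin g E B * B" using AB by (intro mult_right_mono) auto
    then have "99 / 20 * B \<le> B * margin g E B" by (simp only: mult.commute)
    moreover have "167 / 125 * (11 / 10 + B) < 99 / 20 * B" using AB by simp
    ultimately show ?thesis by (rule less_le_trans[rotated])
  qed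
  also have "\<dots> \<le> (B + A * Q) * margin g E B"
    using AB Q margin_ge_const[of g B E] gb g2 E by (intro mult_right_mono) auto
  finally show ?thesis .
qed

text \<open>As B tends to 0, so does the derivative bound, but g = 2 B (1 - 2 B) shrinks equally
  fast. The lower bound for \<open>Q\<close> gives B + A Q >= B (1 + pi A^2); the factor
  \<open>B\<close> cancels and \<open>near_margin_poly\<close> remains.\<close>

lemma near_weight_margin_small_angle:
  assumes AB: "A + B = 1" "0 < B" "B < A" and g: "g = gap A B" and E: "0 \<le> E" "E \<le> 2569 / 2000"
    and K: "0 \<le> K" "K \<le> 167 / 125" and i: "0 \<le> i" "i \<le> 379 / 500" and c2: "0 \<le> c2" "c2 \<le> 1"
    and s2: "0 \<le> s2" "s2 \<le> 442 / 625" and Q: "pi * B * A \<le> Q"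
  shows "K * (i * (c2 + g * A + 41 / 25 * g\<^sup>2) + B * s2 + g * A * B) < (B + A * Q) * margin g E B"
proof -
  have A: "A = 1 - B" using AB by simp
  have B: "0 < B" "B < 1 / 2" using AB by auto
  have gb: "0 < g" "g \<le> 1 / 4" using gap_bounds[of A B] AB g by auto
  have g_eq: "g = 2 * B * (1 - 2 * B)" using B unfolding g gap_def A by (simp add: algebra_simps abs_if)
  have "i * (c2 + g * A + 41 / 25 * g\<^sup>2) \<le> 379 / 500 * (1 + g * A + 41 / 25 * g\<^sup>2)"
    using i c2 gb AB by (intro mult_mono add_nonneg_nonneg mult_nonneg_nonneg) auto
  moreover have "B * s2 \<le> B * (442 / 625)" using s2 B by (intro mult_left_mono) auto
  ultimately have "i * (c2 + g * A + 41 / 25 * g\<^sup>2) + B * s2 + g * A * B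
      \<le> 379 / 500 * (1 + g * A + 41 / 25 * g\<^sup>2) + 442 / 625 * B + g * A * B" by linarith
  then have "K * (i * (c2 + g * A + 41 / 25 * g\<^sup>2) + B * s2 + g * A * B)
      \<le> 167 / 125 * (379 / 500 * (1 + g * A + 41 / 25 * g\<^sup>2) + 442 / 625 * B + g * A * B)"
    using K i c2 gb s2 AB by (intro mult_mono add_nonneg_nonneg mult_nonneg_nonneg) auto
  also have "\<dots> < (1 - 2569 / 4000 * g) * (1 + 157 / 50 * A\<^sup>2) * (2 * B + 1273 / 1000) / (4 * (1 - 2 * B))"
    using near_margin_poly[of B] B unfolding g_eq A by (subst pos_less_divide_eq) auto
  also have "\<dots> = B * (1 + 157 / 50 * A\<^sup>2) * ((1 - 2569 / 4000 * g) * (2 * B + 1273 / 1000) / (2 * g))"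
    using B by (simp add: g_eq)
  also have "\<dots> \<le> (B + A * Q) * margin g E B"
  proof (intro mult_mono)
    have "157 / 50 * (B * A\<^sup>2) \<le> pi * (B * A\<^sup>2)" using pi_approx B by (intro mult_right_mono) auto
    also have "\<dots> = A * (pi * B * A)" by (simp add: power2_eq_square)
    also have "\<dots> \<le> A * Q" using Q AB by (intro mult_left_mono) auto
    finally show "B * (1 + 157 / 50 * A\<^sup>2) \<le> B + A * Q" by (simp add: algebra_simps)
    then show "0 \<le> B + A * Q" using B by (intro order_trans[OF _ \<open>_ \<le> B + A * Q\<close>]) auto
    show "(1 - 2569 / 4000 * g) * (2 * B + 1273 / 1000) / (2 * g) \<le> margin g E B"
      using gb E B by (intro margin_ge) auto
    show "0 \<le> (1 - 2569 / 4000 * g) * (2 * B + 1273 / 1000) / (2 * g)"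
      using gb B by (intro divide_nonneg_nonneg mult_nonneg_nonneg) auto
  qed
  finally show ?thesis .
qed

text \<open>For Q >= 1 the factor B + A Q is at least 1, and the left side is at most 167/125 times
  17/10, below 49/20.\<close>

lemma near_weight_margin_sine_dominant:
  assumes AB: "A + B = 1" "0 < B" "B < A" and g: "g = gap A B" and E: "0 \<le> E" "E \<le> 2569 / 2000"
    and K: "0 \<le> K" "K \<le> 167 / 125" and i: "0 \<le> i" "i \<le> 379 / 500" and c2: "0 \<le> c2" "c2 \<le> 1"
    and s2: "0 \<le> s2" "s2 \<le> 1" and Q: "1 \<le> Q"
  shows "K * (i * (c2 + g * A + 41 / 25 * g\<^sup>2) + B * s2 + g * A * B) < (B + A * Q) * margin g E B"
proof -
  have gb: "0 < g" "g \<le> 1 / 4" "g \<le> 2 * B" using gap_bounds[of A B] AB g by auto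
  have "g * A \<le> 1 / 4 * 1" using gb AB by (intro mult_mono) auto
  moreover have "g\<^sup>2 \<le> 1 / 4 * (1 / 4)" unfolding power2_eq_square using gb by (intro mult_mono) auto
  ultimately have "c2 + g * A + 41 / 25 * g\<^sup>2 \<le> 1 + 1 / 4 + 41 / 400" using c2 by simp
  then have "i * (c2 + g * A + 41 / 25 * g\<^sup>2) \<le> 379 / 500 * (1 + 1 / 4 + 41 / 400)"
    using i c2 gb AB by (intro mult_mono add_nonneg_nonneg mult_nonneg_nonneg) auto
  moreover have "B * s2 \<le> 1 / 2 * 1" using s2 AB by (intro mult_mono) auto
  moreover have "g * A * B \<le> 1 / 4 * (1 / 2)" using \<open>g * A \<le> 1 / 4 * 1\<close> AB gb by (intro mult_mono) auto
  ultimately have "i * (c2 + g * A + 41 / 25 * g\<^sup>2) + B * s2 + g * A * B \<le> 17 / 10" by simp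
  then have "K * (i * (c2 + g * A + 41 / 25 * g\<^sup>2) + B * s2 + g * A * B) \<le> 167 / 125 * (17 / 10)"
    using K i c2 gb s2 AB by (intro mult_mono add_nonneg_nonneg mult_nonneg_nonneg) auto
  also have "\<dots> < 1 * (49 / 20)" by simp
  also have "\<dots> \<le> (B + A * Q) * margin g E B"
  proof (intro mult_mono margin_ge_const)
    have "A * 1 \<le> A * Q" using Q AB by (intro mult_left_mono) auto
    then show "1 \<le> B + A * Q" using AB by linarith
    then show "0 \<le> B + A * Q" by linarith
  qed (use gb E in auto)
  finally show ?thesis .
qed

text \<open>Here every term on the left is of order \<open>B\<close>: the sum is at most 8/5 B, so
  the term \<open>B\<close> of the derivative suffices.\<close>

lemma near_weight_margin_large_angle:
  assumes AB: "A + B = 1" "0 < B" "B < A" and g: "g = gap A B" and E: "0 \<le> E" "E \<le> 2569 / 2000"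
    and K: "0 \<le> K" "K \<le> 167 / 125" and i: "0 \<le> i" "i \<le> 9 / 20 * B" and c2: "0 \<le> c2" "c2 \<le> 1"
    and s2: "0 \<le> s2" "s2 \<le> 442 / 625" and Q: "0 \<le> Q"
  shows "K * (i * (c2 + g * A + 41 / 25 * g\<^sup>2) + B * s2 + g * A * B) < (B + A * Q) * margin g E B"
proof -
  have gb: "0 < g" "g \<le> 1 / 4" "g \<le> 2 * B" using gap_bounds[of A B] AB g by auto
  have "g * A \<le> 1 / 4 * 1" using gb AB by (intro mult_mono) auto
  moreover have "g\<^sup>2 \<le> 1 / 4 * (1 / 4)" unfolding power2_eq_square using gb by (intro mult_mono) auto
  ultimately have "c2 + g * A + 41 / 25 * g\<^sup>2 \<le> 1 + 1 / 4 + 41 / 400" using c2 by simp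
  then have "i * (c2 + g * A + 41 / 25 * g\<^sup>2) \<le> 9 / 20 * B * (1 + 1 / 4 + 41 / 400)"
    using i c2 gb AB by (intro mult_mono add_nonneg_nonneg mult_nonneg_nonneg) auto
  also have "\<dots> \<le> 61 / 100 * B" using AB by simp
  finally have "i * (c2 + g * A + 41 / 25 * g\<^sup>2) \<le> 61 / 100 * B" .
  moreover have "B * s2 \<le> B * (442 / 625)" using s2 AB by (intro mult_left_mono) auto
  moreover have "g * A * B \<le> 1 / 4 * 1 * B" using \<open>g * A \<le> 1 / 4 * 1\<close> AB gb by (intro mult_right_mono) auto
  ultimately have "i * (c2 + g * A + 41 / 25 * g\<^sup>2) + B * s2 + g * A * B \<le> 8 / 5 * B"
    using AB by (simp only: mult_1_right)
  then have "K * (i * (c2 + g * A + 41 / 25 * g\<^sup>2) + B * s2 + g * A * B) \<le> 167 / 125 * (8 / 5 * B)"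
    using K i c2 gb s2 AB by (intro mult_mono add_nonneg_nonneg mult_nonneg_nonneg) auto
  also have "\<dots> < B * (49 / 20)" using AB by simp
  also have "\<dots> \<le> (B + A * Q) * margin g E B"
  proof (intro mult_mono margin_ge_const)
    have "0 \<le> A * Q" using Q AB by auto
    then show "B \<le> B + A * Q" "0 \<le> B + A * Q" using AB by auto
  qed (use gb E in auto)
  finally show ?thesis .
qed

subsection \<open>Perturbation of the secular function\<close>

lemma secular_of_real:
  "secular A B c (of_real x) = of_real (c * cos (A * x) * sin (B * x) + cos (B * x) * sin (A * x))"
proof -
  have "cos (of_real a * of_real x) = complex_of_real (cos (a * x))"
    and "sin (of_real a * of_real x) = complex_of_real (sin (a * x))" for a
    by (metis cos_of_real of_real_mult, metis sin_of_real of_real_mult)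
  then show ?thesis by (simp add: secular_def)
qed

text \<open>For 0 < |x| < pi / 2 both angles lie in (0, pi / 2), where all sines and cosines are
  positive, so no cancellation is possible.\<close>

lemma secular_zero_ge_half_pi:
  assumes AB: "A + B = 1" "0 < A" "0 < B" and c: "c > 0"
    and zero: "c * cos (A * x) * sin (B * x) + cos (B * x) * sin (A * x) = 0" and x: "x \<noteq> 0"
  shows "pi / 2 \<le> \<bar>x\<bar>"
proof (rule ccontr)
  assume "\<not> pi / 2 \<le> \<bar>x\<bar>"
  then have y: "0 < \<bar>x\<bar>" "\<bar>x\<bar> < pi / 2" using x by auto
  have "A * \<bar>x\<bar> \<le> 1 * \<bar>x\<bar>" "B * \<bar>x\<bar> \<le> 1 * \<bar>x\<bar>" using AB by (intro mult_right_mono; simp)+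
  then have lt: "A * \<bar>x\<bar> < pi / 2" "B * \<bar>x\<bar> < pi / 2" using y by linarith+
  have gt: "0 < A * \<bar>x\<bar>" "0 < B * \<bar>x\<bar>" using y AB by auto
  have "c * cos (A * \<bar>x\<bar>) * sin (B * \<bar>x\<bar>) + cos (B * \<bar>x\<bar>) * sin (A * \<bar>x\<bar>) = 0"
    using zero by (auto simp: abs_if)
  moreover have "0 < cos (A * \<bar>x\<bar>)" "0 < cos (B * \<bar>x\<bar>)" "0 < sin (A * \<bar>x\<bar>)" "0 < sin (B * \<bar>x\<bar>)"
    using lt gt pi_gt_zero by (auto intro!: cos_gt_zero_pi sin_gt_zero)
  ultimately show False using c by (smt (verit) mult_pos_pos)
qed

text \<open>The addition theorem keeps the actual size of the sine and cosine at the real zero,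
  which is later matched with the derivative. The third, cruder bound serves for the term without
  the factor \<open>c\<close>.\<close>

lemma norm_sin_cos_near_real:
  fixes w :: complex and a x R :: real
  assumes a: "0 \<le> a" and R: "cmod (w - of_real x) = R"
  shows "cmod (sin (of_real a * w)) \<le> exp (R * a) * (\<bar>sin (a * x)\<bar> + a * R)"
    and "cmod (cos (of_real a * w)) \<le> exp (R * a) * (\<bar>cos (a * x)\<bar> + a * R)"
    and "cmod (cos (of_real a * w)) \<le> exp (R * a)"
proof -
  define d where "d = of_real a * (w - of_real x)"
  have eq: "of_real a * w = of_real (a * x) + d" by (simp add: d_def algebra_simps)
  have d: "cmod d = a * R" using a R by (simp add: d_def norm_mult)
  have im: "\<bar>Im d\<bar> \<le> R * a" using abs_Im_le_cmod[of d] d by (simp add: mult.commute)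
  have C: "cmod (cos d) \<le> exp (R * a)"
    using norm_cos_le_exp_Im[of d] im by (meson exp_le_cancel_iff order_trans)
  have S: "cmod (sin d) \<le> a * R * exp (R * a)"
  proof -
    have "cmod d * exp \<bar>Im d\<bar> \<le> a * R * exp (R * a)"
      using im d by (intro mult_mono) (auto simp flip: d)
    then show ?thesis using norm_sin_le_exp_Im[of d] by linarith
  qed
  have *: "cmod (of_real s * cos d + of_real t * sin d) \<le> exp (R * a) * (\<bar>s\<bar> + a * R)" if "\<bar>t\<bar> \<le> 1" for s t :: real
  proof -
    have "cmod (of_real s * cos d + of_real t * sin d) \<le> \<bar>s\<bar> * cmod (cos d) + \<bar>t\<bar> * cmod (sin d)"
      by (rule order_trans[OF norm_triangle_ineq]) (simp add: norm_mult)
    also have "\<dots> \<le> \<bar>s\<bar> * exp (R * a) + 1 * (a * R * exp (R * a))"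
      using C S that by (intro add_mono mult_left_mono mult_mono) auto
    finally show ?thesis by (simp add: algebra_simps)
  qed
  have "sin (of_real a * w) = of_real (sin (a * x)) * cos d + of_real (cos (a * x)) * sin d"
    unfolding eq sin_add by (simp only: sin_of_real cos_of_real)
  then show "cmod (sin (of_real a * w)) \<le> exp (R * a) * (\<bar>sin (a * x)\<bar> + a * R)"
    using *[of "cos (a * x)" "sin (a * x)"] by simp
  have "cos (of_real a * w) = of_real (cos (a * x)) * cos d + of_real (- sin (a * x)) * sin d"
    unfolding eq cos_add by (simp only: sin_of_real cos_of_real of_real_minus) simp
  then show "cmod (cos (of_real a * w)) \<le> exp (R * a) * (\<bar>cos (a * x)\<bar> + a * R)"
    using *[of "- sin (a * x)" "cos (a * x)"] by simp
  have "Im (of_real a * w) = Im d" by (simp add: eq)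
  then show "cmod (cos (of_real a * w)) \<le> exp (R * a)"
    using norm_cos_le_exp_Im[of "of_real a * w"] im by (metis exp_le_cancel_iff order_trans)
qed

text \<open>Four regimes. If A < B, the interval is long. Otherwise either the sine dominates and Q
  >= 1, or cos (2 B |x|) > 0; then 2 B |x| is at most pi / 2, where \<open>Q\<close> is at least of
  order \<open>B\<close>, or exceeds 3 pi / 2, where 1 / m is of order \<open>B\<close>.\<close>

lemma second_margin:
  assumes AB: "A + B = 1" "0 < A" "0 < B" "A \<noteq> B" and g: "g = gap A B" and E: "0 \<le> E" "E \<le> 2569 / 2000"
    and K: "0 \<le> K" "K \<le> 167 / 125" and x: "pi / 2 \<le> \<bar>x\<bar>" and m: "\<bar>x\<bar> - 1 / 4 \<le> m" and c: "1 \<le> c"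
    and Q: "Q = ((cos (B * x))\<^sup>2 + c\<^sup>2 * (sin (B * x))\<^sup>2) / c"
  shows "K * (1 / m * (\<bar>cos (B * x)\<bar> + g * A + 41 / 25 * g\<^sup>2) + B * \<bar>sin (B * x)\<bar> + g * A * B) < (B + A * Q) * margin g E B"
proof -
  let ?c = "\<bar>cos (B * x)\<bar>" and ?s = "\<bar>sin (B * x)\<bar>"
  have one: "(cos (B * x))\<^sup>2 + (sin (B * x))\<^sup>2 = 1" by simp
  \<comment> \<open>Since pi / 2 - 1/4 is slightly above 500/379.\<close>
  have m1: "500 / 379 \<le> m" using pi_approx x m by simp
  have i: "0 \<le> 1 / m" "1 / m \<le> 379 / 500" using m1 by (auto simp: field_simps)
  have Q0: "0 \<le> Q" using c by (simp add: Q)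
  have cs: "0 \<le> ?c" "?c \<le> 1" "0 \<le> ?s" "?s \<le> 1" by auto
  show ?thesis
  proof (cases "A < B")
    case True
    then show ?thesis using AB E K i cs Q0 by (intro far_weight_margin[OF _ _ _ g]) auto
  next
    case False
    then have BA: "B < A" "B < 1 / 2" using AB by auto
    show ?thesis
    proof (cases "(cos (B * x))\<^sup>2 \<le> (sin (B * x))\<^sup>2")
      case True
      have "1 \<le> Q"
      proof -
        have "(c - 1) * (cos (B * x))\<^sup>2 \<le> (c - 1) * c * (sin (B * x))\<^sup>2"
        proof -
          have "1 * (sin (B * x))\<^sup>2 \<le> c * (sin (B * x))\<^sup>2" using c by (intro mult_right_mono) auto
          then have "(cos (B * x))\<^sup>2 \<le> c * (sin (B * x))\<^sup>2" using True by linarith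
          then have "(c - 1) * (cos (B * x))\<^sup>2 \<le> (c - 1) * (c * (sin (B * x))\<^sup>2)"
            using c by (intro mult_left_mono) auto
          then show ?thesis by (simp add: mult.assoc)
        qed
        then have "c * ((cos (B * x))\<^sup>2 + (sin (B * x))\<^sup>2) \<le> (cos (B * x))\<^sup>2 + c\<^sup>2 * (sin (B * x))\<^sup>2"
          by (simp add: algebra_simps power2_eq_square del: sin_cos_squared_add2 sin_cos_squared_add sin_cos_squared_add3)
        then show ?thesis using c unfolding one by (simp add: Q)
      qed
      then show ?thesis using AB BA E K i cs by (intro near_weight_margin_sine_dominant[OF _ _ _ g]) auto
    next
      case False
      \<comment> \<open>442/625 is a rational just above the square root of 1/2.\<close>
      then have s2: "?s \<le> 442 / 625"
      proof -
        have "(sin (B * x))\<^sup>2 \<le> 1 / 2" using False one by linarith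
        also have "\<dots> \<le> (442 / 625)\<^sup>2" by (simp add: power2_eq_square)
        finally have "(sin (B * x))\<^sup>2 \<le> (442 / 625)\<^sup>2" .
        then show ?thesis using abs_le_square_iff[of "sin (B * x)" "442 / 625"] by simp
      qed
      define y where "y = B * \<bar>x\<bar>"
      have yc: "cos (2 * y) > 0"
      proof -
        have "cos (2 * (B * x)) > 0" using False by (simp add: cos_double)
        then show ?thesis by (simp add: y_def abs_if)
      qed
      have y0: "pi * B / 2 \<le> y" using x AB by (simp add: y_def field_simps)
      show ?thesis
      proof (cases "2 * y \<le> pi / 2")
        case True
        have A: "1 - B = A" using AB by simp
        have "pi * B * A \<le> sin (pi * B)"
          using sin_pi_mult_ge[of B, unfolded A] AB BA by linarith
        also have "\<dots> \<le> sin (2 * y)"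
        proof (intro sin_monotone_2pi_le)
          have "0 \<le> pi * B" using AB by simp
          then show "- (pi / 2) \<le> pi * B" using pi_gt_zero by linarith
        qed (use True y0 in auto)
        also have "\<dots> \<le> \<bar>sin (2 * (B * x))\<bar>" by (simp add: y_def abs_if)
        also have "\<dots> = 2 * ?s * ?c" by (simp add: sin_double abs_mult)
        also have "\<dots> \<le> Q"
        proof -
          \<comment> \<open>AM-GM: c2^2 + c^2 s2^2 >= 2 c |c2 s2|, that is, \<open>Q\<close> is at
            least |sin (2 B x)| whatever \<open>c\<close> is.\<close>
          have "0 \<le> (?c - c * ?s)\<^sup>2" by simp
          also have "\<dots> = (cos (B * x))\<^sup>2 + c\<^sup>2 * (sin (B * x))\<^sup>2 - c * (2 * ?s * ?c)"
            by (simp add: power2_diff power_mult_distrib)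
          finally show ?thesis using c by (simp add: Q field_simps)
        qed
        finally have "pi * B * A \<le> Q" .
        then show ?thesis using AB BA E K i cs s2 by (intro near_weight_margin_small_angle[OF _ _ _ g]) auto
      next
        case False
        have "2 * y > 3 * pi / 2"
        proof (rule ccontr)
          assume "\<not> 3 * pi / 2 < 2 * y"
          then have "cos (2 * y - pi) \<ge> 0" using False by (intro cos_ge_zero) auto
          then show False using yc by simp
        qed
        then have "3 * pi / (4 * B) < \<bar>x\<bar>" using AB by (simp add: y_def field_simps)
        \<comment> \<open>As B < 1/2, the 1/4 is at most 1 / (8 B), and 3 pi / 4 - 1/8 >
          20/9.\<close>
        moreover have "20 / (9 * B) \<le> 3 * pi / (4 * B) - 1 / 4"
          using AB BA pi_approx by (simp add: field_simps)
        ultimately have "20 / (9 * B) \<le> m" using m by linarith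
        then have "1 / m \<le> 9 / 20 * B" using AB m1 by (simp add: field_simps)
        then show ?thesis using AB BA E K i cs s2 Q0 by (intro near_weight_margin_large_angle[OF _ _ _ g]) auto
      qed
    qed
  qed
qed

text \<open>The estimate on the circle, in units of total length 1: \<open>S1\<close>,
  \<open>S2\<close> are the scaled weights, \<open>u1\<close>, \<open>u2\<close> the perturbed
  values and \<open>v1\<close>, \<open>v2\<close> the perturbed slopes divided by the spectral
  parameter. The coefficient of each weight is beaten separately by the derivative times
  \<open>margin\<close>; S1 + S2 > 0 makes the total strict.\<close>

lemma secular_perturbation_lt:
  fixes A B c S1 S2 R x :: real and w u1 u2 v1 v2 :: complex
  assumes AB: "A + B = 1" "0 < A" "0 < B" "A \<noteq> B" and c: "1 \<le> c"
    and S: "0 \<le> S1" "0 \<le> S2" "0 < S1 + S2"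
    and wt: "S1 * (2 * A + 4 / pi) + S2 * (2 * B + 4 / pi) \<le> 2 * gap A B * R" and Rc: "c * R \<le> gap A B"
    and zero: "secular A B c (of_real x) = 0" and x: "x \<noteq> 0" and R: "cmod (w - of_real x) = R"
    and u1: "cmod (u1 - cos (of_real A * w)) \<le> S1 * A * exp (R * A) / (1 - S1 * A)"
    and v1: "cmod (v1 + sin (of_real A * w)) \<le> S1 * exp (R * A) / (1 - S1 * A) / cmod w"
    and u2: "cmod (u2 - cos (of_real B * w)) \<le> S2 * B * exp (R * B) / (1 - S2 * B)"
    and v2: "cmod (v2 + sin (of_real B * w)) \<le> S2 * exp (R * B) / (1 - S2 * B) / cmod w"
  shows "cmod (- of_real c * u1 * v2 - u2 * v1 - of_real (secular_slope A B c x) * (w - of_real x))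
       < \<bar>secular_slope A B c x\<bar> * R"
proof -
  define g where "g = gap A B"
  have gb: "0 < g" "g \<le> 1 / 4" "g \<le> 2 * A" "g \<le> 2 * B"
    using gap_bounds[OF AB(1-4)] by (auto simp: g_def)
  have R0: "0 \<le> R" using R by auto
  have Rg: "R \<le> g"
  proof -
    have "1 * R \<le> c * R" using c R0 by (intro mult_right_mono) auto
    then show ?thesis using Rc g_def by simp
  qed
  have wt': "S1 * (2 * A + 4 / pi) \<le> 2 * g * R" "S2 * (2 * B + 4 / pi) \<le> 2 * g * R"
  proof -
    have "0 \<le> S1 * (2 * A + 4 / pi)" "0 \<le> S2 * (2 * B + 4 / pi)"
      using S AB pi_gt_zero by (auto intro!: mult_nonneg_nonneg add_nonneg_nonneg)
    then show "S1 * (2 * A + 4 / pi) \<le> 2 * g * R" "S2 * (2 * B + 4 / pi) \<le> 2 * g * R"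
      using wt by (auto simp: g_def)
  qed
  have gR: "2 * g * R \<le> 1 / 8"
  proof -
    have "g * R \<le> 1 / 4 * (1 / 4)" using gb Rg R0 by (intro mult_mono) auto
    then show ?thesis by simp
  qed
  \<comment> \<open>From a < 1 follows 2 a + 4/pi >= 3.273 a, hence s a <= 1 / (8 * 3.273) < 1/26.
    The geometric factor 1 / (1 - s a) is then at most 26/25.\<close>
  have small: "s * a \<le> 1 / 26" if "0 \<le> s" "s * (2 * a + 4 / pi) \<le> 2 * g * R" "0 < a" "a < 1" for s a
  proof -
    have "s * (a * (3273 / 1000)) \<le> s * (2 * a + 4 / pi)"
      using that four_over_pi by (intro mult_left_mono) auto
    then show ?thesis using that(2) gR by simp
  qed
  have sA: "S1 * A \<le> 1 / 26" and sB: "S2 * B \<le> 1 / 26"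
    using small[OF S(1) wt'(1)] small[OF S(2) wt'(2)] AB by auto
  have fr: "n / (1 - t) \<le> 26 / 25 * n" if "t \<le> 1 / 26" "0 \<le> n" for n t :: real
  proof -
    have "n / (1 - t) \<le> n / (25 / 26)" using that by (intro divide_left_mono) auto
    then show ?thesis by simp
  qed
  define E where "E = exp R"
  have E: "0 \<le> E" "E \<le> 2569 / 2000"
  proof -
    have "E \<le> exp (1 / 4)" using Rg gb by (simp add: E_def)
    then show "E \<le> 2569 / 2000" using exp_quarter_le by simp
  qed (simp add: E_def)
  define K where "K = 26 / 25 * E"
  have K: "0 \<le> K" "K \<le> 167 / 125" using E by (auto simp: K_def)
  define X1 where "X1 = exp (R * A)"
  define X2 where "X2 = exp (R * B)"
  have X: "0 < X1" "0 < X2" "X1 * X2 = E" "X2 * X1 = E"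
  proof -
    have "R * A + R * B = R" using AB by (simp add: distrib_left[symmetric])
    then show "X1 * X2 = E" by (simp add: X1_def X2_def E_def exp_add[symmetric])
    then show "X2 * X1 = E" by (simp add: mult.commute)
  qed (auto simp: X1_def X2_def)
  define c1 where "c1 = cos (A * x)"
  define s1 where "s1 = sin (A * x)"
  define c2 where "c2 = cos (B * x)"
  define s2 where "s2 = sin (B * x)"
  have zr: "c * c1 * s2 + c2 * s1 = 0"
    using zero unfolding secular_of_real c1_def s1_def c2_def s2_def of_real_eq_0_iff .
  have one: "c1\<^sup>2 + s1\<^sup>2 = 1" "c2\<^sup>2 + s2\<^sup>2 = 1" by (simp_all add: c1_def s1_def c2_def s2_def)
  obtain \<eta> where \<eta>: "1 \<le> \<eta>" "\<eta> \<le> c" "\<eta>\<^sup>2 = c2\<^sup>2 + c\<^sup>2 * s2\<^sup>2" "\<bar>c1\<bar> * \<eta> = \<bar>c2\<bar>" "\<bar>s1\<bar> * \<eta> = c * \<bar>s2\<bar>"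
    "\<bar>c1 * c2 * (c * B + A) - s1 * s2 * (c * A + B)\<bar> = c * B / \<eta> + A * \<eta>"
    using secular_zero_structure[OF one zr c, of A B] AB by auto
  \<comment> \<open>The mechanism that saves the factor \<open>c\<close>: at the zero, |s1| = e |s2|
    and c |c1| = e |c2|, while the derivative is W = e (B + A Q). In the coefficient of
    \<open>S2\<close> the factor \<open>e\<close> occurs on both sides and cancels.\<close>
  define e where "e = c / \<eta>"
  have e: "1 \<le> e" "\<bar>s1\<bar> = e * \<bar>s2\<bar>" "c * \<bar>c1\<bar> = e * \<bar>c2\<bar>"
    using \<eta>(1,2,4,5) by (auto simp: e_def field_simps)
  define W where "W = c * B / \<eta> + A * \<eta>"
  have slope: "\<bar>secular_slope A B c x\<bar> = W"
    using \<eta>(6) by (simp add: secular_slope_def W_def c1_def c2_def s1_def s2_def)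
  have W1: "1 \<le> W" "A * \<eta> \<le> W"
  proof -
    have "B * 1 \<le> B * e" "A * 1 \<le> A * \<eta>" using e(1) \<eta>(1) AB by (auto intro!: mult_left_mono)
    moreover have "W = B * e + A * \<eta>" by (simp add: W_def e_def)
    ultimately show "1 \<le> W" "A * \<eta> \<le> W" using AB by linarith+
  qed
  define Q where "Q = \<eta>\<^sup>2 / c"
  have WQ: "W = e * (B + A * Q)"
    using \<eta>(1) c by (simp add: W_def e_def Q_def field_simps power2_eq_square)
  have xpi: "pi / 2 \<le> \<bar>x\<bar>"
    using secular_zero_ge_half_pi[of A B c x] AB c x zr by (simp add: c1_def c2_def s1_def s2_def)
  have wm: "\<bar>x\<bar> - 1 / 4 \<le> cmod w"
  proof -
    have "cmod (of_real x) \<le> cmod w + cmod (w - of_real x)"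
      using norm_triangle_sub[of "of_real x" w] by (simp add: norm_minus_commute)
    then show ?thesis using R Rg gb by simp
  qed
  define i where "i = 1 / cmod w"
  have w0: "500 / 379 \<le> cmod w" using wm xpi pi_approx by simp
  have i: "0 \<le> i" "i \<le> 379 / 500"
    using le_imp_inverse_le[OF w0] by (auto simp: i_def inverse_eq_divide)

  define \<xi>1 where "\<xi>1 = u1 - cos (of_real A * w)"
  define \<zeta>1 where "\<zeta>1 = v1 + sin (of_real A * w)"
  define \<xi>2 where "\<xi>2 = u2 - cos (of_real B * w)"
  define \<zeta>2 where "\<zeta>2 = v2 + sin (of_real B * w)"
  have \<xi>1: "cmod \<xi>1 \<le> 26 / 25 * (S1 * A * X1)"
    using order_trans[OF u1 fr[OF sA]] S AB by (simp add: \<xi>1_def X1_def)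
  have \<xi>2: "cmod \<xi>2 \<le> 26 / 25 * (S2 * B * X2)"
    using order_trans[OF u2 fr[OF sB]] S AB by (simp add: \<xi>2_def X2_def)
  have \<zeta>1: "cmod \<zeta>1 \<le> 26 / 25 * (S1 * X1) * i"
  proof -
    have "S1 * exp (R * A) / (1 - S1 * A) * i \<le> 26 / 25 * (S1 * X1) * i"
      unfolding X1_def using i S by (intro mult_right_mono fr sA) auto
    then show ?thesis using v1 by (simp add: \<zeta>1_def i_def)
  qed
  have \<zeta>2: "cmod \<zeta>2 \<le> 26 / 25 * (S2 * X2) * i"
  proof -
    have "S2 * exp (R * B) / (1 - S2 * B) * i \<le> 26 / 25 * (S2 * X2) * i"
      unfolding X2_def using i S by (intro mult_right_mono fr sB) auto
    then show ?thesis using v2 by (simp add: \<zeta>2_def i_def)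
  qed
  have sw: "cmod (sin (of_real A * w)) \<le> X1 * (\<bar>s1\<bar> + A * R)" "cmod (cos (of_real A * w)) \<le> X1 * (\<bar>c1\<bar> + A * R)"
     "cmod (sin (of_real B * w)) \<le> X2 * (\<bar>s2\<bar> + B * R)" "cmod (cos (of_real B * w)) \<le> X2"
    using norm_sin_cos_near_real[OF _ R, of A] norm_sin_cos_near_real[OF _ R, of B] AB
    by (auto simp: X1_def X2_def c1_def s1_def s2_def)
  have nn: "0 \<le> \<bar>s1\<bar> + A * R" "0 \<le> \<bar>c1\<bar> + A * R" "0 \<le> \<bar>s2\<bar> + B * R"
    using AB R0 by (auto intro!: add_nonneg_nonneg mult_nonneg_nonneg)

  have "- of_real c * u1 * v2 - u2 * v1 - secular A B c w
     = of_real c * \<xi>1 * sin (of_real B * w) + (- of_real c * cos (of_real A * w) * \<zeta>2) + (- of_real c * \<xi>1 * \<zeta>2)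
       + \<xi>2 * sin (of_real A * w) + (- cos (of_real B * w) * \<zeta>1) + (- \<xi>2 * \<zeta>1)"
    by (simp add: secular_def \<xi>1_def \<xi>2_def \<zeta>1_def \<zeta>2_def algebra_simps)
  moreover have "cmod (a1 + a2 + a3 + a4 + a5 + a6) \<le> cmod a1 + cmod a2 + cmod a3 + cmod a4 + cmod a5 + cmod a6"
    for a1 a2 a3 a4 a5 a6 :: complex
    by (intro norm_triangle_mono order_refl)
  ultimately have "cmod (- of_real c * u1 * v2 - u2 * v1 - secular A B c w)
     \<le> cmod (of_real c * \<xi>1 * sin (of_real B * w)) + cmod (- of_real c * cos (of_real A * w) * \<zeta>2)
       + cmod (- of_real c * \<xi>1 * \<zeta>2) + cmod (\<xi>2 * sin (of_real A * w))
       + cmod (- cos (of_real B * w) * \<zeta>1) + cmod (- \<xi>2 * \<zeta>1)"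
    by presburger
  also have "\<dots> = c * cmod \<xi>1 * cmod (sin (of_real B * w)) + c * cmod (cos (of_real A * w)) * cmod \<zeta>2 + c * cmod \<xi>1 * cmod \<zeta>2
       + cmod \<xi>2 * cmod (sin (of_real A * w)) + cmod (cos (of_real B * w)) * cmod \<zeta>1 + cmod \<xi>2 * cmod \<zeta>1"
    using c by (simp add: norm_mult)
  also have "\<dots> \<le> c * (26 / 25 * (S1 * A * X1)) * (X2 * (\<bar>s2\<bar> + B * R))
       + c * (X1 * (\<bar>c1\<bar> + A * R)) * (26 / 25 * (S2 * X2) * i)
       + c * (26 / 25 * (S1 * A * X1)) * (26 / 25 * (S2 * X2) * i)
       + 26 / 25 * (S2 * B * X2) * (X1 * (\<bar>s1\<bar> + A * R))
       + X2 * (26 / 25 * (S1 * X1) * i)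
       + 26 / 25 * (S2 * B * X2) * (26 / 25 * (S1 * X1) * i)"
    using c S AB i X nn \<xi>1 \<xi>2 \<zeta>1 \<zeta>2 sw
    by (intro add_mono mult_mono) auto
  \<comment> \<open>Sorted by weights. Both products of two perturbations are put into the
    coefficient of \<open>S2\<close>, as the term with c A + B.\<close>
  also have "\<dots> = S1 * (K * (A * (c * \<bar>s2\<bar> + B * (c * R)) + i))
       + S2 * (K * (i * (c * \<bar>c1\<bar> + A * (c * R) + 26 / 25 * (S1 * (c * A + B))) + B * (\<bar>s1\<bar> + A * R)))"
    unfolding K_def X(3)[symmetric] by (simp add: field_simps)
  also have "\<dots> \<le> S1 * (K * (A * (\<eta> + B * g) + i))
       + S2 * (e * (K * (i * (\<bar>c2\<bar> + g * A + 41 / 25 * g\<^sup>2) + B * \<bar>s2\<bar> + g * A * B)))"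
  proof (rule add_mono; rule mult_left_mono)
    have "\<bar>s1\<bar> \<le> 1" by (simp add: s1_def)
    then have "c * \<bar>s2\<bar> \<le> \<eta>" using \<eta>(1) \<eta>(5) by (metis abs_ge_zero dual_order.trans mult_left_le_one_le zero_le_one)
    moreover have "B * (c * R) \<le> B * g" using Rc AB by (intro mult_left_mono) (auto simp: g_def)
    ultimately show "K * (A * (c * \<bar>s2\<bar> + B * (c * R)) + i) \<le> K * (A * (\<eta> + B * g) + i)"
      using K AB by (intro mult_left_mono add_right_mono add_mono) auto
    \<comment> \<open>From 1.273 S1 <= 2 g R and c R <= g follows S1 c <= 2 g^2 / 1.273, and 1.04 *
      2 / 1.273 < 1.64 = 41/25.\<close>
    have "26 / 25 * (S1 * (c * A + B)) \<le> e * (41 / 25 * g\<^sup>2)"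
    proof -
      have "c * A + B \<le> c * A + c * B" using mult_right_mono[OF c, of B] AB by simp
      also have "\<dots> = c" using AB(1) by (simp add: distrib_left[symmetric])
      finally have 1: "S1 * (c * A + B) \<le> S1 * c" using S by (intro mult_left_mono) auto
      have "c * (S1 * (1273 / 1000)) \<le> c * (S1 * (2 * A + 4 / pi))"
        using S AB four_over_pi c by (intro mult_left_mono) auto
      also have "\<dots> \<le> c * (2 * g * R)" using wt' c by (intro mult_left_mono) auto
      also have "\<dots> = 2 * g * (c * R)" by simp
      also have "\<dots> \<le> 2 * g * g" using Rc gb by (intro mult_left_mono) (auto simp: g_def)
      finally have "S1 * c * (1273 / 1000) \<le> 2 * g\<^sup>2" by (simp add: power2_eq_square ac_simps)
      then have "26 / 25 * (S1 * (c * A + B)) \<le> 1 * (41 / 25 * g\<^sup>2)"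
        using 1 zero_le_power2[of g] by linarith
      also have "\<dots> \<le> e * (41 / 25 * g\<^sup>2)" using e by (intro mult_right_mono) auto
      finally show ?thesis .
    qed
    moreover have "A * (c * R) \<le> e * (g * A)"
    proof -
      have "A * (c * R) \<le> A * g" using Rc AB by (intro mult_left_mono) (auto simp: g_def)
      also have "\<dots> \<le> e * (A * g)" using e AB gb mult_right_mono[of 1 e "A * g"] by simp
      finally show ?thesis by (simp add: mult.commute)
    qed
    ultimately have i1: "c * \<bar>c1\<bar> + A * (c * R) + 26 / 25 * (S1 * (c * A + B)) \<le> e * (\<bar>c2\<bar> + g * A + 41 / 25 * g\<^sup>2)"
      unfolding e(3) distrib_left by (intro add_mono) auto
    have "A * R \<le> e * (g * A)"
    proof -
      have "A * R \<le> A * g" using Rg AB by (intro mult_left_mono) auto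
      also have "\<dots> \<le> e * (A * g)" using e AB gb mult_right_mono[of 1 e "A * g"] by simp
      finally show ?thesis by (simp add: mult.commute)
    qed
    then have i2: "\<bar>s1\<bar> + A * R \<le> e * (\<bar>s2\<bar> + g * A)" unfolding e(2) distrib_left by simp
    have "K * (i * (c * \<bar>c1\<bar> + A * (c * R) + 26 / 25 * (S1 * (c * A + B))) + B * (\<bar>s1\<bar> + A * R))
      \<le> K * (i * (e * (\<bar>c2\<bar> + g * A + 41 / 25 * g\<^sup>2)) + B * (e * (\<bar>s2\<bar> + g * A)))"
      using i1 i2 K i AB by (intro mult_left_mono add_mono) auto
    also have "\<dots> = e * (K * (i * (\<bar>c2\<bar> + g * A + 41 / 25 * g\<^sup>2) + B * \<bar>s2\<bar> + g * A * B))"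
      by (simp add: algebra_simps)
    finally show "K * (i * (c * \<bar>c1\<bar> + A * (c * R) + 26 / 25 * (S1 * (c * A + B))) + B * (\<bar>s1\<bar> + A * R))
      \<le> e * (K * (i * (\<bar>c2\<bar> + g * A + 41 / 25 * g\<^sup>2) + B * \<bar>s2\<bar> + g * A * B))" .
  qed (use S in auto)
  also have "\<dots> < S1 * (W * margin g E A) + S2 * (W * margin g E B)"
  proof -
    have AB4: "A * B \<le> 1 / 4"
    proof -
      have "0 \<le> (A - B)\<^sup>2" by simp
      moreover have "(A + B)\<^sup>2 = 1" using AB by simp
      ultimately show ?thesis by (simp add: power2_eq_square algebra_simps)
    qed
    have m1: "K * (A * (\<eta> + B * g) + i) < W * margin g E A"
      using gb E AB AB4 K i W1 \<eta>(1) by (intro first_margin) auto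
    have "K * (i * (\<bar>c2\<bar> + g * A + 41 / 25 * g\<^sup>2) + B * \<bar>s2\<bar> + g * A * B) < (B + A * Q) * margin g E B"
      unfolding i_def c2_def s2_def using AB E K xpi wm c \<eta>(3)
      by (intro second_margin) (auto simp: g_def Q_def c2_def s2_def)
    then have m2: "e * (K * (i * (\<bar>c2\<bar> + g * A + 41 / 25 * g\<^sup>2) + B * \<bar>s2\<bar> + g * A * B)) < W * margin g E B"
      unfolding WQ mult.assoc using e by (intro mult_strict_left_mono) auto
    consider "0 < S1" | "0 < S2" using S by linarith
    then show ?thesis
    proof cases
      case 1
      then show ?thesis using m1 m2 S by (intro add_less_le_mono mult_strict_left_mono mult_left_mono) auto
    next
      case 2
      then show ?thesis using m1 m2 S by (intro add_le_less_mono mult_strict_left_mono mult_left_mono) auto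
    qed
  qed
  \<comment> \<open>\<open>margin\<close> is a common factor times 2 B + 4/pi, so the two terms
    recombine into the left side of \<open>wt\<close>.\<close>
  also have "\<dots> = W * ((1 - g * E / 2) / (2 * g)) * (S1 * (2 * A + 4 / pi) + S2 * (2 * B + 4 / pi))"
  proof -
    have "margin g E b = (1 - g * E / 2) / (2 * g) * (2 * b + 4 / pi)" for b
      by (simp add: margin_def)
    moreover have "S1 * (W * (m * n)) + S2 * (W * (m * n')) = W * m * (S1 * n + S2 * n')" for m n n' :: real
      by (simp add: algebra_simps)
    ultimately show ?thesis by (simp only:)
  qed
  also have "\<dots> \<le> W * ((1 - g * E / 2) / (2 * g)) * (2 * g * R)"
  proof (intro mult_left_mono)
    have "g * E \<le> 1 / 4 * 2" using gb E by (intro mult_mono) auto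
    then show "0 \<le> W * ((1 - g * E / 2) / (2 * g))" using W1 gb by (intro mult_nonneg_nonneg divide_nonneg_nonneg) auto
  qed (use wt in \<open>simp add: g_def\<close>)
  also have "\<dots> = W * R - g * R * E / 2 * W" using gb by (simp add: field_simps)
  finally have pert: "cmod (- of_real c * u1 * v2 - u2 * v1 - secular A B c w) < W * R - g * R * E / 2 * W" .

  \<comment> \<open>The Taylor remainder fits into what the factor 1 - g E / 2 in
    \<open>margin\<close> has set aside, because c R <= g and W >= 1.\<close>
  have "cmod (secular A B c w - of_real (secular_slope A B c x) * (w - of_real x)) \<le> c * R\<^sup>2 / 2 * exp R"
    using AB c by (intro secular_remainder_le zero R) auto
  also have "\<dots> = (c * R) * (R * E / 2)" by (simp add: E_def power2_eq_square)
  also have "\<dots> \<le> g * (R * E / 2)" using Rc R0 E by (intro mult_right_mono) (auto simp: g_def)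
  also have "\<dots> \<le> g * R * E / 2 * W"
    using W1 gb R0 E mult_left_mono[of 1 W "g * R * E / 2"] by simp
  finally have "cmod (secular A B c w - of_real (secular_slope A B c x) * (w - of_real x)) \<le> g * R * E / 2 * W" .
  moreover have "cmod (- of_real c * u1 * v2 - u2 * v1 - of_real (secular_slope A B c x) * (w - of_real x))
    \<le> cmod (- of_real c * u1 * v2 - u2 * v1 - secular A B c w)
      + cmod (secular A B c w - of_real (secular_slope A B c x) * (w - of_real x))"
    by (rule order_trans[OF _ norm_triangle_ineq]) (simp add: algebra_simps)
  ultimately show ?thesis using pert unfolding slope by linarith
qed

subsection \<open>Transformation kernels\<close>

lemma norm_sin_quot_le: "cmod (sin_quot z u) \<le> \<bar>u\<bar> * exp (\<bar>Im z\<bar> * \<bar>u\<bar>)"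
proof (cases "z = 0")
  case False
  have "cmod (sin (z * of_real u)) \<le> cmod (z * of_real u) * exp \<bar>Im (z * of_real u)\<bar>"
    by (rule norm_sin_le_exp_Im)
  also have "\<dots> = cmod z * (\<bar>u\<bar> * exp (\<bar>Im z\<bar> * \<bar>u\<bar>))" by (simp add: norm_mult abs_mult)
  finally show ?thesis using False by (simp add: sin_quot_def norm_divide field_simps)
qed (simp add: sin_quot_def)

lemma norm_cos_mult_real_le: "cmod (cos (z * of_real u)) \<le> exp (\<bar>Im z\<bar> * \<bar>u\<bar>)"
  using norm_cos_le_exp_Im[of "z * of_real u"] by (simp add: abs_mult)

text \<open>A removable singularity: the value \<open>u\<close> at z = 0 is the derivative there of
  the numerator.\<close>

lemma holomorphic_on_sin_quot: "(\<lambda>z. sin_quot z u) holomorphic_on A"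
proof -
  have "(\<lambda>z. if z = 0 then deriv (\<lambda>z. sin (z * of_real u)) 0
      else sin (z * of_real u) / z - sin (0 * of_real u) / (z - 0)) holomorphic_on UNIV"
    by (rule pole_theorem) (auto intro!: holomorphic_intros)
  moreover have "deriv (\<lambda>z::complex. sin (z * of_real u)) 0 = of_real u"
    by (rule DERIV_imp_deriv) (auto intro!: derivative_eq_intros)
  ultimately have "(\<lambda>z. sin_quot z u) holomorphic_on UNIV"
    by (simp add: sin_quot_def[abs_def] if_distrib cong: if_cong)
  then show ?thesis by (rule holomorphic_on_subset) simp
qed

lemma sin_quot_has_vector_derivative:
  "((\<lambda>u. sin_quot z u) has_vector_derivative cos (z * of_real u)) (at u within S)"
proof (cases "z = 0")
  case True
  then show ?thesis
    by (auto simp: sin_quot_def intro!: derivative_eq_intros)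
next
  case False
  have "((\<lambda>u. sin (z * of_real u) / z) has_vector_derivative cos (z * of_real u)) (at u within S)"
    by (rule has_vector_derivative_real_field)
       (use False in \<open>auto intro!: derivative_eq_intros\<close>)
  then show ?thesis using False by (simp add: sin_quot_def)
qed

lemma continuous_on_sin_quot: "continuous_on S (sin_quot z)"
  by (auto simp: continuous_on_eq_continuous_within
      intro: has_vector_derivative_continuous sin_quot_has_vector_derivative)

lemma sin_quot_measurable [measurable]: "sin_quot z \<in> borel_measurable borel"
  by (rule borel_measurable_continuous_onI) (rule continuous_on_sin_quot)

lemma norm_sin_quot_diff_le:
  assumes "\<bar>u\<bar> \<le> m" "\<bar>v\<bar> \<le> m"
  shows "cmod (sin_quot z u - sin_quot z v) \<le> \<bar>u - v\<bar> * exp (\<bar>Im z\<bar> * m)"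
proof -
  have "norm (sin_quot z u - sin_quot z v) \<le> exp (\<bar>Im z\<bar> * m) * norm (u - v)"
  proof (rule differentiable_bound[where S = "{-m..m}" and f' = "\<lambda>u h. h *\<^sub>R cos (z * of_real u)"])
    show "(sin_quot z has_derivative (\<lambda>h. h *\<^sub>R cos (z * of_real w))) (at w within {-m..m})" for w
      using sin_quot_has_vector_derivative[of z w "{-m..m}"] by (simp add: has_vector_derivative_def)
    fix w assume w: "w \<in> {-m..m}"
    then have "\<bar>Im z\<bar> * \<bar>w\<bar> \<le> \<bar>Im z\<bar> * m" by (intro mult_left_mono) auto
    then have "cmod (cos (z * of_real w)) \<le> exp (\<bar>Im z\<bar> * m)"
      using norm_cos_mult_real_le[of z w] by (meson exp_le_cancel_iff order_trans)
    then show "onorm (\<lambda>h. h *\<^sub>R cos (z * of_real w)) \<le> exp (\<bar>Im z\<bar> * m)"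
      by (intro onorm_le) (simp add: mult.commute mult_left_mono)
  qed (use assms in auto)
  then show ?thesis by (simp add: mult.commute)
qed

text \<open>
  Joint measurability of parameter integrals is only available for the Borel product, hence the
  passage from \<open>lebesgue\<close> to \<open>lborel\<close>.
\<close>

lemma K1_measurable_and_Suc:
  fixes g :: "real \<Rightarrow> real"
  assumes g [measurable]: "g \<in> borel_measurable borel"
  shows "(\<lambda>p. K1 g z n (fst p) (snd p)) \<in> borel_measurable (borel \<Otimes>\<^sub>M borel)"
    and "K1 g z (Suc n) x t
      = (\<integral>s. indicator {t..x} s *\<^sub>R (sin_quot z (x - s) * K1 g z n s t * of_real (g s)) \<partial>lborel)"
proof -
  have step: "K1 g z (Suc n) x t
      = (\<integral>s. indicator {t..x} s *\<^sub>R (sin_quot z (x - s) * K1 g z n s t * of_real (g s)) \<partial>lborel)"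
    if m: "(\<lambda>p. K1 g z n (fst p) (snd p)) \<in> borel_measurable (borel \<Otimes>\<^sub>M borel)" for n x t
  proof -
    have [measurable]: "(\<lambda>s. K1 g z n s t) \<in> borel_measurable borel"
      using measurable_compose[OF measurable_Pair[OF measurable_ident_sets measurable_const] m, of borel t] by simp
    show ?thesis
      unfolding K1.simps set_lebesgue_integral_def by (rule integral_completion) measurable
  qed
  have meas: "(\<lambda>p. K1 g z n (fst p) (snd p)) \<in> borel_measurable (borel \<Otimes>\<^sub>M borel)" for n
  proof (induction n)
    case 0
    show ?case unfolding K1.simps by measurable
  next
    case (Suc n)
    have [measurable]: "(\<lambda>q. K1 g z n (snd q) (snd (fst q))) \<in> borel_measurable ((borel \<Otimes>\<^sub>M borel) \<Otimes>\<^sub>M lborel)"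
      using measurable_compose[OF measurable_Pair Suc.IH, of "\<lambda>q. snd q" "(borel \<Otimes>\<^sub>M borel) \<Otimes>\<^sub>M lborel" "\<lambda>q. snd (fst q)"]
      by simp
    \<comment> \<open>The moving interval is written as a condition on the pair and \<open>s\<close>
      together, so that the integrand is jointly measurable.\<close>
    have "(\<lambda>p. \<integral>s. (if snd p \<le> s \<and> s \<le> fst p then 1 else 0) *\<^sub>R (sin_quot z (fst p - s) * K1 g z n s (snd p) * of_real (g s)) \<partial>lborel)
      \<in> borel_measurable (borel \<Otimes>\<^sub>M borel)"
      by (rule lborel.borel_measurable_lebesgue_integral) measurable
    moreover have "K1 g z (Suc n) x t
      = (\<integral>s. (if t \<le> s \<and> s \<le> x then 1 else 0) *\<^sub>R (sin_quot z (x - s) * K1 g z n s t * of_real (g s)) \<partial>lborel)" for x t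
      unfolding step[OF Suc.IH] by (rule Bochner_Integration.integral_cong) (auto simp: indicator_def)
    ultimately show ?case by (simp only:)
  qed
  show "(\<lambda>p. K1 g z n (fst p) (snd p)) \<in> borel_measurable (borel \<Otimes>\<^sub>M borel)" by (rule meas)
  show "K1 g z (Suc n) x t
      = (\<integral>s. indicator {t..x} s *\<^sub>R (sin_quot z (x - s) * K1 g z n s t * of_real (g s)) \<partial>lborel)"
    by (rule step[OF meas])
qed

text \<open>The Neumann series of the kernels has ratio at most \<open>a\<close> times the mass of
  \<open>g\<close>, hence converges geometrically. The mass is taken over the whole line because
  \<open>g\<close> will be a Borel version of the potential extended by zero.\<close>

locale small_potential =
  fixes g :: "real \<Rightarrow> real" and a :: real
  assumes g_int: "integrable lborel g" and a_pos: "0 < a"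
    and small: "(\<integral>s. \<bar>g s\<bar> \<partial>lborel) * a < 1"
begin

definition "\<sigma> = (\<integral>s. \<bar>g s\<bar> \<partial>lborel)"

lemma sigma_nonneg: "0 \<le> \<sigma>"
  by (simp add: \<sigma>_def)

lemma ratio: "0 \<le> \<sigma> * a" "\<sigma> * a < 1"
  using sigma_nonneg a_pos small by (auto simp: \<sigma>_def)

lemma g_measurable [measurable]: "g \<in> borel_measurable borel"
  using borel_measurable_integrable[OF g_int] by simp

lemma K1_measurable [measurable (raw)]:
  assumes [measurable]: "x \<in> borel_measurable M" "t \<in> borel_measurable M"
  shows "(\<lambda>w. K1 g z n (x w) (t w)) \<in> borel_measurable M"
  using measurable_compose[OF measurable_Pair[OF assms] K1_measurable_and_Suc(1)[OF g_measurable, of z n]] by simp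

lemma N1_measurable [measurable (raw)]:
  assumes [measurable]: "x \<in> borel_measurable M" "t \<in> borel_measurable M"
  shows "(\<lambda>w. N1 g (x w) (t w) z) \<in> borel_measurable M"
  unfolding N1_def by measurable

lemmas K1_Suc = K1_measurable_and_Suc(2)[OF g_measurable]

text \<open>The exponentials over x - s and s - t multiply to the one over x - t, so iteration does
  not increase the growth in Im z; (x - s) (s - t) <= a (x - t) leaves only a factor
  \<open>a\<close>.\<close>

lemma K1_integrand_le:
  assumes "t \<le> x" "x - t \<le> a"
    and k: "\<And>s. t \<le> s \<Longrightarrow> s \<le> x \<Longrightarrow> cmod (k s) \<le> (s - t) * exp (\<bar>Im z\<bar> * (s - t)) * C" and C: "0 \<le> C"
  shows "cmod (indicator {t..x} s *\<^sub>R (sin_quot z (x - s) * k s * of_real (g s)))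
      \<le> (x - t) * exp (\<bar>Im z\<bar> * (x - t)) * (C * a) * \<bar>g s\<bar>"
proof (cases "s \<in> {t..x}")
  case True
  have "cmod (sin_quot z (x - s) * k s) \<le> ((x - s) * exp (\<bar>Im z\<bar> * (x - s))) * ((s - t) * exp (\<bar>Im z\<bar> * (s - t)) * C)"
    unfolding norm_mult using norm_sin_quot_le[of z "x - s"] k[of s] True C
    by (intro mult_mono) auto
  also have "\<dots> = ((x - s) * (s - t)) * exp (\<bar>Im z\<bar> * (x - t)) * C"
    by (simp add: exp_add[symmetric] algebra_simps)
  also have "\<dots> \<le> (a * (x - t)) * exp (\<bar>Im z\<bar> * (x - t)) * C"
    using True assms(1,2) C by (intro mult_right_mono mult_mono) auto
  finally have "cmod (sin_quot z (x - s) * k s) * \<bar>g s\<bar> \<le> (a * (x - t)) * exp (\<bar>Im z\<bar> * (x - t)) * C * \<bar>g s\<bar>"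
    by (intro mult_right_mono) auto
  then show ?thesis using True by (simp add: norm_mult algebra_simps)
next
  case False
  then show ?thesis using assms(1) C a_pos by simp
qed

lemma norm_K1_le:
  assumes "t \<le> x" "x - t \<le> a"
  shows "cmod (K1 g z n x t) \<le> (x - t) * exp (\<bar>Im z\<bar> * (x - t)) * (\<sigma> * a) ^ n"
  using assms
proof (induction n arbitrary: x)
  case 0
  then show ?case using norm_sin_quot_le[of z "x - t"] by simp
next
  case (Suc n)
  have C: "0 \<le> (\<sigma> * a) ^ n" using ratio by simp
  have IH: "cmod (K1 g z n s t) \<le> (s - t) * exp (\<bar>Im z\<bar> * (s - t)) * (\<sigma> * a) ^ n" if "t \<le> s" "s \<le> x" for s
    using Suc that by simp
  have "cmod (K1 g z (Suc n) x t) \<le> (\<integral>s. (x - t) * exp (\<bar>Im z\<bar> * (x - t)) * ((\<sigma> * a) ^ n * a) * \<bar>g s\<bar> \<partial>lborel)"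
    unfolding K1_Suc using g_int
    by (intro norm_integral_le K1_integrand_le[OF Suc.prems IH C]) auto
  also have "\<dots> = (x - t) * exp (\<bar>Im z\<bar> * (x - t)) * (\<sigma> * a) ^ Suc n"
    by (simp add: \<sigma>_def)
  finally show ?case .
qed

lemma summable_K1:
  assumes "t \<le> x" "x - t \<le> a"
  shows "summable (\<lambda>n. cmod (K1 g z n x t))"
proof (rule summable_comparison_test'[where N = 0])
  show "summable (\<lambda>n. (x - t) * exp (\<bar>Im z\<bar> * (x - t)) * (\<sigma> * a) ^ n)"
    using ratio by (intro summable_mult summable_geometric) auto
qed (use norm_K1_le[OF assms] in auto)

lemma norm_N1_le:
  assumes "t \<le> x" "x - t \<le> a"
  shows "cmod (N1 g x t z) \<le> (x - t) * exp (\<bar>Im z\<bar> * (x - t)) * (1 / (1 - \<sigma> * a))"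
proof -
  have "cmod (N1 g x t z) \<le> (\<Sum>n. cmod (K1 g z n x t))"
    unfolding N1_def by (rule summable_norm[OF summable_K1[OF assms]])
  also have "\<dots> \<le> (\<Sum>n. (x - t) * exp (\<bar>Im z\<bar> * (x - t)) * (\<sigma> * a) ^ n)"
    using ratio by (intro suminf_le norm_K1_le assms summable_K1 summable_mult summable_geometric) auto
  also have "\<dots> = (x - t) * exp (\<bar>Im z\<bar> * (x - t)) * (1 / (1 - \<sigma> * a))"
    using ratio by (subst suminf_mult) (auto intro: summable_geometric simp: suminf_geometric)
  finally show ?thesis .
qed

text \<open>The recursion summed over n. In this Volterra equation x occurs only in the explicit
  sine kernel and in the limit of integration, which makes \<open>N1\<close> differentiable in x
  although \<open>g\<close> is merely integrable.\<close>

lemma N1_integral_equation: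
  assumes "t \<le> x" "x - t \<le> a"
  shows "N1 g x t z = sin_quot z (x - t)
    + (\<integral>s. indicator {t..x} s *\<^sub>R (sin_quot z (x - s) * N1 g s t z * of_real (g s)) \<partial>lborel)"
proof -
  let ?f = "\<lambda>n s. indicator {t..x} s *\<^sub>R (sin_quot z (x - s) * K1 g z n s t * of_real (g s))"
  define B where "B = (\<lambda>n s. (x - t) * exp (\<bar>Im z\<bar> * (x - t)) * ((\<sigma> * a) ^ n * a) * \<bar>g s\<bar>)"
  have le: "cmod (?f n s) \<le> B n s" for n s
    unfolding B_def by (rule K1_integrand_le[OF assms norm_K1_le]) (use assms ratio in auto)
  have Bint: "integrable lborel (B n)" for n unfolding B_def using g_int by simp
  have fint: "integrable lborel (?f n)" for n
    by (rule integrable_norm_bound[OF Bint _ le]) measurable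
  have Bsum: "summable (\<lambda>n. B n s)" for s
    unfolding B_def using ratio by (intro summable_mult summable_mult2 summable_geometric) auto
  have Bisum: "summable (\<lambda>n. \<integral>s. B n s \<partial>lborel)"
    unfolding B_def using ratio by simp (intro summable_mult summable_mult2 summable_geometric, auto)
  have "N1 g x t z = K1 g z 0 x t + (\<Sum>n. K1 g z (Suc n) x t)"
    unfolding N1_def using suminf_split_initial_segment[OF summable_norm_cancel[OF summable_K1[OF assms]], of z 1] by simp
  also have "(\<Sum>n. K1 g z (Suc n) x t) = (\<Sum>n. \<integral>s. ?f n s \<partial>lborel)" by (simp only: K1_Suc)
  also have "\<dots> = (\<integral>s. (\<Sum>n. ?f n s) \<partial>lborel)"
  proof (rule integral_suminf[symmetric, OF fint])
    show "AE s in lborel. summable (\<lambda>n. norm (?f n s))"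
      by (intro AE_I2 summable_comparison_test'[OF Bsum, of 0]) (use le in auto)
    show "summable (\<lambda>n. \<integral>s. norm (?f n s) \<partial>lborel)"
      by (intro summable_comparison_test'[OF Bisum, of 0])
         (use le in \<open>auto intro!: integral_mono integrable_norm fint Bint simp del: norm_scaleR\<close>)
  qed
  also have "\<dots> = (\<integral>s. indicator {t..x} s *\<^sub>R (sin_quot z (x - s) * N1 g s t z * of_real (g s)) \<partial>lborel)"
  proof (rule Bochner_Integration.integral_cong[OF refl])
    fix s
    show "(\<Sum>n. ?f n s) = indicator {t..x} s *\<^sub>R (sin_quot z (x - s) * N1 g s t z * of_real (g s))"
    proof (cases "s \<in> {t..x}")
      case True
      then have sm: "summable (\<lambda>n. K1 g z n s t)"
        using assms by (intro summable_norm_cancel[OF summable_K1]) auto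
      show ?thesis
        using sums_unique[OF sums_mult2[OF sums_mult[OF summable_sums[OF sm]]], of "sin_quot z (x - s)" "of_real (g s)"] True
        by (simp add: N1_def)
    qed simp
  qed
  finally show ?thesis by simp
qed

section \<open>The one-sided derivative of the kernel at 0\<close>

lemma N1_abs_integrable:
  assumes "t \<le> x" "x - t \<le> a"
  shows "integrable lborel (\<lambda>s. indicator {t..x} s *\<^sub>R (N1 g s t z * of_real (g s)))"
proof (rule integrable_norm_bound)
  show "integrable lborel (\<lambda>s. a * exp (\<bar>Im z\<bar> * a) * (1 / (1 - \<sigma> * a)) * \<bar>g s\<bar>)" using g_int by simp
  fix s
  show "norm (indicator {t..x} s *\<^sub>R (N1 g s t z * of_real (g s))) \<le> a * exp (\<bar>Im z\<bar> * a) * (1 / (1 - \<sigma> * a)) * \<bar>g s\<bar>"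
  proof (cases "s \<in> {t..x}")
    case True
    then have "(s - t) * exp (\<bar>Im z\<bar> * (s - t)) * (1 / (1 - \<sigma> * a)) \<le> a * exp (\<bar>Im z\<bar> * a) * (1 / (1 - \<sigma> * a))"
      using assms ratio by (intro mult_right_mono mult_mono) (auto intro: mult_left_mono)
    then have "cmod (N1 g s t z) \<le> a * exp (\<bar>Im z\<bar> * a) * (1 / (1 - \<sigma> * a))"
      using norm_N1_le[of t s z] True assms by simp
    then have "cmod (N1 g s t z) * \<bar>g s\<bar> \<le> a * exp (\<bar>Im z\<bar> * a) * (1 / (1 - \<sigma> * a)) * \<bar>g s\<bar>"
      by (intro mult_right_mono) auto
    then show ?thesis using True by (simp add: norm_mult)
  next
    case False
    then show ?thesis using a_pos ratio by simp
  qed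
qed measurable

text \<open>The Volterra equation differentiated formally at x = 0: \<open>cos\<close> is even, and
  the boundary term vanishes because the sine kernel is 0 at s = x. Unlike \<open>N1'\<close>, this
  formula also gives a definite value at t = 0.\<close>

definition N1_slope :: "real \<Rightarrow> complex \<Rightarrow> complex" where
  "N1_slope t z = cos (z * of_real t)
    + (\<integral>s. indicator {t..0} s *\<^sub>R (cos (z * of_real s) * N1 g s t z * of_real (g s)) \<partial>lborel)"

text \<open>
  Although \<open>G\<close> is merely integrable, dominated convergence applies, because the sine kernel cut off
  at \<open>s = y\<close> is Lipschitz in \<open>y\<close>.
\<close>

lemma sine_convolution_has_vector_derivative:
  fixes G :: "real \<Rightarrow> complex"
  assumes G: "integrable lborel G" and t: "t \<le> 0" and G0: "\<And>s. s \<notin> {t..0} \<Longrightarrow> G s = 0"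
  shows "((\<lambda>y. \<integral>s. (if s \<le> y then sin_quot z (y - s) else 0) * G s \<partial>lborel)
      has_vector_derivative (\<integral>s. cos (z * of_real s) * G s \<partial>lborel)) (at 0 within {t..0})"
proof -
  have [measurable]: "G \<in> borel_measurable borel" using borel_measurable_integrable[OF G] by simp
  define H where "H = (\<lambda>y s. if s \<le> y then sin_quot z (y - s) else 0)"
  have [measurable]: "(\<lambda>s. H y s) \<in> borel_measurable borel" for y unfolding H_def by measurable
  define M where "M = exp (\<bar>Im z\<bar> * - t)"
  have cosM: "cmod (cos (z * of_real s)) \<le> M" if "s \<in> {t..0}" for s
  proof -
    have "\<bar>Im z\<bar> * \<bar>s\<bar> \<le> \<bar>Im z\<bar> * - t" using that by (intro mult_left_mono) auto
    then show ?thesis using norm_cos_mult_real_le[of z s] unfolding M_def by (meson exp_le_cancel_iff order_trans)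
  qed
  \<comment> \<open>For s > y only \<open>H 0 s\<close> is left, and it is small because |s| < |y|;
    for s <= y the sine kernel is Lipschitz.\<close>
  have Hd: "cmod (H y s - H 0 s) \<le> \<bar>y\<bar> * M" if "y \<in> {t..0}" "s \<in> {t..0}" for y s
  proof (cases "s \<le> y")
    case True
    then show ?thesis
      using that norm_sin_quot_diff_le[of "y - s" "- t" "0 - s" z] by (auto simp: H_def M_def)
  next
    case False
    have "\<bar>Im z\<bar> * \<bar>s\<bar> \<le> \<bar>Im z\<bar> * - t" using that by (intro mult_left_mono) auto
    then have "\<bar>s\<bar> * exp (\<bar>Im z\<bar> * \<bar>s\<bar>) \<le> \<bar>y\<bar> * M"
      unfolding M_def using that False by (intro mult_mono) auto
    then show ?thesis using False that norm_sin_quot_le[of z "- s"] by (simp add: H_def)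
  qed
  have Hint: "integrable lborel (\<lambda>s. H y s * G s)" if "y \<in> {t..0}" for y
  proof (rule integrable_norm_bound)
    show "integrable lborel (\<lambda>s. - t * M * norm (G s))" using G by simp
    have "cmod (H y s) \<le> - t * M" if "s \<in> {t..0}" for s
    proof -
      have "\<bar>Im z\<bar> * \<bar>y - s\<bar> \<le> \<bar>Im z\<bar> * - t"
        using that \<open>y \<in> {t..0}\<close> by (intro mult_left_mono) auto
      then have "\<bar>y - s\<bar> * exp (\<bar>Im z\<bar> * \<bar>y - s\<bar>) \<le> - t * M"
        unfolding M_def using that \<open>y \<in> {t..0}\<close> by (intro mult_mono) auto
      moreover have "0 \<le> - t * M" using t by (intro mult_nonneg_nonneg) (auto simp: M_def)
      ultimately show ?thesis using norm_sin_quot_le[of z "y - s"] by (auto simp: H_def)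
    qed
    then have "cmod (H y s) * cmod (G s) \<le> - t * M * cmod (G s)" if "s \<in> {t..0}" for s
      using that by (intro mult_right_mono) auto
    then show "cmod (H y s * G s) \<le> - t * M * cmod (G s)" for s
      using G0[of s] by (cases "s \<in> {t..0}") (simp_all add: norm_mult)
  qed measurable
  have Cint: "integrable lborel (\<lambda>s. cos (z * of_real s) * G s)"
  proof (rule integrable_norm_bound)
    show "integrable lborel (\<lambda>s. M * norm (G s))" using G by simp
    show "cmod (cos (z * of_real s) * G s) \<le> M * cmod (G s)" for s
      using G0[of s] cosM[of s] by (cases "s \<in> {t..0}") (auto simp: norm_mult intro!: mult_right_mono)
  qed measurable
  define D where "D = (\<integral>s. cos (z * of_real s) * G s \<partial>lborel)"
  define F where "F = (\<lambda>y. \<integral>s. H y s * G s \<partial>lborel)"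
  have "((\<lambda>y. (1 / norm (y - 0)) *\<^sub>R (F y - (F 0 + (y - 0) *\<^sub>R D))) \<longlongrightarrow> 0) (at 0 within {t..0})"
    unfolding tendsto_at_iff_sequentially
  proof (intro allI impI)
    fix X :: "nat \<Rightarrow> real" assume X: "\<forall>i. X i \<in> {t..0} - {0}" "X \<longlonglongrightarrow> 0"
    let ?h = "\<lambda>i s. (1 / \<bar>X i\<bar>) *\<^sub>R ((H (X i) s - H 0 s - X i *\<^sub>R cos (z * of_real s)) * G s)"
    have "(\<lambda>i. \<integral>s. ?h i s \<partial>lborel) \<longlonglongrightarrow> (\<integral>s. 0 \<partial>(lborel :: real measure))"
    proof (rule integral_dominated_convergence[where w = "\<lambda>s. 2 * M * norm (G s)"])
      show "integrable lborel (\<lambda>s. 2 * M * norm (G s))" using G by simp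
      have "cmod (?h i s) \<le> 2 * M * cmod (G s)" for i s
      proof (cases "s \<in> {t..0}")
        case True
        have Xi: "X i \<in> {t..0}" "X i \<noteq> 0" using X(1) by auto
        have "cmod (H (X i) s - H 0 s - X i *\<^sub>R cos (z * of_real s)) \<le> \<bar>X i\<bar> * M + \<bar>X i\<bar> * M"
        proof (rule order_trans[OF norm_triangle_ineq4], rule add_mono)
          show "cmod (X i *\<^sub>R cos (z * of_real s)) \<le> \<bar>X i\<bar> * M"
            using cosM[OF True] by (simp add: mult_left_mono)
        qed (rule Hd[OF Xi(1) True])
        then have "1 / \<bar>X i\<bar> * cmod (H (X i) s - H 0 s - X i *\<^sub>R cos (z * of_real s)) \<le> 2 * M"
          using Xi(2) by (simp add: field_simps)
        then have "1 / \<bar>X i\<bar> * cmod (H (X i) s - H 0 s - X i *\<^sub>R cos (z * of_real s)) * cmod (G s) \<le> 2 * M * cmod (G s)"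
          by (intro mult_right_mono) auto
        then show ?thesis by (simp add: norm_mult)
      next
        case False
        then show ?thesis using G0 by simp
      qed
      then show "AE s in lborel. norm (?h i s) \<le> 2 * M * norm (G s)" for i by simp
      \<comment> \<open>For s < 0 the cutoff is eventually inactive, and the limit is the derivative
        of the sine kernel at -s. The exceptional point 0 is a null set.\<close>
      have "(\<lambda>i. ?h i s) \<longlonglongrightarrow> 0" if "s \<noteq> 0" for s
      proof (cases "s \<in> {t..0}")
        case True
        then have s: "s < 0" using that by auto
        have "((\<lambda>y. (1 / norm (y - (- s))) *\<^sub>R (sin_quot z y - (sin_quot z (- s) + (y - (- s)) *\<^sub>R cos (z * of_real (- s))))) \<longlongrightarrow> 0) (at (- s) within UNIV)"
          using sin_quot_has_vector_derivative[of z "- s" UNIV]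
          unfolding has_vector_derivative_def has_derivative_within by blast
        then have lim: "(\<lambda>i. (1 / norm (X i - s - (- s))) *\<^sub>R (sin_quot z (X i - s) - (sin_quot z (- s) + (X i - s - (- s)) *\<^sub>R cos (z * of_real (- s))))) \<longlonglongrightarrow> 0"
          unfolding tendsto_at_iff_sequentially comp_def
          by (rule allE[where x = "\<lambda>i. X i - s"]) (use X tendsto_diff[OF X(2) tendsto_const[of s]] in auto)
        have "\<forall>\<^sub>F i in sequentially. s < X i" using X(2) s by (rule order_tendstoD)
        then have "\<forall>\<^sub>F i in sequentially. (1 / norm (X i - s - (- s))) *\<^sub>R (sin_quot z (X i - s) - (sin_quot z (- s) + (X i - s - (- s)) *\<^sub>R cos (z * of_real (- s)))) * G s = ?h i s"
          by eventually_elim (use s in \<open>simp add: H_def algebra_simps\<close>)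
        moreover have "(\<lambda>i. (1 / norm (X i - s - (- s))) *\<^sub>R (sin_quot z (X i - s) - (sin_quot z (- s) + (X i - s - (- s)) *\<^sub>R cos (z * of_real (- s)))) * G s) \<longlonglongrightarrow> 0"
          using tendsto_mult_right[OF lim, of "G s"] by simp
        ultimately show ?thesis by (rule Lim_transform_eventually[rotated])
      next
        case False
        then show ?thesis using G0 by simp
      qed
      moreover have "AE s in lborel. s \<noteq> (0::real)" by (rule AE_lborel_singleton)
      ultimately show "AE s in lborel. (\<lambda>i. ?h i s) \<longlonglongrightarrow> 0" by auto
    qed measurable
    then have "(\<lambda>i. \<integral>s. ?h i s \<partial>lborel) \<longlonglongrightarrow> 0" by simp
    moreover have "(\<integral>s. ?h i s \<partial>lborel) = (1 / norm (X i - 0)) *\<^sub>R (F (X i) - (F 0 + (X i - 0) *\<^sub>R D))" for i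
    proof -
      have Xi: "X i \<in> {t..0}" "0 \<in> {t..0}" using X(1) t by auto
      have "(\<integral>s. ?h i s \<partial>lborel) = (1 / \<bar>X i\<bar>) *\<^sub>R (\<integral>s. H (X i) s * G s - H 0 s * G s - X i *\<^sub>R (cos (z * of_real s) * G s) \<partial>lborel)"
        by (subst integral_scaleR_right[symmetric]) (auto simp: left_diff_distrib intro!: Bochner_Integration.integral_cong)
      also have "(\<integral>s. H (X i) s * G s - H 0 s * G s - X i *\<^sub>R (cos (z * of_real s) * G s) \<partial>lborel) = F (X i) - F 0 - X i *\<^sub>R D"
        using Hint[OF Xi(1)] Hint[OF Xi(2)] Cint by (simp add: F_def D_def)
      finally show ?thesis by (simp add: algebra_simps)
    qed
    ultimately show "((\<lambda>y. (1 / norm (y - 0)) *\<^sub>R (F y - (F 0 + (y - 0) *\<^sub>R D))) \<circ> X) \<longlonglongrightarrow> 0"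
      by (simp only: comp_def)
  qed
  then show ?thesis
    unfolding has_vector_derivative_def has_derivative_within F_def H_def D_def
    by (auto intro: bounded_linear_scaleR_left)
qed

lemma N1_has_vector_derivative:
  assumes t: "t < 0" "- t \<le> a"
  shows "((\<lambda>y. N1 g y t z) has_vector_derivative N1_slope t z) (at 0 within {t..0})"
proof -
  define G where "G = (\<lambda>s. indicator {t..0} s *\<^sub>R (N1 g s t z * of_real (g s)))"
  have G: "integrable lborel G" unfolding G_def using t by (intro N1_abs_integrable) auto
  have "((\<lambda>y. sin_quot z (y - t)) has_vector_derivative cos (z * of_real (0 - t))) (at 0 within {t..0})"
  proof -
    have "((\<lambda>y. y - t) has_vector_derivative 1) (at 0 within {t..0})"
      unfolding has_real_derivative_iff_has_vector_derivative[symmetric]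
      by (auto intro!: derivative_eq_intros)
    from vector_diff_chain_within[OF this, of "sin_quot z" "cos (z * of_real (0 - t))"]
    show ?thesis using sin_quot_has_vector_derivative[of z "0 - t"] by (simp add: comp_def)
  qed
  from has_vector_derivative_add[OF this sine_convolution_has_vector_derivative[OF G, of t z]]
  have "((\<lambda>y. sin_quot z (y - t) + (\<integral>s. (if s \<le> y then sin_quot z (y - s) else 0) * G s \<partial>lborel))
      has_vector_derivative N1_slope t z) (at 0 within {t..0})"
    using t by (auto simp: N1_slope_def G_def algebra_simps)
  then show "((\<lambda>y. N1 g y t z) has_vector_derivative N1_slope t z) (at 0 within {t..0})"
  proof (rule has_vector_derivative_transform[rotated 2])
    fix y assume y: "y \<in> {t..0}"
    have "(\<integral>s. indicator {t..y} s *\<^sub>R (sin_quot z (y - s) * N1 g s t z * of_real (g s)) \<partial>lborel)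
        = (\<integral>s. (if s \<le> y then sin_quot z (y - s) else 0) * G s \<partial>lborel)"
      using y by (intro Bochner_Integration.integral_cong) (auto simp: G_def indicator_def)
    then show "N1 g y t z = sin_quot z (y - t) + (\<integral>s. (if s \<le> y then sin_quot z (y - s) else 0) * G s \<partial>lborel)"
      using N1_integral_equation[of t y z] y t by simp
  qed (use t in auto)
qed

lemma N1_slope_measurable [measurable (raw)]:
  assumes [measurable]: "t \<in> borel_measurable M"
  shows "(\<lambda>w. N1_slope (t w) z) \<in> borel_measurable M"
proof -
  have "(\<lambda>u. \<integral>s. (if u \<le> s \<and> s \<le> 0 then 1 else 0) *\<^sub>R (cos (z * of_real s) * N1 g s u z * of_real (g s)) \<partial>lborel)
      \<in> borel_measurable borel"
    by (rule lborel.borel_measurable_lebesgue_integral) measurable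
  moreover have "(\<integral>s. indicator {u..0} s *\<^sub>R (cos (z * of_real s) * N1 g s u z * of_real (g s)) \<partial>lborel)
     = (\<integral>s. (if u \<le> s \<and> s \<le> 0 then 1 else 0) *\<^sub>R (cos (z * of_real s) * N1 g s u z * of_real (g s)) \<partial>lborel)" for u
    by (rule Bochner_Integration.integral_cong) (auto simp: indicator_def)
  ultimately have [measurable]: "(\<lambda>u. N1_slope u z) \<in> borel_measurable borel"
    unfolding N1_slope_def by simp
  show ?thesis by measurable
qed

lemma N1_slope_integrand_le:
  assumes t: "t \<le> 0" "- t \<le> a"
  shows "cmod (indicator {t..0} s *\<^sub>R (cos (z * of_real s) * N1 g s t z * of_real (g s)))
    \<le> exp (\<bar>Im z\<bar> * - t) * (a / (1 - \<sigma> * a)) * \<bar>g s\<bar>"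
proof (cases "s \<in> {t..0}")
  case True
  have "cmod (cos (z * of_real s) * N1 g s t z)
      \<le> exp (\<bar>Im z\<bar> * - s) * ((s - t) * exp (\<bar>Im z\<bar> * (s - t)) * (1 / (1 - \<sigma> * a)))"
    unfolding norm_mult using norm_cos_mult_real_le[of z s] norm_N1_le[of t s z] True t
    by (intro mult_mono) auto
  also have "\<dots> = (s - t) * exp (\<bar>Im z\<bar> * - t) * (1 / (1 - \<sigma> * a))"
    by (simp add: exp_add[symmetric] algebra_simps)
  also have "\<dots> \<le> a * exp (\<bar>Im z\<bar> * - t) * (1 / (1 - \<sigma> * a))"
    using True t ratio by (intro mult_right_mono) auto
  finally have "cmod (cos (z * of_real s) * N1 g s t z) * \<bar>g s\<bar> \<le> a * exp (\<bar>Im z\<bar> * - t) * (1 / (1 - \<sigma> * a)) * \<bar>g s\<bar>"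
    by (intro mult_right_mono) auto
  then show ?thesis using True by (simp add: norm_mult algebra_simps)
next
  case False
  then show ?thesis using a_pos ratio by simp
qed

lemma norm_N1_slope_le:
  assumes t: "t \<le> 0" "- t \<le> a"
  shows "cmod (N1_slope t z) \<le> exp (\<bar>Im z\<bar> * - t) * (1 / (1 - \<sigma> * a))"
proof -
  let ?f = "\<lambda>s. indicator {t..0} s *\<^sub>R (cos (z * of_real s) * N1 g s t z * of_real (g s))"
  let ?B = "\<lambda>s. exp (\<bar>Im z\<bar> * - t) * (a / (1 - \<sigma> * a)) * \<bar>g s\<bar>"
  have "cmod (\<integral>s. ?f s \<partial>lborel) \<le> (\<integral>s. ?B s \<partial>lborel)"
    using g_int by (intro norm_integral_le N1_slope_integrand_le[OF t]) auto
  also have "\<dots> = exp (\<bar>Im z\<bar> * - t) * (\<sigma> * a / (1 - \<sigma> * a))" by (simp add: \<sigma>_def)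
  finally have "cmod (N1_slope t z) \<le> exp (\<bar>Im z\<bar> * - t) + exp (\<bar>Im z\<bar> * - t) * (\<sigma> * a / (1 - \<sigma> * a))"
    unfolding N1_slope_def using norm_cos_mult_real_le[of z t] t
    by (intro norm_triangle_mono) auto
  also have "\<dots> = exp (\<bar>Im z\<bar> * - t) * (1 / (1 - \<sigma> * a))"
    using ratio by (simp add: field_simps)
  finally show ?thesis .
qed

section \<open>Holomorphic dependence on the spectral parameter\<close>

lemma exp_Im_le:
  assumes "z \<in> ball 0 M" "0 \<le> u" "u \<le> a"
  shows "exp (\<bar>Im z\<bar> * u) \<le> exp (M * a)"
proof -
  have "\<bar>Im z\<bar> \<le> M" using assms(1) abs_Im_le_cmod[of z] by simp
  then have "\<bar>Im z\<bar> * u \<le> M * a" using assms by (intro mult_mono) auto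
  then show ?thesis by simp
qed

lemma holomorphic_on_K1:
  assumes "t \<le> x" "x - t \<le> a"
  shows "(\<lambda>z. K1 g z n x t) holomorphic_on ball 0 M"
  using assms
proof (induction n arbitrary: x)
  case 0
  show ?case by (simp add: holomorphic_on_sin_quot)
next
  case (Suc n)
  show ?case unfolding K1_Suc
  proof (rule holomorphic_on_integral[where w = "\<lambda>s. a * exp (M * a) * ((\<sigma> * a) ^ n * a) * \<bar>g s\<bar>"])
    fix s
    show "(\<lambda>z. indicator {t..x} s *\<^sub>R (sin_quot z (x - s) * K1 g z n s t * of_real (g s))) holomorphic_on ball 0 M"
    proof (cases "s \<in> {t..x}")
      case True
      then have "(\<lambda>z. K1 g z n s t) holomorphic_on ball 0 M" using Suc by auto
      then show ?thesis using True by (auto intro!: holomorphic_intros holomorphic_on_sin_quot)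
    qed simp
    fix z assume z: "z \<in> ball (0::complex) M"
    have "cmod (indicator {t..x} s *\<^sub>R (sin_quot z (x - s) * K1 g z n s t * of_real (g s)))
      \<le> (x - t) * exp (\<bar>Im z\<bar> * (x - t)) * ((\<sigma> * a) ^ n * a) * \<bar>g s\<bar>"
      using Suc.prems ratio by (intro K1_integrand_le norm_K1_le) auto
    also have "\<dots> \<le> a * exp (M * a) * ((\<sigma> * a) ^ n * a) * \<bar>g s\<bar>"
      using Suc.prems ratio a_pos exp_Im_le[OF z, of "x - t"] by (intro mult_right_mono mult_mono) auto
    finally show "cmod (indicator {t..x} s *\<^sub>R (sin_quot z (x - s) * K1 g z n s t * of_real (g s)))
      \<le> a * exp (M * a) * ((\<sigma> * a) ^ n * a) * \<bar>g s\<bar>" .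
  qed (use g_int in \<open>auto\<close>)
qed

text \<open>The Neumann series is an integral over counting measure, dominated on
  \<open>ball 0 M\<close> by a geometric series.\<close>

lemma holomorphic_on_N1:
  assumes "t \<le> x" "x - t \<le> a"
  shows "(\<lambda>z. N1 g x t z) holomorphic_on ball 0 M"
proof -
  let ?w = "\<lambda>n. a * exp (M * a) * (\<sigma> * a) ^ n"
  have "(\<lambda>z. \<integral>n. K1 g z n x t \<partial>count_space UNIV) holomorphic_on ball 0 M"
  proof (rule holomorphic_on_integral[where w = ?w])
    show "integrable (count_space UNIV) ?w"
      using ratio a_pos by (simp add: integrable_count_space_nat_iff norm_mult norm_power abs_mult summable_mult summable_geometric)
    fix z n assume z: "z \<in> ball (0::complex) M"
    have "cmod (K1 g z n x t) \<le> (x - t) * exp (\<bar>Im z\<bar> * (x - t)) * (\<sigma> * a) ^ n" by (rule norm_K1_le[OF assms])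
    also have "\<dots> \<le> ?w n"
      using assms ratio a_pos exp_Im_le[OF z, of "x - t"] by (intro mult_right_mono mult_mono) auto
    finally show "cmod (K1 g z n x t) \<le> ?w n" .
  qed (auto intro: holomorphic_on_K1 assms)
  moreover have "(\<integral>n. K1 g z n x t \<partial>count_space UNIV) = N1 g x t z" for z
    unfolding N1_def
    by (rule integral_count_space_nat) (simp add: integrable_count_space_nat_iff summable_K1 assms)
  ultimately show ?thesis by simp
qed

lemma holomorphic_on_N1_slope:
  assumes t: "t \<le> 0" "- t \<le> a"
  shows "(\<lambda>z. N1_slope t z) holomorphic_on ball 0 M"
proof -
  have "(\<lambda>z. \<integral>s. indicator {t..0} s *\<^sub>R (cos (z * of_real s) * N1 g s t z * of_real (g s)) \<partial>lborel) holomorphic_on ball 0 M"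
  proof (rule holomorphic_on_integral[where w = "\<lambda>s. exp (M * a) * (a / (1 - \<sigma> * a)) * \<bar>g s\<bar>"])
    fix s
    show "(\<lambda>z. indicator {t..0} s *\<^sub>R (cos (z * of_real s) * N1 g s t z * of_real (g s))) holomorphic_on ball 0 M"
    proof (cases "s \<in> {t..0}")
      case True
      then have "(\<lambda>z. N1 g s t z) holomorphic_on ball 0 M" using t by (intro holomorphic_on_N1) auto
      then show ?thesis using True by (auto intro!: holomorphic_intros)
    qed simp
    fix z assume z: "z \<in> ball (0::complex) M"
    have "exp (\<bar>Im z\<bar> * - t) * (a / (1 - \<sigma> * a)) * \<bar>g s\<bar> \<le> exp (M * a) * (a / (1 - \<sigma> * a)) * \<bar>g s\<bar>"
      using ratio a_pos exp_Im_le[OF z, of "- t"] t by (intro mult_right_mono) auto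
    then show "cmod (indicator {t..0} s *\<^sub>R (cos (z * of_real s) * N1 g s t z * of_real (g s)))
      \<le> exp (M * a) * (a / (1 - \<sigma> * a)) * \<bar>g s\<bar>"
      by (rule order_trans[OF N1_slope_integrand_le[OF t]])
  qed (use g_int in auto)
  then show ?thesis unfolding N1_slope_def by (auto intro!: holomorphic_intros)
qed

text \<open>Covers the value and the slope at once, with \<open>k\<close> either kernel. The
  exponents over -t and t + a add up to \<open>a\<close>, independently of t.\<close>

lemma boundary_integral:
  fixes k :: "complex \<Rightarrow> real \<Rightarrow> complex"
  assumes k [measurable]: "\<And>z. k z \<in> borel_measurable borel"
    and hol: "\<And>t. t \<in> {-a..0} \<Longrightarrow> (\<lambda>z. k z t) holomorphic_on ball 0 M"
    and k_le: "\<And>z t. t \<in> {-a..0} \<Longrightarrow> cmod (k z t) \<le> C * exp (\<bar>Im z\<bar> * - t)" and C: "0 \<le> C"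
  defines "J \<equiv> \<lambda>z. \<integral>t. indicator {-a..0} t *\<^sub>R (k z t * of_real (g t) * cos (z * of_real (t + a))) \<partial>lborel"
  shows "J holomorphic_on ball 0 M" and "cmod (J z) \<le> \<sigma> * C * exp (\<bar>Im z\<bar> * a)"
proof -
  let ?f = "\<lambda>z t. indicator {-a..0} t *\<^sub>R (k z t * of_real (g t) * cos (z * of_real (t + a)))"
  have le: "cmod (?f z t) \<le> C * exp (\<bar>Im z\<bar> * a) * \<bar>g t\<bar>" for z t
  proof (cases "t \<in> {-a..0}")
    case True
    have "cmod (k z t) * cmod (cos (z * of_real (t + a))) \<le> (C * exp (\<bar>Im z\<bar> * - t)) * exp (\<bar>Im z\<bar> * (t + a))"
      using k_le[OF True] norm_cos_mult_real_le[of z "t + a"] C True by (intro mult_mono) auto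
    also have "\<dots> = C * exp (\<bar>Im z\<bar> * a)" by (simp add: exp_add[symmetric] algebra_simps)
    finally have "cmod (k z t) * cmod (cos (z * of_real (t + a))) * \<bar>g t\<bar> \<le> C * exp (\<bar>Im z\<bar> * a) * \<bar>g t\<bar>"
      by (intro mult_right_mono) auto
    then show ?thesis using True by (simp add: norm_mult ac_simps)
  next
    case False
    then show ?thesis using C by simp
  qed
  show "J holomorphic_on ball 0 M" unfolding J_def
  proof (rule holomorphic_on_integral[where w = "\<lambda>t. C * exp (M * a) * \<bar>g t\<bar>"])
    show "(\<lambda>z. ?f z t) holomorphic_on ball 0 M" for t
    proof (cases "t \<in> {-a..0}")
      case True
      then show ?thesis using hol[OF True] by (auto intro!: holomorphic_intros)
    qed simp
    fix z t assume z: "z \<in> ball (0::complex) M"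
    have "C * exp (\<bar>Im z\<bar> * a) * \<bar>g t\<bar> \<le> C * exp (M * a) * \<bar>g t\<bar>"
      using exp_Im_le[OF z, of a] a_pos C by (intro mult_right_mono mult_left_mono) auto
    then show "cmod (?f z t) \<le> C * exp (M * a) * \<bar>g t\<bar>" by (rule order_trans[OF le])
  qed (use g_int in auto)
  have "cmod (J z) \<le> (\<integral>t. C * exp (\<bar>Im z\<bar> * a) * \<bar>g t\<bar> \<partial>lborel)"
    unfolding J_def using g_int by (intro norm_integral_le le) auto
  also have "\<dots> = \<sigma> * C * exp (\<bar>Im z\<bar> * a)" by (simp add: \<sigma>_def)
  finally show "cmod (J z) \<le> \<sigma> * C * exp (\<bar>Im z\<bar> * a)" .
qed

end

subsection \<open>Square integrable potentials\<close>

lemma has_vector_derivative_cong_within: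
  assumes "\<And>y. y \<in> S \<Longrightarrow> f y = g y" "x \<in> S"
  shows "(f has_vector_derivative d) (at x within S) \<longleftrightarrow> (g has_vector_derivative d) (at x within S)"
  using assms by (metis has_vector_derivative_transform)

text \<open>The iterates see the potential only through integrals over subintervals of {-a..0}, so a
  null set has no effect. The equality holds at every x and t, as is needed for differentiating in
  x.\<close>

lemma K1_cong_AE:
  assumes q: "set_borel_measurable lebesgue {-a..0} q" and g: "g \<in> borel_measurable borel"
    and eq: "AE s in lebesgue. s \<in> {-a..0} \<longrightarrow> q s = g s" and "- a \<le> t" "x \<le> 0"
  shows "K1 q z n x t = K1 g z n x t"
  using \<open>x \<le> 0\<close>
proof (induction n arbitrary: x)
  case 0
  show ?case by simp
next
  case (Suc n)
  have "K1 q z (Suc n) x t = (LINT s:{t..x}|lebesgue. sin_quot z (x - s) * K1 g z n s t * of_real (q s))"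
    unfolding K1.simps using Suc by (intro set_lebesgue_integral_cong) auto
  also have "\<dots> = (LINT s:{t..x}|lebesgue. sin_quot z (x - s) * K1 g z n s t * of_real (g s))"
    unfolding set_lebesgue_integral_def
  proof (rule integral_cong_AE)
    have [measurable]: "(\<lambda>s. K1 g z n s t) \<in> borel_measurable borel"
      using measurable_compose[OF measurable_Pair[OF measurable_ident_sets measurable_const] K1_measurable_and_Suc(1)[OF g], of borel t] by simp
    note g [measurable]
    have "(\<lambda>s. indicator {t..x} s *\<^sub>R (sin_quot z (x - s) * K1 g z n s t)) \<in> borel_measurable lborel"
      by measurable
    then have k: "(\<lambda>s. indicator {t..x} s *\<^sub>R (sin_quot z (x - s) * K1 g z n s t)) \<in> borel_measurable lebesgue"
      by (rule measurable_completion)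
    have "(\<lambda>s. of_real (indicator {-a..0} s *\<^sub>R q s) :: complex) \<in> borel_measurable lebesgue"
      using q unfolding set_borel_measurable_def by measurable
    from borel_measurable_times[OF k this]
    have "(\<lambda>s. (indicator {t..x} s *\<^sub>R (sin_quot z (x - s) * K1 g z n s t)) * of_real (indicator {-a..0} s *\<^sub>R q s)) \<in> borel_measurable lebesgue" .
    also have "(\<lambda>s. (indicator {t..x} s *\<^sub>R (sin_quot z (x - s) * K1 g z n s t)) * of_real (indicator {-a..0} s *\<^sub>R q s))
      = (\<lambda>s. indicator {t..x} s *\<^sub>R (sin_quot z (x - s) * K1 g z n s t * of_real (q s)))"
      using \<open>- a \<le> t\<close> \<open>x \<le> 0\<close> by (auto simp: indicator_def fun_eq_iff)
    finally show "(\<lambda>s. indicator {t..x} s *\<^sub>R (sin_quot z (x - s) * K1 g z n s t * of_real (q s))) \<in> borel_measurable lebesgue" .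
    have "(\<lambda>s. indicator {t..x} s *\<^sub>R (sin_quot z (x - s) * K1 g z n s t * of_real (g s))) \<in> borel_measurable lborel"
      by measurable
    then show "(\<lambda>s. indicator {t..x} s *\<^sub>R (sin_quot z (x - s) * K1 g z n s t * of_real (g s))) \<in> borel_measurable lebesgue"
      by (rule measurable_completion)
    show "AE s in lebesgue. indicator {t..x} s *\<^sub>R (sin_quot z (x - s) * K1 g z n s t * of_real (q s))
      = indicator {t..x} s *\<^sub>R (sin_quot z (x - s) * K1 g z n s t * of_real (g s))"
      using eq by eventually_elim (use \<open>- a \<le> t\<close> \<open>x \<le> 0\<close> in \<open>auto simp: indicator_def\<close>)
  qed
  finally show ?case by simp
qed

text \<open>\<open>U\<close> of the overview. With \<open>endpoint_slope\<close>, which is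
  \<open>V\<close>, it makes up the first column of the determinant, without the factor p.\<close>

definition endpoint_value :: "real \<Rightarrow> (real \<Rightarrow> real) \<Rightarrow> complex \<Rightarrow> complex" where
  "endpoint_value a q z = cos (z * of_real a)
    + (LINT t:{-a..0}|lebesgue. N1 q 0 t z * of_real (q t) * cos (z * of_real (t + a)))"

definition endpoint_slope :: "real \<Rightarrow> (real \<Rightarrow> real) \<Rightarrow> complex \<Rightarrow> complex" where
  "endpoint_slope a q z = - z * sin (z * of_real a)
    + (LINT t:{-a..0}|lebesgue. N1' q 0 t z * of_real (q t) * cos (z * of_real (t + a)))"

lemma square_integrable_imp_integrable:
  assumes "square_integrable_on q {c..d}"
  shows "integrable lebesgue (\<lambda>s. indicator {c..d} s *\<^sub>R q s)"
proof (rule integrable_norm_bound)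
  show "integrable lebesgue (\<lambda>s. indicator {c..d} s + indicator {c..d} s *\<^sub>R (q s)\<^sup>2)"
    using assms by (intro Bochner_Integration.integrable_add integrable_real_indicator)
      (auto simp: square_integrable_on_def set_integrable_def emeasure_lborel_Icc_eq)
  show "(\<lambda>s. indicator {c..d} s *\<^sub>R q s) \<in> borel_measurable lebesgue"
    using assms by (simp add: square_integrable_on_def set_borel_measurable_def)
  fix s
  have "0 \<le> (\<bar>q s\<bar> - 1 / 2)\<^sup>2" by simp
  then have "\<bar>q s\<bar> \<le> 1 + (q s)\<^sup>2" by (simp add: power2_eq_square algebra_simps)
  then show "norm (indicator {c..d} s *\<^sub>R q s) \<le> indicator {c..d} s + indicator {c..d} s *\<^sub>R (q s)\<^sup>2"
    by (simp add: indicator_def)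
qed

lemma borel_representative:
  assumes "square_integrable_on q {c..d}"
  obtains g where "g \<in> borel_measurable borel" "integrable lborel g"
    "AE s in lebesgue. s \<in> {c..d} \<longrightarrow> q s = g s" "(\<integral>s. \<bar>g s\<bar> \<partial>lborel) = (LINT s:{c..d}|lebesgue. \<bar>q s\<bar>)"
proof -
  let ?q = "\<lambda>s. indicator {c..d} s *\<^sub>R q s"
  have q: "integrable lebesgue ?q" by (rule square_integrable_imp_integrable[OF assms])
  then have qm: "?q \<in> borel_measurable lebesgue" by (rule borel_measurable_integrable)
  obtain g :: "real \<Rightarrow> real" where g: "g \<in> borel_measurable lborel" "AE s in lborel. ?q s = g s"
    using completion_ex_borel_measurable_real[OF qm] by auto
  have gm: "g \<in> borel_measurable lebesgue" by (rule measurable_completion[OF g(1)])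
  have ae: "AE s in lebesgue. ?q s = g s" by (rule AE_completion[OF g(2)])
  have "integrable lebesgue g" using integrable_cong_AE[OF qm gm ae] q by simp
  then have gi: "integrable lborel g" using integrable_completion[OF g(1)] by simp
  show thesis
  proof
    show gb [measurable]: "g \<in> borel_measurable borel" using g(1) by simp
    show "AE s in lebesgue. s \<in> {c..d} \<longrightarrow> q s = g s" using ae by eventually_elim auto
    have "(\<integral>s. \<bar>g s\<bar> \<partial>lborel) = (\<integral>s. \<bar>g s\<bar> \<partial>lebesgue)"
      by (intro integral_completion[symmetric]) measurable
    also have "\<dots> = (\<integral>s. \<bar>?q s\<bar> \<partial>lebesgue)"
    proof (rule integral_cong_AE)
      show "AE s in lebesgue. \<bar>g s\<bar> = \<bar>?q s\<bar>" using ae by eventually_elim simp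
    qed (use qm gm in measurable)
    finally show "(\<integral>s. \<bar>g s\<bar> \<partial>lborel) = (LINT s:{c..d}|lebesgue. \<bar>q s\<bar>)"
      by (simp add: set_lebesgue_integral_def abs_mult)
  qed (rule gi)
qed

locale small_square_integrable =
  fixes q :: "real \<Rightarrow> real" and a :: real
  assumes sq: "square_integrable_on q {-a..0}" and a: "0 < a"
    and sm: "sigma1 a q * a < 1"
begin

lemma representative:
  obtains g where "small_potential g a" "small_potential.\<sigma> g = sigma1 a q"
    "AE s in lebesgue. s \<in> {-a..0} \<longrightarrow> q s = g s"
    "\<And>z n t x. - a \<le> t \<Longrightarrow> x \<le> 0 \<Longrightarrow> K1 q z n x t = K1 g z n x t"
proof -
  obtain g where g: "g \<in> borel_measurable borel" "integrable lborel g"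
    "AE s in lebesgue. s \<in> {-a..0} \<longrightarrow> q s = g s" "(\<integral>s. \<bar>g s\<bar> \<partial>lborel) = sigma1 a q"
    using borel_representative[OF sq] unfolding sigma1_def by blast
  have p: "small_potential g a" by standard (use g a sm in auto)
  show thesis
  proof (rule that[OF p _ g(3)])
    show "small_potential.\<sigma> g = sigma1 a q" using g(4) by (simp add: small_potential.\<sigma>_def[OF p])
    show "K1 q z n x t = K1 g z n x t" if "- a \<le> t" "x \<le> 0" for z n t x
      using sq that by (intro K1_cong_AE[OF _ g(1) g(3)]) (auto simp: square_integrable_on_def)
  qed
qed

lemma summable_K1_q:
  assumes "- a \<le> t" "t \<le> x" "x \<le> 0"
  shows "summable (\<lambda>n. K1 q z n x t)"
proof -
  obtain g where g: "small_potential g a" "\<And>z n t x. - a \<le> t \<Longrightarrow> x \<le> 0 \<Longrightarrow> K1 q z n x t = K1 g z n x t"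
    using representative by metis
  interpret small_potential g a by (rule g(1))
  show ?thesis using summable_norm_cancel[OF summable_K1[of t x z]] assms g(2) by simp
qed

lemma N1_differentiable:
  assumes "- a \<le> t" "t < 0"
  shows "((\<lambda>y. N1 q y t z) has_vector_derivative N1' q 0 t z) (at 0 within {t..0})"
proof -
  obtain g where g: "small_potential g a" "\<And>z n t x. - a \<le> t \<Longrightarrow> x \<le> 0 \<Longrightarrow> K1 q z n x t = K1 g z n x t"
    using representative by metis
  interpret small_potential g a by (rule g(1))
  have "((\<lambda>y. N1 q y t z) has_vector_derivative N1_slope t z) (at 0 within {t..0})"
    using N1_has_vector_derivative[of t z] assms g(2)
    by (subst has_vector_derivative_cong_within[of _ _ "\<lambda>y. N1 g y t z"]) (auto simp: N1_def)
  moreover from this have "N1' q 0 t z = N1_slope t z"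
    unfolding N1'_def using vector_derivative_within_cbox[of t 0 0 "\<lambda>y. N1 q y t z"] assms by simp
  ultimately show ?thesis by simp
qed

text \<open>Carried over from the Borel representative. The bound for the value has an extra factor
  \<open>a\<close> because \<open>N1\<close> at x = 0 contains a factor -t <= a, which its slope
  does not.\<close>

lemma endpoint_bounds:
  shows "endpoint_value a q holomorphic_on ball 0 M" and "endpoint_slope a q holomorphic_on ball 0 M"
    and "cmod (endpoint_value a q z - cos (z * of_real a))
      \<le> sigma1 a q * a * exp (\<bar>Im z\<bar> * a) / (1 - sigma1 a q * a)"
    and "cmod (endpoint_slope a q z + z * sin (z * of_real a))
      \<le> sigma1 a q * exp (\<bar>Im z\<bar> * a) / (1 - sigma1 a q * a)"
proof -
  obtain g where g: "small_potential g a" "small_potential.\<sigma> g = sigma1 a q"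
    "AE s in lebesgue. s \<in> {-a..0} \<longrightarrow> q s = g s"
    "\<And>z n t x. - a \<le> t \<Longrightarrow> x \<le> 0 \<Longrightarrow> K1 q z n x t = K1 g z n x t"
    using representative by metis
  interpret small_potential g a by (rule g(1))
  have qm: "set_borel_measurable lebesgue {-a..0} q" using sq by (simp add: square_integrable_on_def)
  have sig: "\<sigma> = sigma1 a q" by (rule g(2))
  have N1: "N1 q y t z = N1 g y t z" if "- a \<le> t" "y \<le> 0" for y t z
    using g(4) that by (simp add: N1_def)
  have N1': "N1' q 0 t z = N1_slope t z" if t: "- a \<le> t" "t < 0" for t z
  proof -
    have "((\<lambda>y. N1 q y t z) has_vector_derivative N1_slope t z) (at 0 within {t..0})"
      using N1_has_vector_derivative[of t z] t N1
      by (subst has_vector_derivative_cong_within[of _ _ "\<lambda>y. N1 g y t z"]) auto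
    then show ?thesis
      unfolding N1'_def using vector_derivative_within_cbox[of t 0 0 "\<lambda>y. N1 q y t z"] t by simp
  qed
  define J where "J = (\<lambda>(k :: complex \<Rightarrow> real \<Rightarrow> complex) z.
      \<integral>t. indicator {-a..0} t *\<^sub>R (k z t * of_real (g t) * cos (z * of_real (t + a))) \<partial>lborel)"
  have transfer: "(LINT t:{-a..0}|lebesgue. h t * of_real (q t) * cos (z * of_real (t + a))) = J k z"
    if k: "k z \<in> borel_measurable borel" and h: "\<And>t. - a \<le> t \<Longrightarrow> t < 0 \<Longrightarrow> h t = k z t" for h k z
  proof -
    note k [measurable]
    let ?G = "\<lambda>t. indicator {-a..0} t *\<^sub>R (k z t * of_real (g t) * cos (z * of_real (t + a)))"
    have "(LINT t:{-a..0}|lebesgue. h t * of_real (q t) * cos (z * of_real (t + a)))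
      = (\<integral>t. (indicator {-a..0} t *\<^sub>R (k z t * cos (z * of_real (t + a)))) * of_real (indicator {-a..0} t *\<^sub>R q t) \<partial>lebesgue)"
      unfolding set_lebesgue_integral_def \<comment> \<open>the point \<open>0\<close> is left out since \<open>N1'\<close> is unspecified there\<close>
      by (rule integral_discrete_difference[where X = "{0}"]) (auto simp: h indicator_def)
    also have "\<dots> = (\<integral>t. ?G t \<partial>lebesgue)"
    proof (rule integral_cong_AE)
      have "(\<lambda>t. indicator {-a..0} t *\<^sub>R (k z t * cos (z * of_real (t + a)))) \<in> borel_measurable lborel" by measurable
      then have k': "(\<lambda>t. indicator {-a..0} t *\<^sub>R (k z t * cos (z * of_real (t + a)))) \<in> borel_measurable lebesgue"
        by (rule measurable_completion)
      have "(\<lambda>t. of_real (indicator {-a..0} t *\<^sub>R q t) :: complex) \<in> borel_measurable lebesgue"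
        using qm unfolding set_borel_measurable_def by measurable
      from borel_measurable_times[OF k' this]
      show "(\<lambda>t. (indicator {-a..0} t *\<^sub>R (k z t * cos (z * of_real (t + a)))) * of_real (indicator {-a..0} t *\<^sub>R q t))
        \<in> borel_measurable lebesgue" .
      have "?G \<in> borel_measurable lborel" by measurable
      then show "?G \<in> borel_measurable lebesgue" by (rule measurable_completion)
      show "AE t in lebesgue. (indicator {-a..0} t *\<^sub>R (k z t * cos (z * of_real (t + a)))) * of_real (indicator {-a..0} t *\<^sub>R q t) = ?G t"
        using g(3) by eventually_elim (auto simp: indicator_def)
    qed
    also have "\<dots> = J k z" unfolding J_def by (rule integral_completion) measurable
    finally show ?thesis .
  qed
  have V: "endpoint_value a q z = cos (z * of_real a) + J (\<lambda>z t. N1 g 0 t z) z" for z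
    unfolding endpoint_value_def using N1 by (subst transfer) auto
  have D: "endpoint_slope a q z = - z * sin (z * of_real a) + J (\<lambda>z t. N1_slope t z) z" for z
    unfolding endpoint_slope_def using N1' by (subst transfer) auto
  have N1_le: "cmod (N1 g 0 t z) \<le> a / (1 - \<sigma> * a) * exp (\<bar>Im z\<bar> * - t)" if "t \<in> {-a..0}" for t z
  proof -
    have "cmod (N1 g 0 t z) \<le> (0 - t) * exp (\<bar>Im z\<bar> * (0 - t)) * (1 / (1 - \<sigma> * a))"
      using that by (intro norm_N1_le) auto
    also have "\<dots> \<le> a * exp (\<bar>Im z\<bar> * (0 - t)) * (1 / (1 - \<sigma> * a))"
      using that ratio by (intro mult_right_mono) auto
    finally show ?thesis by simp
  qed
  have C: "0 \<le> a / (1 - \<sigma> * a)" "0 \<le> 1 / (1 - \<sigma> * a)" using a_pos ratio by auto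
  have N1_hol: "(\<lambda>z. N1 g 0 t z) holomorphic_on ball 0 M" if "t \<in> {-a..0}" for t
    using that by (intro holomorphic_on_N1) auto
  have V': "J (\<lambda>z t. N1 g 0 t z) holomorphic_on ball 0 M"
    "cmod (J (\<lambda>z t. N1 g 0 t z) z) \<le> \<sigma> * (a / (1 - \<sigma> * a)) * exp (\<bar>Im z\<bar> * a)" for z
    unfolding J_def
    by (rule boundary_integral[OF _ N1_hol N1_le C(1)]; simp)+
  have slope_hol: "(\<lambda>z. N1_slope t z) holomorphic_on ball 0 M" if "t \<in> {-a..0}" for t
    using that by (intro holomorphic_on_N1_slope) auto
  have slope_le: "cmod (N1_slope t z) \<le> 1 / (1 - \<sigma> * a) * exp (\<bar>Im z\<bar> * - t)" if "t \<in> {-a..0}" for t z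
    using norm_N1_slope_le[of t z] that by simp
  have D': "J (\<lambda>z t. N1_slope t z) holomorphic_on ball 0 M"
    "cmod (J (\<lambda>z t. N1_slope t z) z) \<le> \<sigma> * (1 / (1 - \<sigma> * a)) * exp (\<bar>Im z\<bar> * a)" for z
    unfolding J_def
    by (rule boundary_integral[OF _ slope_hol slope_le C(2)]; simp)+
  have "endpoint_value a q = (\<lambda>z. cos (z * of_real a) + J (\<lambda>z t. N1 g 0 t z) z)"
    "endpoint_slope a q = (\<lambda>z. - z * sin (z * of_real a) + J (\<lambda>z t. N1_slope t z) z)"
    using V D by auto
  then show "endpoint_value a q holomorphic_on ball 0 M" "endpoint_slope a q holomorphic_on ball 0 M"
    using V'(1) D'(1) by (auto intro!: holomorphic_intros)
  show "cmod (endpoint_value a q z - cos (z * of_real a))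
      \<le> sigma1 a q * a * exp (\<bar>Im z\<bar> * a) / (1 - sigma1 a q * a)"
    using V'(2)[of z] by (simp add: V sig[symmetric])
  show "cmod (endpoint_slope a q z + z * sin (z * of_real a))
      \<le> sigma1 a q * exp (\<bar>Im z\<bar> * a) / (1 - sigma1 a q * a)"
    using D'(2)[of z] by (simp add: D sig[symmetric])
qed

end

subsection \<open>Reflection of the second interval\<close>

lemma set_lebesgue_integral_reflect:
  fixes f :: "real \<Rightarrow> 'a :: euclidean_space"
  shows "(LINT s:{c..d}|lebesgue. f s) = (LINT s:{-d..-c}|lebesgue. f (- s))"
  unfolding set_lebesgue_integral_def
  by (subst lebesgue_integral_real_affine[where c = "-1" and t = 0])
     (auto intro!: Bochner_Integration.integral_cong simp: indicator_def)

lemma sin_quot_minus: "sin_quot z (- u) = - sin_quot z u"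
  by (simp add: sin_quot_def)

text \<open>Each of the n + 1 sine factors is odd under reflection.\<close>

lemma K2_eq_K1_reflect: "K2 q z n x t = (-1) ^ Suc n * K1 (\<lambda>s. q (- s)) z n (- x) (- t)"
proof (induction n arbitrary: x)
  case 0
  show ?case using sin_quot_minus[of z "x - t"] by simp
next
  case (Suc n)
  have "K2 q z (Suc n) x t
      = (LINT s:{-t..-x}|lebesgue. sin_quot z (x + s) * K2 q z n (- s) t * of_real (q (- s)))"
    by (subst K2.simps, subst set_lebesgue_integral_reflect) simp
  also have "\<dots> = (LINT s:{-t..-x}|lebesgue. (-1) ^ Suc (Suc n) *
      (sin_quot z (- x - s) * K1 (\<lambda>s. q (- s)) z n s (- t) * of_real (q (- s))))"
  proof -
    have "sin_quot z (x + s) = - sin_quot z (- x - s)" for s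
      using sin_quot_minus[of z "- x - s"] by (simp add: add.commute)
    then show ?thesis by (intro set_lebesgue_integral_cong) (auto simp: Suc)
  qed
  also have "\<dots> = (-1) ^ Suc (Suc n) * K1 (\<lambda>s. q (- s)) z (Suc n) (- x) (- t)"
    by (simp only: set_integral_mult_right K1.simps)
  finally show ?case .
qed

lemma square_integrable_on_reflect:
  assumes "square_integrable_on q {c..d}"
  shows "square_integrable_on (\<lambda>s. q (- s)) {-d..-c}"
proof -
  have ind: "indicator {c..d} (- s) = (indicator {-d..-c} s :: real)" for s :: real
    by (auto simp: indicator_def)
  have "uminus \<in> lebesgue \<rightarrow>\<^sub>M (lebesgue :: real measure)"
  proof -
    have "(*\<^sub>R) (- 1) = (uminus :: real \<Rightarrow> real)" by (simp add: fun_eq_iff)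
    then show ?thesis using lebesgue_measurable_scaling[where 'a = real and x = "- 1"] by simp
  qed
  from measurable_compose[OF this, of "\<lambda>s. indicator {c..d} s *\<^sub>R q s" borel] assms
  have "set_borel_measurable lebesgue {-d..-c} (\<lambda>s. q (- s))"
    by (simp add: square_integrable_on_def set_borel_measurable_def ind)
  moreover have "set_integrable lebesgue {-d..-c} (\<lambda>s. (q (- s))\<^sup>2)"
    using assms lebesgue_integrable_real_affine_iff[of "-1" "\<lambda>s. indicator {c..d} s *\<^sub>R (q s)\<^sup>2" 0]
    by (simp add: square_integrable_on_def set_integrable_def ind)
  ultimately show ?thesis by (simp add: square_integrable_on_def)
qed

lemma sigma2_eq_sigma1_reflect: "sigma2 b q = sigma1 b (\<lambda>s. q (- s))"
  unfolding sigma1_def sigma2_def by (subst set_lebesgue_integral_reflect) simp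

lemma endpoint_reflect:
  assumes b: "0 < b" and q: "square_integrable_on q {0..b}" and small: "sigma2 b q * b < 1"
  shows "cos (z * of_real b) - (LINT t:{0..b}|lebesgue. N2 q 0 t z * of_real (q t) * cos (z * of_real (b - t)))
      = endpoint_value b (\<lambda>s. q (- s)) z"
    and "z * sin (z * of_real b) - (LINT t:{0..b}|lebesgue. N2' q 0 t z * of_real (q t) * cos (z * of_real (b - t)))
      = - endpoint_slope b (\<lambda>s. q (- s)) z"
proof -
  define r where "r = (\<lambda>s. q (- s))"
  interpret small_square_integrable r b
    by standard (use b square_integrable_on_reflect[OF q] small in \<open>auto simp: r_def sigma2_eq_sigma1_reflect\<close>)
  \<comment> \<open>The sign (-1)^n in \<open>N2\<close> and the sign (-1)^(n+1) of the reflection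
    leave one minus.\<close>
  have N2: "N2 q x t z = - N1 r (- x) (- t) z" if "0 \<le> x" "x \<le> t" "t \<le> b" for x t
  proof -
    have "summable (\<lambda>n. K1 r z n (- x) (- t))" using that by (intro summable_K1_q) auto
    moreover have "(-1) ^ n * K2 q z n x t = - K1 r z n (- x) (- t)" for n
      unfolding K2_eq_K1_reflect r_def by (simp add: mult.assoc[symmetric] power_add[symmetric] flip: power_mult_distrib)
    ultimately show ?thesis unfolding N2_def N1_def by (simp add: suminf_minus)
  qed
  \<comment> \<open>Reversing x contributes a second minus, so the slopes agree without a
    sign.\<close>
  have N2': "N2' q 0 t z = N1' r 0 (- t) z" if t: "0 < t" "t \<le> b" for t
  proof -
    have im: "uminus ` {0..t} = {-t..0}" by (auto simp: image_iff intro: bexI[of _ "- _"])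
    have u: "(uminus has_vector_derivative (-1 :: real)) (at 0 within {0..t})"
      unfolding has_real_derivative_iff_has_vector_derivative[symmetric] by (auto intro!: derivative_eq_intros)
    have "((\<lambda>y. N1 r y (- t) z) has_vector_derivative N1' r 0 (- t) z) (at 0 within {-t..0})"
      using t by (intro N1_differentiable) auto
    then have "((\<lambda>y. N1 r y (- t) z) \<circ> uminus has_vector_derivative (-1) *\<^sub>R N1' r 0 (- t) z) (at 0 within {0..t})"
      using vector_diff_chain_within[OF u, of "\<lambda>y. N1 r y (- t) z"] by (simp add: im)
    then have "((\<lambda>y. - N1 r (- y) (- t) z) has_vector_derivative N1' r 0 (- t) z) (at 0 within {0..t})"
      using has_vector_derivative_minus[of "\<lambda>y. N1 r (- y) (- t) z"] by (force simp: comp_def)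
    then have "((\<lambda>y. N2 q y t z) has_vector_derivative N1' r 0 (- t) z) (at 0 within {0..t})"
      using N2 t by (subst has_vector_derivative_cong_within[of _ _ "\<lambda>y. - N1 r (- y) (- t) z"]) auto
    then show ?thesis
      unfolding N2'_def using vector_derivative_within_cbox[of 0 t 0 "\<lambda>y. N2 q y t z"] t by simp
  qed
  have "(LINT t:{0..b}|lebesgue. N2 q 0 t z * of_real (q t) * cos (z * of_real (b - t)))
      = (LINT t:{-b..0}|lebesgue. - (N1 r 0 t z * of_real (r t) * cos (z * of_real (t + b))))"
    by (subst set_lebesgue_integral_reflect)
       (auto intro!: set_lebesgue_integral_cong simp: N2 r_def add.commute)
  also have "\<dots> = - (LINT t:{-b..0}|lebesgue. N1 r 0 t z * of_real (r t) * cos (z * of_real (t + b)))"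
    unfolding set_lebesgue_integral_def by simp
  finally show "cos (z * of_real b) - (LINT t:{0..b}|lebesgue. N2 q 0 t z * of_real (q t) * cos (z * of_real (b - t)))
      = endpoint_value b (\<lambda>s. q (- s)) z"
    by (simp add: endpoint_value_def r_def)
  have "(LINT t:{0..b}|lebesgue. N2' q 0 t z * of_real (q t) * cos (z * of_real (b - t)))
      = (LINT t:{-b..0}|lebesgue. N2' q 0 (- t) z * of_real (q (- t)) * cos (z * of_real (b + t)))"
    by (subst set_lebesgue_integral_reflect) simp
  \<comment> \<open>The point 0 is left out, because there the derivatives are unspecified.\<close>
  also have "\<dots> = (LINT t:{-b..0}|lebesgue. N1' r 0 t z * of_real (r t) * cos (z * of_real (t + b)))"
    unfolding set_lebesgue_integral_def
    by (rule integral_discrete_difference[where X = "{0}"])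
       (auto simp: N2' r_def add.commute indicator_def)
  finally show "z * sin (z * of_real b) - (LINT t:{0..b}|lebesgue. N2' q 0 t z * of_real (q t) * cos (z * of_real (b - t)))
      = - endpoint_slope b (\<lambda>s. q (- s)) z"
    by (simp add: endpoint_slope_def r_def)
qed

lemma char_perturbed_eq:
  assumes "0 < b" "square_integrable_on q2 {0..b}" "sigma2 b q2 * b < 1"
  shows "char_perturbed a b p q1 q2 z
    = - (of_real p)\<^sup>2 * endpoint_value a q1 z * endpoint_slope b (\<lambda>s. q2 (- s)) z
      - endpoint_value b (\<lambda>s. q2 (- s)) z * endpoint_slope a q1 z"
  unfolding char_perturbed_def endpoint_reflect[OF assms] det_2
  by (simp add: endpoint_value_def[of a] endpoint_slope_def[of a] power2_eq_square algebra_simps)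

subsection \<open>Localisation of the zeros\<close>

text \<open>A direct substitute for self-adjointness. A zero satisfies sin w = k sin (rho w) with
  |k| < 1 and |rho| <= 1. If Im w were nonzero, comparing real and imaginary parts and using that
  cosh and |sinh| increase in |Im w| would bound |sin (Re w)| and |cos (Re w)| by |k| times those at
  rho Re w; squaring and adding gives 1 <= k^2.\<close>

lemma secular_zero_real:
  assumes AB: "A + B = 1" "0 < A" "0 < B" and c: "0 < c" and zero: "secular A B c w = 0"
  shows "Im w = 0"
proof (rule ccontr)
  assume y: "Im w \<noteq> 0"
  define \<rho> where "\<rho> = B - A"
  define k where "k = - (c - 1) / (c + 1)"
  have \<rho>: "\<bar>\<rho>\<bar> \<le> 1" using AB by (auto simp: \<rho>_def)
  have k: "\<bar>k\<bar> < 1" using c by (auto simp: k_def abs_if field_simps)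
  have "of_real ((c + 1) / 2) * sin w + of_real ((c - 1) / 2) * sin (of_real \<rho> * w) = 0"
    using zero by (simp only: secular_eq[OF AB(1)] \<rho>_def)
  moreover have "of_real ((c + 1) / 2) * of_real k = - complex_of_real ((c - 1) / 2)"
    unfolding of_real_mult[symmetric] of_real_minus[symmetric] of_real_eq_iff using c by (simp add: k_def field_simps)
  ultimately have "of_real ((c + 1) / 2) * (sin w - of_real k * sin (of_real \<rho> * w)) = 0"
    by (simp only: right_diff_distrib mult.assoc[symmetric]) simp
  moreover have "complex_of_real ((c + 1) / 2) \<noteq> 0" using c unfolding of_real_eq_0_iff by simp
  ultimately have eq: "sin w = of_real k * sin (of_real \<rho> * w)" by simp
  have re: "sin (Re w) * cosh (Im w) = k * (sin (\<rho> * Re w) * cosh (\<rho> * Im w))"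
    using arg_cong[OF eq, of Re] by (simp add: Re_sin cosh_def)
  have im: "cos (Re w) * sinh (Im w) = k * (cos (\<rho> * Re w) * sinh (\<rho> * Im w))"
    using arg_cong[OF eq, of Im] by (simp add: Im_sin sinh_def)
  have le: "\<bar>\<rho> * Im w\<bar> \<le> \<bar>Im w\<bar>" using \<rho> by (simp add: abs_mult mult_left_le_one_le)
  have ch: "cosh (\<rho> * Im w) \<le> cosh (Im w)"
    using cosh_real_nonneg_le_iff[of "\<bar>\<rho> * Im w\<bar>" "\<bar>Im w\<bar>"] le by (simp only: cosh_real_abs)
  have sh: "\<bar>sinh (\<rho> * Im w)\<bar> \<le> \<bar>sinh (Im w)\<bar>"
    using sinh_real_le_iff[of "\<bar>\<rho> * Im w\<bar>" "\<bar>Im w\<bar>"] le by (simp only: sinh_real_abs)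
  have "\<bar>sin (Re w)\<bar> * cosh (Im w) = \<bar>k\<bar> * \<bar>sin (\<rho> * Re w)\<bar> * cosh (\<rho> * Im w)"
    using arg_cong[OF re, of abs] by (simp add: abs_mult)
  also have "\<dots> \<le> \<bar>k\<bar> * \<bar>sin (\<rho> * Re w)\<bar> * cosh (Im w)" using ch by (intro mult_left_mono) auto
  finally have s: "\<bar>sin (Re w)\<bar> \<le> \<bar>k\<bar> * \<bar>sin (\<rho> * Re w)\<bar>" by simp
  have "\<bar>cos (Re w)\<bar> * \<bar>sinh (Im w)\<bar> = \<bar>k\<bar> * \<bar>cos (\<rho> * Re w)\<bar> * \<bar>sinh (\<rho> * Im w)\<bar>"
    using arg_cong[OF im, of abs] by (simp add: abs_mult)
  also have "\<dots> \<le> \<bar>k\<bar> * \<bar>cos (\<rho> * Re w)\<bar> * \<bar>sinh (Im w)\<bar>" using sh by (intro mult_left_mono) auto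
  finally have cs: "\<bar>cos (Re w)\<bar> \<le> \<bar>k\<bar> * \<bar>cos (\<rho> * Re w)\<bar>" using y by simp
  have "1 = (sin (Re w))\<^sup>2 + (cos (Re w))\<^sup>2" by simp
  also have "\<dots> \<le> (\<bar>k\<bar> * \<bar>sin (\<rho> * Re w)\<bar>)\<^sup>2 + (\<bar>k\<bar> * \<bar>cos (\<rho> * Re w)\<bar>)\<^sup>2"
    using power_mono[OF s, of 2] power_mono[OF cs, of 2] by (intro add_mono) auto
  also have "\<dots> = k\<^sup>2 * ((sin (\<rho> * Re w))\<^sup>2 + (cos (\<rho> * Re w))\<^sup>2)" by (simp only: power_mult_distrib power2_abs distrib_left)
  also have "\<dots> = k\<^sup>2" by simp
  also have "\<dots> < 1" using k by (simp add: abs_square_less_1)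
  finally show False by simp
qed

lemma sigma1_nonneg: "0 \<le> sigma1 a q"
  unfolding sigma1_def set_lebesgue_integral_def by (intro integral_nonneg_AE) auto

text \<open>Scaling by L = a + b leads to \<open>secular_perturbation_lt\<close>; the characteristic
  function divided by z and by its slope is then close enough to z - z0 for the count. Both
  potentials live to the left of 0 and \<open>c\<close> is any number >= 1, so the two intervals may
  be entered in either order.\<close>

lemma ex1_zero_near_secular_zero:
  fixes a b c R :: real and q1 q2 :: "real \<Rightarrow> real" and z0 :: complex
  assumes ab: "0 < a" "0 < b" "a \<noteq> b" and c: "1 \<le> c"
    and sq: "square_integrable_on q1 {-a..0}" "square_integrable_on q2 {-b..0}"
    and pos: "0 < sigma1 a q1 + sigma1 b q2"
    and wt: "2 * (sigma1 a q1 * a + sigma1 b q2 * b) + 4 / pi * (a + b) * (sigma1 a q1 + sigma1 b q2)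
      \<le> 2 * gap (a / (a + b)) (b / (a + b)) * (R * (a + b))"
    and Rc: "c * (R * (a + b)) \<le> gap (a / (a + b)) (b / (a + b))"
    and zero: "secular (a / (a + b)) (b / (a + b)) c (of_real (a + b) * z0) = 0" and z0: "z0 \<noteq> 0"
  shows "\<exists>!z. cmod (z - z0) < R \<and>
    - of_real c * endpoint_value a q1 z * endpoint_slope b q2 z - endpoint_value b q2 z * endpoint_slope a q1 z = 0"
proof -
  define L where "L = a + b"
  define A where "A = a / L"
  define B where "B = b / L"
  define s1 where "s1 = sigma1 a q1"
  define s2 where "s2 = sigma1 b q2"
  have L: "0 < L" using ab by (simp add: L_def)
  have AB: "A + B = 1" "0 < A" "0 < B" "A \<noteq> B"
    using ab L by (simp_all add: A_def B_def add_divide_distrib[symmetric]) (simp add: L_def)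
  have AL: "A * L = a" "B * L = b" using L by (auto simp: A_def B_def)
  have s: "0 \<le> s1" "0 \<le> s2" "0 < s1 + s2" using sigma1_nonneg pos by (auto simp: s1_def s2_def)
  have gb: "0 < gap A B" "gap A B \<le> 1 / 4" using gap_bounds[OF AB] by auto
  have wt': "2 * (s1 * a + s2 * b) + 4 / pi * L * (s1 + s2) \<le> 2 * gap A B * (R * L)"
    using wt by (simp only: s1_def s2_def A_def B_def L_def)
  have Rc': "c * (R * L) \<le> gap A B" using Rc by (simp only: A_def B_def L_def)
  have sab: "0 \<le> s1 * a" "0 \<le> s2 * b" using s ab by auto
  have pos': "0 < 4 / pi * L * (s1 + s2)" using L s pi_gt_zero by (intro mult_pos_pos divide_pos_pos) auto
  have "2 * (s1 * a + s2 * b) \<le> 2 * gap A B * (R * L)"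
    by (rule order_trans[OF add_increasing2[OF less_imp_le[OF pos'] order_refl] wt'])
  moreover have "0 < 2 * gap A B * (R * L)"
    by (rule less_le_trans[OF add_nonneg_pos[OF _ pos'] wt']) (use sab in simp)
  ultimately have RL: "0 < R * L" using gb by (simp add: zero_less_mult_iff)
  then have R: "0 < R" using L by (simp add: zero_less_mult_iff)
  have RLg: "R * L \<le> gap A B" using Rc' mult_right_mono[OF c, of "R * L"] RL by simp
  have "2 * gap A B * (R * L) \<le> 2 * (1 / 4) * (1 / 4)" using gb RLg RL by (intro mult_mono) auto
  with \<open>2 * (s1 * a + s2 * b) \<le> 2 * gap A B * (R * L)\<close>
  have "2 * (s1 * a + s2 * b) \<le> 2 * (1 / 4) * (1 / 4)" by (rule order_trans)
  then have sm: "s1 * a < 1" "s2 * b < 1" using sab by auto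
  interpret e1: small_square_integrable q1 a by standard (use ab sq sm in \<open>auto simp: s1_def\<close>)
  interpret e2: small_square_integrable q2 b by standard (use ab sq sm in \<open>auto simp: s2_def\<close>)

  have zero': "secular A B c (of_real L * z0) = 0" using zero by (simp only: A_def B_def L_def)
  define x where "x = L * Re z0"
  have "Im (of_real L * z0) = 0" using secular_zero_real[OF AB(1-3) _ zero'] c by simp
  then have z0_real: "z0 = of_real (Re z0)" using L by (simp add: complex_eq_iff)
  have xz: "of_real x = of_real L * z0" by (subst z0_real) (simp add: x_def)
  have x0: "x \<noteq> 0" using xz z0 L by auto
  have zx: "secular A B c (of_real x) = 0" using zero' by (simp only: xz)
  have xpi: "pi / 2 \<le> \<bar>x\<bar>"
    using zx unfolding secular_of_real of_real_eq_0_iff by (intro secular_zero_ge_half_pi[OF AB(1-3) _ _ x0]) (use c in auto)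
  have nz0: "\<bar>x\<bar> = L * cmod z0" using arg_cong[OF xz, of cmod] L by (simp add: norm_mult)
  \<comment> \<open>R L <= 1/4 < pi / 2 <= L |z0|, so division by z is harmless on a ball larger
    than the circle.\<close>
  have Rz0: "R < cmod z0"
  proof -
    have "R * L < cmod z0 * L" using RLg gb xpi nz0 pi_gt3 by (simp add: mult.commute)
    then show ?thesis using L by simp
  qed
  define k where "k = secular_slope A B c x"
  define \<Delta> where "\<Delta> = (\<lambda>z. - of_real c * endpoint_value a q1 z * endpoint_slope b q2 z - endpoint_value b q2 z * endpoint_slope a q1 z)"
  have near: "cmod (\<Delta> z / z - of_real (k * L) * (z - z0)) < \<bar>k\<bar> * (R * L)" if z: "cmod (z - z0) = R" for z
  proof -
    have z_nz: "z \<noteq> 0" using z Rz0 by auto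
    define w where "w = of_real L * z"
    have wx: "w - of_real x = of_real L * (z - z0)" by (simp add: w_def xz algebra_simps)
    have wR: "cmod (w - of_real x) = R * L" using z L by (simp add: wx norm_mult)
    have arg: "of_real A * w = z * of_real a" "of_real B * w = z * of_real b"
      by (simp_all add: w_def AL[symmetric])
    have "Im z0 = 0" by (subst z0_real) simp
    then have im: "\<bar>Im z\<bar> \<le> R" using abs_Im_le_cmod[of "z - z0"] z by simp
    have ex: "exp (\<bar>Im z\<bar> * l) \<le> exp (R * l)" if "0 < l" for l using im that by (simp add: mult_right_mono)
    have val: "cmod (endpoint_value l q z - cos (of_real l' * w)) \<le> s * L * l' * exp (R * L * l') / (1 - s * L * l')"
      if "cmod (endpoint_value l q z - cos (z * of_real l)) \<le> s * l * exp (\<bar>Im z\<bar> * l) / (1 - s * l)"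
        "0 \<le> s" "0 < l" "s * l < 1" "l' * L = l" "of_real l' * w = z * of_real l" for l l' s q
    proof -
      have "s * l * exp (\<bar>Im z\<bar> * l) / (1 - s * l) \<le> s * l * exp (R * l) / (1 - s * l)"
        using that ex[of l] by (intro divide_right_mono mult_left_mono) auto
      also have "\<dots> = s * L * l' * exp (R * L * l') / (1 - s * L * l')"
        by (simp add: that(5)[symmetric] ac_simps)
      finally show ?thesis using that(1,6) by simp
    qed
    have slp: "cmod (endpoint_slope l q z / z + sin (of_real l' * w)) \<le> s * L * exp (R * L * l') / (1 - s * L * l') / cmod w"
      if "cmod (endpoint_slope l q z + z * sin (z * of_real l)) \<le> s * exp (\<bar>Im z\<bar> * l) / (1 - s * l)"
        "0 \<le> s" "0 < l" "s * l < 1" "l' * L = l" "of_real l' * w = z * of_real l" for l l' s q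
    proof -
      have "s * exp (\<bar>Im z\<bar> * l) / (1 - s * l) \<le> s * exp (R * l) / (1 - s * l)"
        using that ex[of l] by (intro divide_right_mono mult_left_mono) auto
      then have "cmod (endpoint_slope l q z + z * sin (z * of_real l)) / cmod z \<le> s * exp (R * l) / (1 - s * l) / cmod z"
        using that(1) by (intro divide_right_mono) auto
      also have "\<dots> = s * L * exp (R * L * l') / (1 - s * L * l') / cmod w"
        using L by (simp add: that(5)[symmetric] w_def norm_mult ac_simps)
      also have "cmod (endpoint_slope l q z + z * sin (z * of_real l)) / cmod z
          = cmod (endpoint_slope l q z / z + sin (of_real l' * w))"
        unfolding that(6) norm_divide[symmetric] using z_nz by (simp add: add_divide_distrib)
      finally show ?thesis .
    qed
    have "cmod (- of_real c * endpoint_value a q1 z * (endpoint_slope b q2 z / z) - endpoint_value b q2 z * (endpoint_slope a q1 z / z)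
        - of_real (secular_slope A B c x) * (w - of_real x)) < \<bar>secular_slope A B c x\<bar> * (R * L)"
    proof (rule secular_perturbation_lt[OF AB c _ _ _ _ Rc' zx x0 wR, where ?S1.0 = "s1 * L" and ?S2.0 = "s2 * L"])
      show "0 \<le> s1 * L" "0 \<le> s2 * L" "0 < s1 * L + s2 * L"
        using s L by (auto simp: distrib_right[symmetric])
      have "s1 * L * (2 * A + 4 / pi) + s2 * L * (2 * B + 4 / pi)
          = 2 * (s1 * (A * L) + s2 * (B * L)) + 4 / pi * L * (s1 + s2)"
        by (simp add: algebra_simps add_divide_distrib)
      then show "s1 * L * (2 * A + 4 / pi) + s2 * L * (2 * B + 4 / pi) \<le> 2 * gap A B * (R * L)"
        using wt' by (simp only: AL)
    qed (intro val slp; use e1.endpoint_bounds e2.endpoint_bounds s ab sm AL arg in \<open>simp add: s1_def s2_def\<close>)+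
    moreover have "\<Delta> z / z = - of_real c * endpoint_value a q1 z * (endpoint_slope b q2 z / z) - endpoint_value b q2 z * (endpoint_slope a q1 z / z)"
      by (simp add: \<Delta>_def diff_divide_distrib)
    ultimately show ?thesis by (simp add: k_def wx mult.assoc)
  qed
  \<comment> \<open>With zero slope the strict estimate \<open>near\<close> would bound a modulus by
    less than 0.\<close>
  have k: "k \<noteq> 0"
  proof
    assume "k = 0"
    then show False using near[of "z0 + of_real R"] R by simp
  qed
  define F where "F = (\<lambda>z. \<Delta> z / z / of_real (k * L))"
  have "\<exists>!z. cmod (z - z0) < R \<and> F z = 0"
  proof (rule ex1_zero_near_linear[OF _ R Rz0])
    have "ball z0 (cmod z0) \<subseteq> ball 0 (2 * cmod z0)"
    proof
      fix z assume "z \<in> ball z0 (cmod z0)"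
      then show "z \<in> ball 0 (2 * cmod z0)"
        using norm_triangle_ineq[of "z - z0" z0] by (simp add: dist_norm norm_minus_commute)
    qed
    then have "f holomorphic_on ball z0 (cmod z0)" if "f holomorphic_on ball 0 (2 * cmod z0)" for f
      using that holomorphic_on_subset by blast
    note h = this[OF e1.endpoint_bounds(1)] this[OF e1.endpoint_bounds(2)] this[OF e2.endpoint_bounds(1)] this[OF e2.endpoint_bounds(2)]
    show "F holomorphic_on ball z0 (cmod z0)"
      unfolding F_def \<Delta>_def using k L
      by (intro holomorphic_intros h) auto
    show "cmod (F z - (z - z0)) < R" if z: "cmod (z - z0) = R" for z
    proof -
      have "F z - (z - z0) = (\<Delta> z / z - of_real (k * L) * (z - z0)) / of_real (k * L)"
        using k L by (simp add: F_def diff_divide_distrib)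
      then have "cmod (F z - (z - z0)) = cmod (\<Delta> z / z - of_real (k * L) * (z - z0)) / (\<bar>k\<bar> * L)"
        using L by (simp add: norm_divide norm_mult)
      also have "\<dots> < \<bar>k\<bar> * (R * L) / (\<bar>k\<bar> * L)"
        using near[OF z] k L by (intro divide_strict_right_mono) auto
      finally show ?thesis using k L by simp
    qed
  qed
  moreover have "(cmod (z - z0) < R \<and> F z = 0) \<longleftrightarrow> (cmod (z - z0) < R \<and> \<Delta> z = 0)" for z
    using k L Rz0 by (auto simp: F_def)
  ultimately show ?thesis by (simp add: \<Delta>_def)
qed

lemma sigma1_pos:
  assumes sq: "square_integrable_on q {-a..0}" and nz: "\<not> (AE t in lebesgue_on {-a..0}. q t = 0)"
  shows "0 < sigma1 a q"
proof (rule ccontr)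
  assume "\<not> 0 < sigma1 a q"
  then have "sigma1 a q = 0" using sigma1_nonneg[of a q] by simp
  then have 0: "(\<integral>s. \<bar>indicator {-a..0} s *\<^sub>R q s\<bar> \<partial>lebesgue) = 0"
    by (simp add: sigma1_def set_lebesgue_integral_def abs_mult)
  have "integrable lebesgue (\<lambda>s. \<bar>indicator {-a..0} s *\<^sub>R q s\<bar>)"
    using square_integrable_imp_integrable[OF sq] by (rule integrable_abs)
  from integral_nonneg_eq_0_iff_AE[OF this] 0
  have "AE s in lebesgue. indicator {-a..0} s *\<^sub>R q s = 0" by simp
  then have "AE s in lebesgue. s \<in> {-a..0} \<longrightarrow> q s = 0" by eventually_elim auto
  then show False using nz by (simp add: AE_restrict_space_iff)
qed

lemma char_unperturbed_eq_secular:
  assumes "0 < a + b"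
  shows "char_unperturbed a b p z = z * secular (a / (a + b)) (b / (a + b)) (p\<^sup>2) (of_real (a + b) * z)"
proof -
  have "of_real (l / (a + b)) * (of_real (a + b) * z) = z * of_real l" for l
    unfolding of_real_divide using assms by (simp del: of_real_add)
  then show ?thesis by (simp only: char_unperturbed_def secular_def) (simp add: algebra_simps)
qed

lemma secular_swap:
  assumes "c \<noteq> 0"
  shows "secular B A (1 / c) w = secular A B c w / of_real c"
  using assms by (simp add: secular_def add_divide_distrib ac_simps)

text \<open>For potentials vanishing almost everywhere the radius would be 0 and the neighborhood
  empty. The origin is a double zero of the unperturbed function, which is z times a function with a
  simple zero there; this is why z0 is taken nonzero.\<close>

theorem theorem4:
  fixes a b p :: real and q1 q2 :: "real \<Rightarrow> real" and z0 :: complex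
  assumes "a > 0" and "b > 0" and "p \<noteq> 0"
    and "square_integrable_on q1 {-a..0}"
    and "square_integrable_on q2 {0..b}"
    and perturbed: "\<not> ((AE t in lebesgue_on {-a..0}. q1 t = 0) \<and> (AE t in lebesgue_on {0..b}. q2 t = 0))"
    and "2 * delta1 a b q1 q2 + 4 * delta2 a b q1 q2 * (a + b) / (pi - 2 * r_par a b p)
           < (1 + p\<^sup>2) * ((rho_par a b)\<^sup>2 * (r_par a b p)\<^sup>2 / (1 + \<bar>k_par p\<bar>))"
    and "char_unperturbed a b p z0 = 0" and nontrivial: "z0 \<noteq> 0"
  shows "\<exists>!z. cmod (z - z0)
             < (2 * delta1 a b q1 q2 + 4 * delta2 a b q1 q2 * (a + b) / (pi - 2 * r_par a b p))
               / ((1 + p\<^sup>2) * (a + b) * \<bar>rho_par a b\<bar> * r_par a b p)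
           \<and> char_perturbed a b p q1 q2 z = 0"
proof -
  define L where "L = a + b"
  define P where "P = p\<^sup>2"
  define q2' where "q2' = (\<lambda>s. q2 (- s))"
  define s1 where "s1 = sigma1 a q1"
  define s2 where "s2 = sigma1 b q2'"
  define \<rho> where "\<rho> = \<bar>rho_par a b\<bar>"
  define r where "r = r_par a b p"
  define M where "M = 2 * delta1 a b q1 q2 + 4 * delta2 a b q1 q2 * L / (pi - 2 * r)"
  define R where "R = M / ((1 + P) * L * \<rho> * r)"
  define g where "g = gap (a / L) (b / L)"
  have L: "0 < L" and P: "0 < P" using assms(1-3) by (auto simp: L_def P_def)
  have s2: "sigma2 b q2 = s2" by (simp add: s2_def q2'_def sigma2_eq_sigma1_reflect)
  have s_nn: "0 \<le> s1" "0 \<le> s2" by (simp_all add: s1_def s2_def sigma1_nonneg)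
  have sq2: "square_integrable_on q2' {-b..0}"
    using square_integrable_on_reflect[OF assms(5)] by (simp add: q2'_def)
  have s_pos: "0 < s1 + s2"
  proof (cases "AE t in lebesgue_on {-a..0}. q1 t = 0")
    case False
    then show ?thesis using sigma1_pos[OF assms(4)] s_nn by (simp add: s1_def)
  next
    case True
    have "\<not> (AE t in lebesgue_on {-b..0}. q2' t = 0)"
    proof
      assume "AE t in lebesgue_on {-b..0}. q2' t = 0"
      then have "(\<integral>t. \<bar>indicator {-b..0} t *\<^sub>R q2' t\<bar> \<partial>lebesgue) = 0"
        by (intro integral_eq_zero_AE) (auto simp: AE_restrict_space_iff indicator_def)
      then have "s2 = 0"
        by (simp add: s2_def sigma1_def set_lebesgue_integral_def abs_mult)
      then have "(\<integral>t. \<bar>indicator {0..b} t *\<^sub>R q2 t\<bar> \<partial>lebesgue) = 0"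
        using s2 by (simp add: sigma2_def set_lebesgue_integral_def abs_mult)
      then have "AE t in lebesgue. indicator {0..b} t *\<^sub>R q2 t = 0"
        using integral_nonneg_eq_0_iff_AE[OF integrable_abs[OF square_integrable_imp_integrable[OF assms(5)]]] by simp
      then have "AE t in lebesgue. t \<in> {0..b} \<longrightarrow> q2 t = 0" by eventually_elim auto
      then show False using True perturbed by (simp add: AE_restrict_space_iff)
    qed
    then show ?thesis using sigma1_pos[OF sq2] s_nn by (simp add: s2_def)
  qed
  have \<rho>_eq: "\<rho> = \<bar>b - a\<bar> / L" using L by (simp add: \<rho>_def rho_par_def L_def add.commute)
  have \<rho>_bounds: "0 \<le> \<rho>" "\<rho> < 1" using assms(1,2) L by (auto simp: \<rho>_eq L_def field_simps)
  have g_eq: "g = \<rho> * (1 - \<rho>)"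
  proof -
    have "\<bar>b / L - a / L\<bar> = \<rho>" using L by (simp add: \<rho>_eq diff_divide_distrib[symmetric])
    then show ?thesis by (simp add: g_def gap_def)
  qed
  have r_eq: "r = (1 - \<rho>) * (1 - \<bar>k_par p\<bar>)" by (simp add: r_def r_par_def \<rho>_def)
  have k_lt: "\<bar>k_par p\<bar> < 1" using P by (auto simp: k_par_def P_def[symmetric] abs_if field_simps)
  have r: "0 < r" "r \<le> 1"
    using \<rho>_bounds k_lt by (auto simp: r_eq intro!: mult_le_one)
  have pr: "0 < pi - 2 * r" "pi - 2 * r \<le> pi" using r pi_gt3 by auto
  have d1: "s1 * a + s2 * b \<le> delta1 a b q1 q2"
  proof -
    have "s1 * a * 1 \<le> s1 * a * exp (s1 * a)" "s2 * b * 1 \<le> s2 * b * exp (s2 * b)"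
      using s_nn assms(1,2) by (intro mult_left_mono; simp)+
    then show ?thesis by (simp add: delta1_def s2 s1_def[symmetric])
  qed
  have d2: "s1 + s2 \<le> delta2 a b q1 q2"
  proof -
    have "s1 * 1 \<le> s1 * exp (s1 * a)" "s2 * 1 \<le> s2 * exp (s2 * b)"
      using s_nn assms(1,2) by (intro mult_left_mono; simp)+
    moreover have "0 \<le> s1 * s2 * (a + b) * exp (s1 * a + s2 * b)" using s_nn assms(1,2) by simp
    ultimately show ?thesis by (simp add: delta2_def s2 s1_def[symmetric])
  qed
  \<comment> \<open>Origin of the constant 4/pi: pi - 2 r is at most pi, and the exponential factors
    in delta1 and delta2 are at least 1.\<close>
  have wt: "2 * (s1 * a + s2 * b) + 4 / pi * L * (s1 + s2) \<le> M"
  proof -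
    have "4 / pi * L * (s1 + s2) = (s1 + s2) * (4 * L) / pi" by simp
    also have "\<dots> \<le> delta2 a b q1 q2 * (4 * L) / (pi - 2 * r)"
      using d2 pr s_nn L by (intro frac_le mult_right_mono mult_nonneg_nonneg) auto
    finally show ?thesis using d1 by (simp add: M_def mult.commute mult.left_commute)
  qed
  have pos: "0 < 4 / pi * L * (s1 + s2)" using L s_pos pi_gt_zero by (intro mult_pos_pos divide_pos_pos) auto
  have sab: "0 \<le> s1 * a" "0 \<le> s2 * b" using s_nn assms(1,2) by auto
  have M_ge: "2 * (s1 * a + s2 * b) \<le> M"
    by (rule order_trans[OF add_increasing2[OF less_imp_le[OF pos] order_refl] wt])
  have M: "0 < M"
    by (rule less_le_trans[OF add_nonneg_pos[OF _ pos] wt]) (use sab in simp)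
  have hyp: "M < (1 + P) * (\<rho>\<^sup>2 * r\<^sup>2 / (1 + \<bar>k_par p\<bar>))"
    using assms(7) by (simp add: M_def L_def P_def r_def \<rho>_def)
  \<comment> \<open>For rho = 0 the hypothesis would force M < 0. In particular a and b
    differ.\<close>
  have \<rho>: "0 < \<rho>"
  proof (rule ccontr)
    assume "\<not> 0 < \<rho>"
    then have "\<rho> = 0" using \<rho>_bounds by simp
    then show False using hyp M by simp
  qed
  then have ab: "a \<noteq> b" by (auto simp: \<rho>_eq)
  have g: "0 < g" using \<rho> \<rho>_bounds by (simp add: g_eq)
  have RL: "R * L = M / ((1 + P) * \<rho> * r)" using L by (simp add: R_def)
  have "secular (a / L) (b / L) P (of_real L * z0) = 0"
    using assms(8) nontrivial L char_unperturbed_eq_secular[of a b p z0] by (simp add: L_def P_def)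
  note zero = this
  let ?U1 = "endpoint_value a q1" and ?U2 = "endpoint_value b q2'" and ?V1 = "endpoint_slope a q1" and ?V2 = "endpoint_slope b q2'"
  \<comment> \<open>As |rho| r = g (1 - |k|), the bound in the hypothesis and the denominator of the
    scaled radius both split into a power of \<open>g\<close> and a factor depending on p
    only.\<close>
  have r2: "(1 + P) * (\<rho>\<^sup>2 * r\<^sup>2 / (1 + \<bar>k_par p\<bar>)) = g\<^sup>2 * ((1 + P) * (1 - \<bar>k_par p\<bar>)\<^sup>2 / (1 + \<bar>k_par p\<bar>))"
    by (simp add: g_eq r_eq power_mult_distrib)
  have rg: "(1 + P) * \<rho> * r = g * ((1 + P) * (1 - \<bar>k_par p\<bar>))"
    by (simp add: g_eq r_eq)
  have "\<exists>!z. cmod (z - z0) < R \<and> - of_real P * ?U1 z * ?V2 z - ?U2 z * ?V1 z = 0"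
    and small: "s2 * b < 1"
  proof -
    show "\<exists>!z. cmod (z - z0) < R \<and> - of_real P * ?U1 z * ?V2 z - ?U2 z * ?V1 z = 0"
    proof (cases "1 \<le> P")
      case True
      have k: "\<bar>k_par p\<bar> = (P - 1) / (1 + P)"
      proof -
        have "k_par p = - ((P - 1) / (1 + P))" by (simp add: k_par_def P_def minus_divide_left)
        then show ?thesis using True by simp
      qed
      have k1: "(1 + P) * (1 - \<bar>k_par p\<bar>) = 2" using P by (simp add: k field_simps)
      have k2: "(1 + P) * (1 - \<bar>k_par p\<bar>)\<^sup>2 / (1 + \<bar>k_par p\<bar>) = 2 / P"
      proof -
        have m: "1 - \<bar>k_par p\<bar> = 2 / (1 + P)" "1 + \<bar>k_par p\<bar> = 2 * P / (1 + P)" using P by (simp_all add: k field_simps)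
        have "D * (2 / D)\<^sup>2 / (2 * P / D) = 2 / P" if "0 < D" for D
          using that P by (simp add: power2_eq_square field_simps)
        then show ?thesis unfolding m using P by simp
      qed
      \<comment> \<open>The scaled radius is M / (2 g), so the hypothesis M < 2 g^2 / P reads P R L
        < g.\<close>
      have RL2: "2 * g * (R * L) = M" using g by (simp add: RL rg k1)
      have "P * (2 * g * (R * L)) \<le> P * (g\<^sup>2 * (2 / P))" unfolding RL2 using hyp P unfolding r2 k2 by (intro mult_left_mono) auto
      then have Rc: "P * (R * L) \<le> g" using P g by (simp add: power2_eq_square)
      show ?thesis
        using ex1_zero_near_secular_zero[OF assms(1,2) ab True assms(4) sq2, of R z0] s_pos wt Rc zero nontrivial RL2
        by (simp add: s1_def s2_def L_def g_def)
    next
      case False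
      then have k: "\<bar>k_par p\<bar> = (1 - P) / (1 + P)" using P by (simp add: k_par_def P_def[symmetric])
      have k1: "(1 + P) * (1 - \<bar>k_par p\<bar>) = 2 * P" using P by (simp add: k field_simps)
      have k2: "(1 + P) * (1 - \<bar>k_par p\<bar>)\<^sup>2 / (1 + \<bar>k_par p\<bar>) = 2 * P\<^sup>2"
      proof -
        have m: "1 - \<bar>k_par p\<bar> = 2 * P / (1 + P)" "1 + \<bar>k_par p\<bar> = 2 / (1 + P)" using P by (simp_all add: k field_simps)
        show ?thesis unfolding m using P by (simp add: power2_eq_square)
      qed
      \<comment> \<open>Now the scaled radius is M / (2 P g), and the hypothesis M < 2 P^2 g^2 gives
        R L / P < g, the requirement for c = 1 / P with the intervals exchanged.\<close>
      have RL2: "P * (2 * g * (R * L)) = M" using g P by (simp add: RL rg k1)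
      have "M \<le> g\<^sup>2 * (2 * P\<^sup>2)" using hyp unfolding r2 k2 by simp
      then have "1 / P * (R * L) \<le> g" using P g unfolding RL2[symmetric] by (simp add: power2_eq_square field_simps)
      note Rc = this
      have "P * (2 * g * (R * L)) \<le> 1 * (2 * g * (R * L))"
        using False g RL M \<rho> r P by (intro mult_right_mono) auto
      then have wt': "2 * (s2 * b + s1 * a) + 4 / pi * L * (s2 + s1) \<le> 2 * g * (R * L)"
        using wt RL2 by (simp add: add.commute)
      have zero': "secular (b / L) (a / L) (1 / P) (of_real L * z0) = 0"
        using zero P by (simp add: secular_swap)
      have "\<exists>!z. cmod (z - z0) < R \<and> - of_real (1 / P) * ?U2 z * ?V1 z - ?U1 z * ?V2 z = 0"
        using ex1_zero_near_secular_zero[OF assms(2,1) ab[symmetric] _ sq2 assms(4), of "1 / P" R z0] s_pos wt' Rc zero' nontrivial False P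
        by (simp add: s1_def s2_def L_def g_def gap_commute add.commute)
      moreover have "- of_real (1 / P) * ?U2 z * ?V1 z - ?U1 z * ?V2 z = 0
          \<longleftrightarrow> - of_real P * ?U1 z * ?V2 z - ?U2 z * ?V1 z = 0" for z
      proof -
        have "- of_real (1 / P) * ?U2 z * ?V1 z - ?U1 z * ?V2 z = (- of_real P * ?U1 z * ?V2 z - ?U2 z * ?V1 z) / of_real P"
          using P by (simp add: field_simps)
        then show ?thesis using P by (simp only: divide_eq_0_iff of_real_eq_0_iff) simp
      qed
      ultimately show ?thesis by (simp only:)
    qed
    have "2 * (s2 * b) \<le> M" using M_ge sab by simp
    \<comment> \<open>Needed for s2 b < 1, which \<open>char_perturbed_eq\<close> requires: g <= 1,
      and the factor depending on p is at most 2.\<close>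
    moreover have "M < 2"
    proof -
      have "g \<le> 1" unfolding g_eq using \<rho>_bounds by (intro mult_le_one) auto
      then have "g\<^sup>2 \<le> 1" using g by (simp add: power_le_one)
      moreover have "(1 + P) * (1 - \<bar>k_par p\<bar>)\<^sup>2 / (1 + \<bar>k_par p\<bar>) \<le> 2"
      proof -
        have "(1 + P) * (1 - \<bar>k_par p\<bar>) \<le> (1 + P) * (1 + k_par p)"
          using P abs_ge_minus_self[of "k_par p"] by (intro mult_left_mono) auto
        also have "\<dots> = 2" using P by (simp add: k_par_def P_def[symmetric] field_simps)
        finally have "(1 + P) * (1 - \<bar>k_par p\<bar>) \<le> 2" .
        then have "(1 + P) * (1 - \<bar>k_par p\<bar>) * (1 - \<bar>k_par p\<bar>) \<le> 2 * 1" using k_lt P by (intro mult_mono) auto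
        then have "(1 + P) * (1 - \<bar>k_par p\<bar>)\<^sup>2 / (1 + \<bar>k_par p\<bar>) \<le> 2 * 1 / 1"
          using P k_lt by (intro frac_le) (auto simp: power2_eq_square mult.assoc)
        then show ?thesis by simp
      qed
      moreover have "0 \<le> (1 + P) * (1 - \<bar>k_par p\<bar>)\<^sup>2 / (1 + \<bar>k_par p\<bar>)" using P by simp
      ultimately have "g\<^sup>2 * ((1 + P) * (1 - \<bar>k_par p\<bar>)\<^sup>2 / (1 + \<bar>k_par p\<bar>)) \<le> 1 * 2" by (intro mult_mono) auto
      then show ?thesis using hyp unfolding r2 by simp
    qed
    ultimately show "s2 * b < 1" by simp
  qed
  moreover have "char_perturbed a b p q1 q2 z = - of_real P * ?U1 z * ?V2 z - ?U2 z * ?V1 z" for z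
    using char_perturbed_eq[OF assms(2,5), of a p q1 z] small by (simp add: s2 q2'_def P_def)
  ultimately show ?thesis
    by (simp add: R_def M_def L_def P_def \<rho>_def r_def)
qed

end
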